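(* Let $K$ be any field and $n\ge 6$ an integer. Let $I_n(K)$ be the kernel of the $K$-algebra homomorphism $K[y_{ij}\mid 1\le j<i\le n]\to K[s_1,\dots,s_n,t_1,\dots,t_n]$ determined by $y_{ij}\mapsto s_is_j+t_it_j$. Then $I_n(K)$ is generated, as an ideal, by the orbits of the pentad $P$ and of the off-diagonal minor $M$ under the symmetric group $\operatorname{Sym}(n)$.
   Context: Identify $y_{ji}$ with $y_{ij}$ for $j<i$. The pentad $P$ is the polynomial with integer coefficients $P=\frac{1}{10}\sum_{\pi\in\operatorname{Sym}(5)}\operatorname{sgn}(\pi)\,y_{\pi(1)\pi(2)}y_{\pi(2)\pi(3)}y_{\pi(3)\pi(4)}y_{\pi(4)\pi(5)}y_{\pi(5)\pi(1)}$ (each monomial occurs 10 times, so all coefficients of $P$ are $\pm1$), regarded in $K$ via $\mathbb{Z}\to K$. The off-diagonal minor $M$ is the determinant of the $3\times 3$ matrix $(y_{ij})_{i\in\{4,5,6\},\,j\in\{1,2,3\}}$. $\operatorname{Sym}(n)$ acts by $\sigma y_{ij}=y_{\sigma(i)\sigma(j)}$ (using the identification $y_{ji}=y_{ij}$). *)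

theory Defs
  imports "HOL-Library.Poly_Mapping" "HOL-Combinatorics.Permutations"
begin

text \<open>Multivariate polynomials over a coefficient ring 'a in variables of type 'v are
  represented as finitely supported maps from monomials (exponent vectors 'v =>0 nat)
  to coefficients; multiplication is the convolution product of Poly_Mapping.\<close>

type_synonym ('v, 'a) mpoly = "('v \<Rightarrow>\<^sub>0 nat) \<Rightarrow>\<^sub>0 'a"

definition Var :: "'v \<Rightarrow> ('v, 'a::comm_ring_1) mpoly" where
  "Var v = Poly_Mapping.single (Poly_Mapping.single v 1) 1"

definition Const :: "'a::comm_ring_1 \<Rightarrow> ('v, 'a) mpoly" where
  "Const c = Poly_Mapping.single 0 c"

definition psubst :: "('v \<Rightarrow> ('w, 'a::comm_ring_1) mpoly) \<Rightarrow> ('v, 'a) mpoly \<Rightarrow> ('w, 'a) mpoly" where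
  "psubst \<phi> f = (\<Sum>m\<in>Poly_Mapping.keys f.
      Const (Poly_Mapping.lookup f m) * (\<Prod>v\<in>Poly_Mapping.keys m. \<phi> v ^ Poly_Mapping.lookup m v))"

text \<open>Variable y_ij (1 <= j < i <= n) is encoded as the pair (i,j); y_ji is identified with y_ij.\<close>
definition yv :: "nat \<Rightarrow> nat \<Rightarrow> nat \<times> nat" where
  "yv i j = (max i j, min i j)"

definition Yvars :: "nat \<Rightarrow> (nat \<times> nat) set" where
  "Yvars n = {(i, j). 1 \<le> j \<and> j < i \<and> i \<le> n}"

definition Rpoly :: "nat \<Rightarrow> (nat \<times> nat, 'a::comm_ring_1) mpoly set" where
  "Rpoly n = {f. \<forall>m\<in>Poly_Mapping.keys f. Poly_Mapping.keys m \<subseteq> Yvars n}"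

text \<open>Target ring K[s_1..s_n, t_1..t_n]: s_i is (False, i), t_i is (True, i).\<close>
definition st_map :: "nat \<times> nat \<Rightarrow> (bool \<times> nat, 'a::comm_ring_1) mpoly" where
  "st_map v = (case v of (i, j) \<Rightarrow>
      Var (False, i) * Var (False, j) + Var (True, i) * Var (True, j))"

definition In_ideal :: "nat \<Rightarrow> (nat \<times> nat, 'a::comm_ring_1) mpoly set" where
  "In_ideal n = {f \<in> Rpoly n. psubst st_map f = 0}"

definition gen_ideal :: "'b::comm_ring_1 set \<Rightarrow> 'b set \<Rightarrow> 'b set" where
  "gen_ideal R S = {f. \<exists>G c. finite G \<and> G \<subseteq> S \<and> (\<forall>g\<in>G. c g \<in> R) \<and> f = (\<Sum>g\<in>G. c g * g)}"

definition sym_act :: "(nat \<Rightarrow> nat) \<Rightarrow> (nat \<times> nat, 'a::comm_ring_1) mpoly \<Rightarrow> (nat \<times> nat, 'a) mpoly" where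
  "sym_act \<sigma> f = psubst (\<lambda>(i, j). Var (yv (\<sigma> i) (\<sigma> j))) f"

definition orbit_Sym :: "nat \<Rightarrow> (nat \<times> nat, 'a::comm_ring_1) mpoly \<Rightarrow> (nat \<times> nat, 'a) mpoly set" where
  "orbit_Sym n f = {sym_act \<sigma> f | \<sigma>. \<sigma> permutes {1..n}}"

text \<open>Pentad: the integer polynomial (1/10) sum_pi sgn(pi) y_{pi1 pi2} ... y_{pi5 pi1}
  (each monomial occurs 10 times, so the division is exact), mapped into K.\<close>
definition pentad_Z :: "(nat \<times> nat, int) mpoly" where
  "pentad_Z = Poly_Mapping.map (\<lambda>c. c div 10)
     (\<Sum>\<pi>\<in>{\<pi>. \<pi> permutes {1..5::nat}}.
        Const (sign \<pi>) * (\<Prod>k\<in>{1..5::nat}. Var (yv (\<pi> k) (\<pi> (k mod 5 + 1)))))"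

definition pentad :: "(nat \<times> nat, 'a::comm_ring_1) mpoly" where
  "pentad = Poly_Mapping.map of_int pentad_Z"

definition offdiag_minor :: "(nat \<times> nat, 'a::comm_ring_1) mpoly" where
  "offdiag_minor = (\<Sum>p\<in>{p. p permutes {1..3::nat}}.
      Const (of_int (sign p)) * (\<Prod>r\<in>{1..3::nat}. Var (yv (r + 3) (p r))))"

end

theory Submission
  imports Defs "HOL-Computational_Algebra.Polynomial"
begin

text \<open>
  Adjoin loop variables $y_{kk}$, mapped to $s_k^2 + t_k^2$. With all loops present the kernel is
  generated by the $3 \times 3$ minors: reducing by their diagonal terms leaves monomials that are
  unions of two chains, and these have linearly independent images, since a chain is the unique
  monomial of least weight among those with the same vertex degrees.

  The loops are then removed one at a time. A minor containing $y_{kk}$ has the form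
  $y_{kk} D - N$ with $D$ a tetrad avoiding $k$. An element of the larger ideal that is free of
  $y_{kk}$ lies in the smaller ideal $J$ as soon as $D \mapsto N$ extends to a well-defined
  linear map modulo $J$ on the ideal of tetrads, that is, as soon as the syzygies of the tetrads
  carry over. The linear syzygies carry over because of the remaining minors; the Koszul syzygies
  $N D' - N' D$ are consequences of the minors, except when $D$ and $D'$ live on the same four
  vertices, where they are the pentads.
\<close>

section \<open>Polynomials\<close>

text \<open>The map D |-> N is obtained without listing the syzygies of the tetrads. The ideal of
  tetrads is spanned by differences M - M' of monomials related by one exchange, with M = X y_ab
  y_cd and M' = X y_ac y_bd. So it suffices to find a function psi on monomials, with psi(M) -
  psi(M') = X N modulo J for every exchange; being consistent around all cycles of exchanges is the
  same as respecting all syzygies. Such a psi comes from recursion on the degree: two vertices o1,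
  o2 are chosen, one exchange splits off the edge o1 o2, and psi is applied to the rest. The pair
  depends only on the vertex degrees, which exchanges preserve.

  The obstacle is the missing loops: exchanging o1 u, o2 v creates the edge u v, which does not
  exist when u = v has no loop. Hence the degrees of o1 and o2 together must exceed that of every
  vertex without a loop, and coincidences of vertices cause most of the case distinctions.

  The map must also send J into J. Only then can the coefficients of the powers of y_kk be compared
  from the top down, each membership in J giving the next.\<close>

abbreviation mon :: "('v \<Rightarrow>\<^sub>0 nat) \<Rightarrow> ('v, 'a::comm_ring_1) mpoly" where
  "mon m \<equiv> Poly_Mapping.single m 1"

text \<open>The coefficient map \<open>h\<close> and the values \<open>F\<close> on monomials are
  independent of each other, so one formula covers the ring homomorphisms \<open>evalp\<close> and
  the map \<open>Psi\<close>, which is only additive.\<close>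

definition lin :: "('a::zero \<Rightarrow> 'r::comm_ring_1) \<Rightarrow> ('m \<Rightarrow> 'r) \<Rightarrow> ('m \<Rightarrow>\<^sub>0 'a) \<Rightarrow> 'r" where
  "lin h F f = (\<Sum>m\<in>Poly_Mapping.keys f. h (Poly_Mapping.lookup f m) * F m)"

lemma lin_superset:
  assumes "h 0 = 0" "finite S" "Poly_Mapping.keys f \<subseteq> S"
  shows "lin h F f = (\<Sum>m\<in>S. h (Poly_Mapping.lookup f m) * F m)"
  unfolding lin_def by (rule sum.mono_neutral_left) (use assms in \<open>auto simp: in_keys_iff\<close>)

lemma lin_add:
  assumes "h 0 = 0" "\<And>x y. h (x + y) = h x + h y"
  shows "lin h F (f + g) = lin h F f + lin h F g"
proof -
  let ?S = "Poly_Mapping.keys f \<union> Poly_Mapping.keys g"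
  have "Poly_Mapping.keys (f + g) \<subseteq> ?S" by (rule Poly_Mapping.keys_add)
  then show ?thesis
    using assms by (simp add: lin_superset[where S = ?S] lookup_add distrib_right sum.distrib)
qed

lemma lin_zero [simp]: "lin h F 0 = 0"
  by (simp add: lin_def)

lemma lin_single: "h 0 = 0 \<Longrightarrow> lin h F (Poly_Mapping.single m c) = h c * F m"
  by (cases "c = 0") (simp_all add: lin_def)

lemma lin_sum:
  assumes "h 0 = 0" "\<And>x y. h (x + y) = h x + h y"
  shows "lin h F (\<Sum>i\<in>I. f i) = (\<Sum>i\<in>I. lin h F (f i))"
  by (induction I rule: infinite_finite_induct) (simp_all add: lin_add assms)

lemma monomial_expansion:
  fixes f :: "'m \<Rightarrow>\<^sub>0 'a::comm_monoid_add"
  shows "f = (\<Sum>m\<in>Poly_Mapping.keys f. Poly_Mapping.single m (Poly_Mapping.lookup f m))"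
proof (rule poly_mapping_eqI)
  fix k
  have "(\<Sum>m\<in>Poly_Mapping.keys f. Poly_Mapping.lookup f m when m = k) = Poly_Mapping.lookup f k"
    by (auto simp: when_def in_keys_iff)
  then show "Poly_Mapping.lookup f k = Poly_Mapping.lookup
      (\<Sum>m\<in>Poly_Mapping.keys f. Poly_Mapping.single m (Poly_Mapping.lookup f m)) k"
    by (simp add: lookup_sum lookup_single)
qed

lemma single_conv_Const_mon: "Poly_Mapping.single m c = Const c * mon m"
  by (simp add: Const_def mult_single)

section \<open>Evaluation homomorphisms\<close>

definition mval :: "('v \<Rightarrow> 'r::comm_ring_1) \<Rightarrow> ('v \<Rightarrow>\<^sub>0 nat) \<Rightarrow> 'r" where
  "mval \<phi> m = (\<Prod>v\<in>Poly_Mapping.keys m. \<phi> v ^ Poly_Mapping.lookup m v)"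

lemma mval_superset:
  assumes "finite S" "Poly_Mapping.keys m \<subseteq> S"
  shows "mval \<phi> m = (\<Prod>v\<in>S. \<phi> v ^ Poly_Mapping.lookup m v)"
  unfolding mval_def by (rule prod.mono_neutral_left) (use assms in \<open>auto simp: in_keys_iff\<close>)

lemma mval_add: "mval \<phi> (m + m') = mval \<phi> m * mval \<phi> m'"
proof -
  let ?S = "Poly_Mapping.keys m \<union> Poly_Mapping.keys m'"
  have "Poly_Mapping.keys (m + m') \<subseteq> ?S" by (rule Poly_Mapping.keys_add)
  then show ?thesis
    by (simp add: mval_superset[where S = ?S] lookup_add power_add prod.distrib)
qed

lemma mval_zero [simp]: "mval \<phi> 0 = 1"
  by (simp add: mval_def)

lemma mval_single [simp]: "mval \<phi> (Poly_Mapping.single v (Suc 0)) = \<phi> v"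
  by (simp add: mval_def)

text \<open>Three coefficient maps occur: \<open>Const\<close> gives \<open>psubst\<close>,
  \<open>[:Const c:]\<close> reads a polynomial as univariate in one loop, and
  \<open>Const (of_int c)\<close> passes from integer coefficients to \<open>'a\<close>.\<close>

definition evalp :: "('a::comm_ring_1 \<Rightarrow> 'r::comm_ring_1) \<Rightarrow> ('v \<Rightarrow> 'r) \<Rightarrow> ('v, 'a) mpoly \<Rightarrow> 'r" where
  "evalp h \<phi> f = lin h (mval \<phi>) f"

lemma psubst_conv_evalp: "psubst \<phi> f = evalp Const \<phi> f"
  by (simp add: psubst_def evalp_def lin_def mval_def)

locale coeff_hom =
  fixes h :: "'a::comm_ring_1 \<Rightarrow> 'r::comm_ring_1"
  assumes hom_one: "h 1 = 1"
    and hom_add: "h (x + y) = h x + h y"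
    and hom_mult: "h (x * y) = h x * h y"
begin

lemma hom_zero: "h 0 = 0"
  using hom_add[of 0 0] by simp

lemma evalp_add: "evalp h \<phi> (f + g) = evalp h \<phi> f + evalp h \<phi> g"
  by (simp add: evalp_def lin_add hom_zero hom_add)

lemma evalp_zero: "evalp h \<phi> 0 = 0"
  by (simp add: evalp_def)

lemma evalp_uminus: "evalp h \<phi> (- f) = - evalp h \<phi> f"
  using evalp_add[of \<phi> f "- f"] by (simp add: evalp_zero minus_unique)

lemma evalp_diff: "evalp h \<phi> (f - g) = evalp h \<phi> f - evalp h \<phi> g"
  using evalp_add[of \<phi> f "- g"] by (simp add: evalp_uminus)

lemma evalp_sum: "evalp h \<phi> (\<Sum>i\<in>I. f i) = (\<Sum>i\<in>I. evalp h \<phi> (f i))"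
  by (simp add: evalp_def lin_sum hom_zero hom_add)

lemma evalp_single: "evalp h \<phi> (Poly_Mapping.single m c) = h c * mval \<phi> m"
  by (simp add: evalp_def lin_single hom_zero)

lemma evalp_mon: "evalp h \<phi> (mon m) = mval \<phi> m"
  by (simp add: evalp_single hom_one)

lemma evalp_mult: "evalp h \<phi> (f * g) = evalp h \<phi> f * evalp h \<phi> g"
proof -
  have "evalp h \<phi> (f * g) = evalp h \<phi>
      ((\<Sum>m\<in>Poly_Mapping.keys f. Poly_Mapping.single m (Poly_Mapping.lookup f m)) *
       (\<Sum>m\<in>Poly_Mapping.keys g. Poly_Mapping.single m (Poly_Mapping.lookup g m)))"
    by (simp only: monomial_expansion[symmetric])
  also have "\<dots> = (\<Sum>m\<in>Poly_Mapping.keys f. \<Sum>m'\<in>Poly_Mapping.keys g.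
      (h (Poly_Mapping.lookup f m) * mval \<phi> m) * (h (Poly_Mapping.lookup g m') * mval \<phi> m'))"
    by (simp add: sum_product evalp_sum mult_single evalp_single hom_mult mval_add ac_simps)
  also have "\<dots> = evalp h \<phi> f * evalp h \<phi> g"
    by (simp add: evalp_def lin_def sum_product)
  finally show ?thesis .
qed

lemma evalp_one: "evalp h \<phi> 1 = 1"
  using evalp_mon[of \<phi> 0] by simp

lemma evalp_prod: "evalp h \<phi> (\<Prod>i\<in>I. f i) = (\<Prod>i\<in>I. evalp h \<phi> (f i))"
  by (induction I rule: infinite_finite_induct) (simp_all add: evalp_one evalp_mult)

lemma evalp_Var: "evalp h \<phi> (Var v) = \<phi> v"
  using evalp_mon[of \<phi> "Poly_Mapping.single v 1"] by (simp add: Var_def)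

lemma evalp_Const: "evalp h \<phi> (Const c) = h c"
  by (simp add: Const_def evalp_single)

lemmas evalp_simps = evalp_add evalp_diff evalp_uminus evalp_mult evalp_Var evalp_Const
  evalp_zero evalp_one evalp_sum evalp_prod

end

lemma coeff_hom_Const: "coeff_hom (Const :: 'a::comm_ring_1 \<Rightarrow> ('v, 'a) mpoly)"
  by unfold_locales (simp_all add: Const_def single_add mult_single)

interpretation psub: coeff_hom "Const :: 'a::comm_ring_1 \<Rightarrow> ('v, 'a) mpoly"
  by (rule coeff_hom_Const)

section \<open>Polynomials in a subset of the variables, and ideals generated there\<close>

definition polyring :: "'v set \<Rightarrow> ('v, 'a::comm_ring_1) mpoly set" where
  "polyring W = {f. \<forall>m\<in>Poly_Mapping.keys f. Poly_Mapping.keys m \<subseteq> W}"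

lemma polyring_zero [simp]: "0 \<in> polyring W"
  by (simp add: polyring_def)

lemma polyring_add: "f \<in> polyring W \<Longrightarrow> g \<in> polyring W \<Longrightarrow> f + g \<in> polyring W"
  unfolding polyring_def using Poly_Mapping.keys_add[of f g] by blast

lemma polyring_uminus: "f \<in> polyring W \<Longrightarrow> - f \<in> polyring W"
  by (auto simp: polyring_def in_keys_iff)

lemma polyring_diff: "f \<in> polyring W \<Longrightarrow> g \<in> polyring W \<Longrightarrow> f - g \<in> polyring W"
  using polyring_add[of f W "- g"] polyring_uminus[of g W] by simp

lemma polyring_mult: "f \<in> polyring W \<Longrightarrow> g \<in> polyring W \<Longrightarrow> f * g \<in> polyring W"
proof -
  assume f: "f \<in> polyring W" and g: "g \<in> polyring W"
  have "Poly_Mapping.keys m \<subseteq> W" if m: "m \<in> Poly_Mapping.keys (f * g)" for m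
  proof -
    obtain a b where "m = a + b" "a \<in> Poly_Mapping.keys f" "b \<in> Poly_Mapping.keys g"
      using m Poly_Mapping.keys_mult[of f g] by auto
    then show ?thesis
      using f g Poly_Mapping.keys_add[of a b] unfolding polyring_def by blast
  qed
  then show ?thesis by (simp add: polyring_def)
qed

lemma polyring_single: "Poly_Mapping.keys m \<subseteq> W \<Longrightarrow> Poly_Mapping.single m c \<in> polyring W"
  by (cases "c = 0") (simp_all add: polyring_def)

lemma polyring_Const: "Const c \<in> polyring W"
  by (simp add: Const_def polyring_single)

lemma polyring_one [simp]: "1 \<in> polyring W"
  using polyring_single[of 0 W 1] by simp

lemma polyring_Var: "v \<in> W \<Longrightarrow> Var v \<in> polyring W"
  by (simp add: Var_def polyring_single)

lemma polyring_mono: "W \<subseteq> W' \<Longrightarrow> polyring W \<subseteq> polyring W'"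
  unfolding polyring_def by blast

lemma polyring_induct [consumes 1, case_names zero add mon]:
  assumes f: "f \<in> polyring W"
    and zero: "P 0"
    and add: "\<And>f g. P f \<Longrightarrow> P g \<Longrightarrow> P (f + g)"
    and mon: "\<And>c m. Poly_Mapping.keys m \<subseteq> W \<Longrightarrow> P (Const c * mon m)"
  shows "P f"
proof -
  have "P (\<Sum>m\<in>S. Poly_Mapping.single m (Poly_Mapping.lookup f m))"
    if "S \<subseteq> Poly_Mapping.keys f" for S
    using that
  proof (induction S rule: infinite_finite_induct)
    case (insert m S)
    then have "Poly_Mapping.keys m \<subseteq> W" using f by (auto simp: polyring_def)
    then have "P (Poly_Mapping.single m (Poly_Mapping.lookup f m))"
      using mon by (metis single_conv_Const_mon)
    then show ?case using insert add by simp
  qed (simp_all add: zero)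
  from this[OF order.refl] show ?thesis by (subst monomial_expansion)
qed

text \<open>Adding one multiple at a time makes closure properties and inclusions accessible to rule
  induction; \<open>gen_ideal_conv_ideal_of\<close> is the link to \<open>gen_ideal\<close>.\<close>

inductive_set ideal_of :: "'r::comm_ring_1 set \<Rightarrow> 'r set \<Rightarrow> 'r set" for R S where
  zero: "0 \<in> ideal_of R S"
| step: "f \<in> ideal_of R S \<Longrightarrow> r \<in> R \<Longrightarrow> s \<in> S \<Longrightarrow> f + r * s \<in> ideal_of R S"

lemma ideal_of_gen: "1 \<in> R \<Longrightarrow> s \<in> S \<Longrightarrow> s \<in> ideal_of R S"
  using ideal_of.step[OF ideal_of.zero, of 1 R s S] by simp

lemma ideal_of_add:
  assumes "f \<in> ideal_of R S" "g \<in> ideal_of R S"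
  shows "f + g \<in> ideal_of R S"
  using assms(2)
proof (induction g rule: ideal_of.induct)
  case (step g r s)
  then show ?case by (metis add.assoc ideal_of.step)
qed (simp add: assms(1))

lemma ideal_of_mult:
  assumes "f \<in> ideal_of R S" "r \<in> R" "\<And>x y. x \<in> R \<Longrightarrow> y \<in> R \<Longrightarrow> x * y \<in> R"
  shows "r * f \<in> ideal_of R S"
  using assms(1)
proof (induction f rule: ideal_of.induct)
  case (step f t s)
  have "r * f + (r * t) * s \<in> ideal_of R S"
    using step assms by (intro ideal_of.step) auto
  then show ?case by (simp add: algebra_simps)
qed (simp add: ideal_of.zero)

lemma ideal_of_subset:
  assumes "\<And>f g. f \<in> I \<Longrightarrow> g \<in> I \<Longrightarrow> f + g \<in> I" "0 \<in> I"
    and "\<And>r s. r \<in> R \<Longrightarrow> s \<in> S \<Longrightarrow> r * s \<in> I"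
  shows "ideal_of R S \<subseteq> I"
proof
  fix f assume "f \<in> ideal_of R S"
  then show "f \<in> I" by (induction f rule: ideal_of.induct) (use assms in auto)
qed

lemma gen_ideal_conv_ideal_of:
  assumes "0 \<in> R" and addR: "\<And>x y. x \<in> R \<Longrightarrow> y \<in> R \<Longrightarrow> x + y \<in> R"
  shows "gen_ideal R S = ideal_of R S"
proof
  show "gen_ideal R S \<subseteq> ideal_of R S"
  proof
    fix f assume "f \<in> gen_ideal R S"
    then obtain G c where G: "finite G" "G \<subseteq> S" "\<forall>g\<in>G. c g \<in> R" "f = (\<Sum>g\<in>G. c g * g)"
      by (auto simp: gen_ideal_def)
    then have "(\<Sum>g\<in>G. c g * g) \<in> ideal_of R S"
    proof (induction G arbitrary: f rule: finite_induct)
      case (insert g G)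
      then have "(\<Sum>g\<in>G. c g * g) + c g * g \<in> ideal_of R S"
        by (intro ideal_of.step) auto
      then show ?case using insert by (simp add: add.commute)
    qed (simp add: ideal_of.zero)
    then show "f \<in> ideal_of R S" using G by simp
  qed
  show "ideal_of R S \<subseteq> gen_ideal R S"
  proof
    fix f assume "f \<in> ideal_of R S"
    then show "f \<in> gen_ideal R S"
    proof (induction f rule: ideal_of.induct)
      case zero
      show ?case unfolding gen_ideal_def by (rule CollectI, rule exI[of _ "{}"]) simp
    next
      case (step f r s)
      then obtain G c where G: "finite G" "G \<subseteq> S" "\<forall>g\<in>G. c g \<in> R" "f = (\<Sum>g\<in>G. c g * g)"
        by (auto simp: gen_ideal_def)
      \<comment> \<open>\<open>gen_ideal\<close> lists each generator once. If \<open>s\<close>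
        already occurs in \<open>G\<close>, its old coefficient is increased by \<open>r\<close>;
        the 0 stands for a generator not listed so far.\<close>
      define c' where "c' = c(s := (if s \<in> G then c s else 0) + r)"
      have "(\<Sum>g\<in>insert s G. c' g * g) = c' s * s + (\<Sum>g\<in>G - {s}. c' g * g)"
        using G(1) by (simp add: sum.insert_remove)
      also have "(\<Sum>g\<in>G - {s}. c' g * g) = (\<Sum>g\<in>G - {s}. c g * g)"
        by (rule sum.cong) (auto simp: c'_def)
      also have "c' s * s + \<dots> = f + r * s"
        using G(1) by (auto simp: c'_def G(4) sum.remove[of G s] algebra_simps)
      finally have eq: "f + r * s = (\<Sum>g\<in>insert s G. c' g * g)" by simp
      show ?case
        unfolding gen_ideal_def
        by (rule CollectI, rule exI[of _ "insert s G"], rule exI[of _ c'])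
          (use G step assms eq in \<open>auto simp: c'_def\<close>)
    qed
  qed
qed

lemma ideal_of_polyring_mult:
  "f \<in> ideal_of (polyring W) S \<Longrightarrow> r \<in> polyring W \<Longrightarrow> r * f \<in> ideal_of (polyring W) S"
  by (rule ideal_of_mult) (auto intro: polyring_mult)

lemma ideal_of_polyring_uminus:
  "f \<in> ideal_of (polyring W) S \<Longrightarrow> - f \<in> ideal_of (polyring W) S"
  using ideal_of_polyring_mult[of f W S "- 1"] by (simp add: polyring_uminus)

lemma ideal_of_polyring_diff:
  "f \<in> ideal_of (polyring W) S \<Longrightarrow> g \<in> ideal_of (polyring W) S \<Longrightarrow> f - g \<in> ideal_of (polyring W) S"
  using ideal_of_add[of f "polyring W" S "- g"] ideal_of_polyring_uminus[of g W S] by simp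

text \<open>The vertex degrees \<open>dg\<close>, the total degree \<open>tot\<close> and the weight
  \<open>wt\<close> are all instances and inherit additivity from here.\<close>

definition wsum :: "('v \<Rightarrow> nat) \<Rightarrow> ('v \<Rightarrow>\<^sub>0 nat) \<Rightarrow> nat" where
  "wsum g m = (\<Sum>v\<in>Poly_Mapping.keys m. Poly_Mapping.lookup m v * g v)"

lemma wsum_superset:
  assumes "finite S" "Poly_Mapping.keys m \<subseteq> S"
  shows "wsum g m = (\<Sum>v\<in>S. Poly_Mapping.lookup m v * g v)"
  unfolding wsum_def by (rule sum.mono_neutral_left) (use assms in \<open>auto simp: in_keys_iff\<close>)

lemma wsum_add [simp]: "wsum g (m + m') = wsum g m + wsum g m'"
proof -
  let ?S = "Poly_Mapping.keys m \<union> Poly_Mapping.keys m'"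
  have "Poly_Mapping.keys (m + m') \<subseteq> ?S" by (rule Poly_Mapping.keys_add)
  then show ?thesis
    by (simp add: wsum_superset[where S = ?S] lookup_add distrib_right sum.distrib)
qed

lemma wsum_zero [simp]: "wsum g 0 = 0"
  by (simp add: wsum_def)

lemma wsum_single [simp]: "wsum g (Poly_Mapping.single v (Suc 0)) = g v"
  by (simp add: wsum_def)

lemma keys_add_nat:
  fixes m m' :: "'v \<Rightarrow>\<^sub>0 nat"
  shows "Poly_Mapping.keys (m + m') = Poly_Mapping.keys m \<union> Poly_Mapping.keys m'"
  by (auto simp: in_keys_iff lookup_add)

lemma keys_splitE:
  fixes m :: "'v \<Rightarrow>\<^sub>0 nat"
  assumes "v \<in> Poly_Mapping.keys m"
  obtains m' where "m = Poly_Mapping.single v 1 + m'"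
proof
  show "m = Poly_Mapping.single v 1 + (m - Poly_Mapping.single v 1)"
    using assms by (intro poly_mapping_eqI)
      (auto simp: lookup_add lookup_minus lookup_single in_keys_iff when_def)
qed

lemma single_add_eqE:
  fixes m m' :: "'v \<Rightarrow>\<^sub>0 nat"
  assumes "Poly_Mapping.single v 1 + m = Poly_Mapping.single w 1 + m'" "v \<noteq> w"
  obtains x where "m = Poly_Mapping.single w 1 + x" "m' = Poly_Mapping.single v 1 + x"
proof -
  have "w \<in> Poly_Mapping.keys (Poly_Mapping.single v 1 + m)"
    unfolding assms(1) by (simp add: keys_add_nat)
  then have "w \<in> Poly_Mapping.keys m" using assms(2) by (auto simp: keys_add_nat)
  then obtain x where x: "m = Poly_Mapping.single w 1 + x" by (rule keys_splitE)
  have "Poly_Mapping.single w 1 + (Poly_Mapping.single v 1 + x) = Poly_Mapping.single w 1 + m'"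
    using assms(1) x by (simp add: ac_simps)
  then have "m' = Poly_Mapping.single v 1 + x" by simp
  with x show thesis by (rule that)
qed

lemma mon_induct [case_names zero add]:
  fixes m :: "'v \<Rightarrow>\<^sub>0 nat"
  assumes "P 0" "\<And>v m. P m \<Longrightarrow> P (Poly_Mapping.single v 1 + m)"
  shows "P m"
proof (induction "wsum (\<lambda>_. 1) m" arbitrary: m)
  case 0
  have "Poly_Mapping.keys m = {}"
  proof (rule ccontr)
    assume "Poly_Mapping.keys m \<noteq> {}"
    then obtain v where "v \<in> Poly_Mapping.keys m" by blast
    then obtain m' where "m = Poly_Mapping.single v 1 + m'" by (rule keys_splitE)
    then show False using 0 by simp
  qed
  then have "m = 0" by (intro poly_mapping_eqI) (auto simp: in_keys_iff)
  then show ?case using assms by simp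
next
  case (Suc n)
  then have "Poly_Mapping.keys m \<noteq> {}" by (auto simp: wsum_def)
  then obtain v where "v \<in> Poly_Mapping.keys m" by blast
  then obtain m' where m': "m = Poly_Mapping.single v 1 + m'" by (rule keys_splitE)
  then have "n = wsum (\<lambda>_. 1) m'" using Suc(2) by simp
  then show ?case using Suc(1) assms(2) m' by simp
qed

section \<open>Minors, pentads and their syzygies\<close>

definition y :: "nat \<Rightarrow> nat \<Rightarrow> (nat \<times> nat, 'a::comm_ring_1) mpoly" where
  "y a b = Var (yv a b)"

lemma yv_commute: "yv a b = yv b a"
  by (simp add: yv_def max.commute min.commute)

lemma y_commute: "y a b = y b a"
  by (simp add: y_def yv_commute)

lemma yv_eq_iff: "yv a b = yv c d \<longleftrightarrow> a = c \<and> b = d \<or> a = d \<and> b = c"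
  by (auto simp: yv_def max_def min_def split: if_splits)

text \<open>The determinant with rows \<open>a\<close>, \<open>b\<close>, \<open>c\<close> and
  columns \<open>d\<close>, \<open>e\<close>, \<open>f\<close>, expanded along row \<open>a\<close>.
  Indices may repeat or overlap, so loops such as \<open>y a a\<close> can enter formally.\<close>

definition mn :: "nat \<Rightarrow> nat \<Rightarrow> nat \<Rightarrow> nat \<Rightarrow> nat \<Rightarrow> nat \<Rightarrow> (nat \<times> nat, 'a::comm_ring_1) mpoly" where
  "mn a b c d e f =
     y a d * (y b e * y c f - y b f * y c e)
   - y a e * (y b d * y c f - y b f * y c d)
   + y a f * (y b d * y c e - y b e * y c d)"

text \<open>If a loop variable $y_{kk}$ were available, then $y_{kk} D = N$ would hold in the target for
  every tetrad $D = y_{ab}y_{cd} - y_{ac}y_{bd}$ avoiding $k$, with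
  $N$ the corresponding difference of values of \<open>nn k\<close> (expand the minor with rows $k,a,d$ and columns $k,b,c$).\<close>

definition nn :: "nat \<Rightarrow> nat \<Rightarrow> nat \<Rightarrow> nat \<Rightarrow> nat \<Rightarrow> (nat \<times> nat, 'a::comm_ring_1) mpoly" where
  "nn k a b c d = y k a * y k b * y c d + y k c * y k d * y a b"

definition DD :: "nat \<Rightarrow> nat \<Rightarrow> nat \<Rightarrow> nat \<Rightarrow> (nat \<times> nat, 'a::comm_ring_1) mpoly" where
  "DD a b c d = y a b * y c d - y a c * y b d"

definition NN :: "nat \<Rightarrow> nat \<Rightarrow> nat \<Rightarrow> nat \<Rightarrow> nat \<Rightarrow> (nat \<times> nat, 'a::comm_ring_1) mpoly" where
  "NN k a b c d = nn k a b c d - nn k a c b d"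

text \<open>The pentad is the Koszul relation obtained by eliminating $y_{kk}$ from two of the relations
  $y_{kk} D = N$.\<close>

definition pentf :: "nat \<Rightarrow> nat \<Rightarrow> nat \<Rightarrow> nat \<Rightarrow> nat \<Rightarrow> (nat \<times> nat, 'a::comm_ring_1) mpoly" where
  "pentf k a b c d = DD a b c d * NN k a b d c - DD a b d c * NN k a b c d"

lemmas poly_defs = mn_def nn_def DD_def NN_def pentf_def

text \<open>The four adjacent transpositions together show that the pentad is alternating in its
  five vertices, although its definition singles out \<open>k\<close>. Up to sign it can therefore
  be centred at any vertex.\<close>

lemma pentf_swap1: "pentf k a b c d = - pentf a k b c d"
  by (simp add: poly_defs algebra_simps y_commute)

lemma pentf_swap2: "pentf k a b c d = - pentf k b a c d"
  by (simp add: poly_defs algebra_simps y_commute)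

lemma pentf_swap3: "pentf k a b c d = - pentf k a c b d"
  by (simp add: poly_defs algebra_simps y_commute)

lemma pentf_swap4: "pentf k a b c d = - pentf k a b d c"
  by (simp add: poly_defs algebra_simps y_commute)

lemma mn_swap_rows1: "mn a b c d e f = - mn b a c d e f"
  by (simp add: poly_defs algebra_simps)

lemma mn_transpose: "mn a b c d e f = mn d e f a b c"
  by (simp add: poly_defs algebra_simps y_commute)

lemma mn_eq_0:
  "mn a a c d e f = 0" "mn a b b d e f = 0" "mn a b a d e f = 0"
  "mn a b c d d f = 0" "mn a b c d e e = 0" "mn a b c d e d = 0"
  by (simp_all add: poly_defs algebra_simps)

lemma NN_flip: "NN k b a d c = NN k a b c d" "DD b a d c = DD a b c d"
  by (simp_all add: poly_defs algebra_simps y_commute)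

text \<open>With \<open>DD\<close> in place of \<open>NN\<close> the left side is 0: it telescopes
  around the monomials with edges o1 p, q r, o2 v; then o1 o2, p v, q r; then o1 o2, q v, p r; then
  o1 q, p r, o2 v. The identity says that this linear syzygy carries over modulo minors.\<close>

lemma four_cycle:
  "y q r * NN k o1 p o2 v + y o1 o2 * NN k p v r q - y p r * NN k o1 q o2 v - y o2 v * NN k o1 p q r
   = y k o2 * mn k p q v o1 r - y k r * mn p q o2 k v o1"
  by (simp add: poly_defs algebra_simps y_commute)

text \<open>In the target both products become y_kk times the product of the two tetrads. Of the
  pairs joining one tetrad to the other, only e b, e c, h b and h c occur in the minors on the
  right; these are the pairs that \<open>koszul_core\<close> has to assume.\<close>

lemma koszul_identity:
  "NN k a b c d * DD e f g h - NN k e f g h * DD a b c d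
   = (y a k * y d c - y a c * y d k) * mn k e h b f g
   - (y a k * y d b - y a b * y d k) * mn k e h c f g
   + y k f * (y e g * mn h a d k b c - y h g * mn e a d k b c)
   - y k g * (y e f * mn h a d k b c - y h f * mn e a d k b c)"
  by (simp add: poly_defs algebra_simps y_commute)

lemma minor_lift:
  "y a d * NN k b e f c - y a e * NN k b d f c + y a f * NN k b d e c
   = y k b * mn a k c d e f + y k c * mn a b k d e f"
  by (simp add: poly_defs algebra_simps y_commute)

lemma minor_lift_row:
  "y k d * NN k b e f c - y k e * NN k b d f c + y k f * NN k b d e c = 0"
  by (simp add: poly_defs algebra_simps y_commute)

lemma minor_tetrads:
  "mn a b c d e f = y a d * DD b e f c - y a e * DD b d f c + y a f * DD b d e c"
  by (simp add: poly_defs algebra_simps y_commute)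

text \<open>The left side is the pentad centred at \<open>a\<close> with its tetrads replaced by
  their N for \<open>k\<close>. In the target it is y_kk y_aa (D D' - D' D) = 0. Each minor on the
  right separates the six vertices into three rows and three columns, so no loop is
  required.\<close>

lemma pentad_lift:
  "NN k b c d f * NN a b c f d - NN k b c f d * NN a b c d f
   = y a d * y b f * y c k * mn a c k b d f - y a d * y b k * y c f * mn a d k b c f
   - y a c * y b d * y f k * mn a b d c f k - y a c * y b k * y d f * mn a f k b c d
   + y a d * y b c * y f k * mn a b k c d f - y a d * y b c * y f k * mn a c k b d f
   + y a c * y b d * y f k * mn a c f b d k - y a d * y b k * y c f * mn a b k c d f
   + y a f * y b k * y c d * mn a f k b c d + y a c * y b k * y d f * mn a d k b c f
   - y a b * y c d * y f k * mn a b k c d f - y a c * y b f * y d k * mn a d k b c f"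
  by (simp add: poly_defs algebra_simps y_commute)

lemma loop_minor: "mn k a b k c d = y k k * DD a c d b - NN k a c d b"
  by (simp add: poly_defs algebra_simps y_commute)

section \<open>The ideal with loops\<close>

text \<open>\<open>L\<close> collects the vertices whose loops are available as variables; removing
  a loop changes only this parameter.\<close>

definition okp :: "nat set \<Rightarrow> nat set \<Rightarrow> nat \<Rightarrow> nat \<Rightarrow> bool" where
  "okp V L a b \<longleftrightarrow> a \<in> V \<and> b \<in> V \<and> (a = b \<longrightarrow> a \<in> L)"

definition evars :: "nat set \<Rightarrow> nat set \<Rightarrow> (nat \<times> nat) set" where
  "evars V L = {yv a b | a b. okp V L a b}"

definition minors :: "nat set \<Rightarrow> nat set \<Rightarrow> (nat \<times> nat, 'a::comm_ring_1) mpoly set" where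
  "minors V L = {mn a b c d e f | a b c d e f. distinct [a, b, c] \<and> distinct [d, e, f] \<and>
     (\<forall>r\<in>{a, b, c}. \<forall>s\<in>{d, e, f}. okp V L r s)}"

definition pentads :: "nat set \<Rightarrow> (nat \<times> nat, 'a::comm_ring_1) mpoly set" where
  "pentads U = {pentf a b c d e | a b c d e. distinct [a, b, c, d, e] \<and> {a, b, c, d, e} \<subseteq> U}"

text \<open>Pentads are imposed only outside \<open>L\<close>. If k is in \<open>L\<close>, then
  substituting N = y_kk D - minor from \<open>loop_minor\<close> into \<open>pentf_def\<close>
  cancels the loop terms, and the pentad is a combination of minors.\<close>

definition JJ :: "nat set \<Rightarrow> nat set \<Rightarrow> (nat \<times> nat, 'a::comm_ring_1) mpoly set" where
  "JJ V L = ideal_of (polyring (evars V L)) (minors V L \<union> pentads (V - L))"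

lemma okp_commute: "okp V L a b = okp V L b a"
  by (auto simp: okp_def)

lemma y_in_polyring: "okp V L a b \<Longrightarrow> y a b \<in> polyring (evars V L)"
  unfolding y_def by (rule polyring_Var) (auto simp: evars_def)

lemma mn_in_JJ:
  assumes "\<forall>r\<in>{a, b, c}. \<forall>s\<in>{d, e, f}. okp V L r s"
  shows "(mn a b c d e f :: (nat \<times> nat, 'a::comm_ring_1) mpoly) \<in> JJ V L"
proof (cases "distinct [a, b, c] \<and> distinct [d, e, f]")
  case True
  with assms have "(mn a b c d e f :: (nat \<times> nat, 'a) mpoly) \<in> minors V L" unfolding minors_def by blast
  then show ?thesis unfolding JJ_def by (intro ideal_of_gen) auto
next
  case False
  then have "mn a b c d e f = (0 :: (nat \<times> nat, 'a) mpoly)" by (auto simp: mn_eq_0)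
  then show ?thesis by (simp only: JJ_def ideal_of.zero)
qed

lemma pentf_in_JJ:
  assumes "distinct [a, b, c, d, e]" "{a, b, c, d, e} \<subseteq> V - L"
  shows "pentf a b c d e \<in> JJ V L"
proof -
  have "pentf a b c d e \<in> pentads (V - L)" unfolding pentads_def using assms by blast
  then show ?thesis unfolding JJ_def by (intro ideal_of_gen) auto
qed

locale loop_step =
  fixes V L :: "nat set" and k :: nat and R J :: "(nat \<times> nat, 'a::comm_ring_1) mpoly set"
  assumes finV: "finite V" and LV: "L \<subseteq> V" and kV: "k \<in> V" and kL: "k \<notin> L"
    and R_eq: "R = polyring (evars V L)" and J_eq: "J = JJ V L"
begin

abbreviation ok where "ok \<equiv> okp V L"

definition okv :: "nat \<Rightarrow> nat \<Rightarrow> bool" where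
  "okv a b \<longleftrightarrow> okp V L a b \<and> a \<noteq> k \<and> b \<noteq> k"

lemma okv_commute: "okv a b = okv b a"
  by (auto simp: okv_def okp_commute)

lemma okvD: "okv a b \<Longrightarrow> ok a b" "okv a b \<Longrightarrow> ok b a" "okv a b \<Longrightarrow> ok k a" "okv a b \<Longrightarrow> ok k b"
  "okv a b \<Longrightarrow> ok a k" "okv a b \<Longrightarrow> ok b k"
  using kV by (auto simp: okv_def okp_def)

lemma J_zero: "0 \<in> J" by (simp add: J_eq JJ_def ideal_of.zero)
lemma J_add: "f \<in> J \<Longrightarrow> g \<in> J \<Longrightarrow> f + g \<in> J" by (simp add: J_eq JJ_def ideal_of_add)
lemma J_diff: "f \<in> J \<Longrightarrow> g \<in> J \<Longrightarrow> f - g \<in> J" by (simp add: J_eq JJ_def ideal_of_polyring_diff)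
lemma J_uminus: "f \<in> J \<Longrightarrow> - f \<in> J" by (simp add: J_eq JJ_def ideal_of_polyring_uminus)
lemma J_uminus_iff: "- f \<in> J \<longleftrightarrow> f \<in> J" using J_uminus[of f] J_uminus[of "- f"] by auto
lemma J_mult: "r \<in> R \<Longrightarrow> f \<in> J \<Longrightarrow> r * f \<in> J"
  by (simp add: J_eq R_eq JJ_def ideal_of_polyring_mult)
lemma J_trans: "f - g \<in> J \<Longrightarrow> g - h \<in> J \<Longrightarrow> f - h \<in> J"
  using J_add[of "f - g" "g - h"] by simp
lemma J_sym: "f - g \<in> J \<Longrightarrow> g - f \<in> J"
  using J_uminus[of "f - g"] by simp

lemma R_add: "f \<in> R \<Longrightarrow> g \<in> R \<Longrightarrow> f + g \<in> R" by (simp add: R_eq polyring_add)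
lemma R_diff: "f \<in> R \<Longrightarrow> g \<in> R \<Longrightarrow> f - g \<in> R" by (simp add: R_eq polyring_diff)
lemma R_mult: "f \<in> R \<Longrightarrow> g \<in> R \<Longrightarrow> f * g \<in> R" by (simp add: R_eq polyring_mult)
lemma R_y: "ok a b \<Longrightarrow> y a b \<in> R" by (simp add: R_eq y_in_polyring)
lemma J_mn: "\<forall>r\<in>{a, b, c}. \<forall>s\<in>{d, e, f}. ok r s \<Longrightarrow> mn a b c d e f \<in> J"
  unfolding J_eq by (rule mn_in_JJ)

lemmas R_closed = R_add R_diff R_mult R_y

text \<open>The edges a b, c d are exchanged for a c, b d. Nothing is asked of the pairs a d and b
  c, so these may coincide even at a vertex without a loop; the exchange is then trivial.\<close>

definition exok :: "nat \<Rightarrow> nat \<Rightarrow> nat \<Rightarrow> nat \<Rightarrow> bool" where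
  "exok a b c d \<longleftrightarrow> okv a b \<and> okv c d \<and> okv a c \<and> okv b d"

definition KZ :: "nat \<Rightarrow> nat \<Rightarrow> nat \<Rightarrow> nat \<Rightarrow> nat \<Rightarrow> nat \<Rightarrow> nat \<Rightarrow> nat \<Rightarrow> (nat \<times> nat, 'a) mpoly" where
  "KZ a b c d e f g h = NN k a b c d * DD e f g h - NN k e f g h * DD a b c d"

lemma exok_flip: "exok a b c d \<Longrightarrow> exok b a d c"
  by (auto simp: exok_def okv_commute)

lemma koszul_core:
  assumes "exok a b c d" "exok e f g h" "ok e b" "ok e c" "ok h b" "ok h c"
  shows "KZ a b c d e f g h \<in> J"
proof -
  have o: "ok a k" "ok d k" "ok a b" "ok a c" "ok d b" "ok d c" "ok k b" "ok k c" "ok k f" "ok k g"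
     "ok e k" "ok h k" "ok e f" "ok e g" "ok h f" "ok h g"
    using assms(1,2) okvD okv_commute unfolding exok_def by metis+
  have "mn k e h b f g \<in> J" "mn k e h c f g \<in> J" "mn h a d k b c \<in> J" "mn e a d k b c \<in> J"
    by (rule J_mn; use o assms in simp)+
  then show ?thesis
    unfolding KZ_def koszul_identity
    by (intro J_add J_diff J_mult R_closed o assms) auto
qed

text \<open>The flips of the two tetrads give four ways to apply \<open>koszul_core\<close>. If all
  four fail, the coincidences force both tetrads onto the same four vertices, none with a loop, but
  with different opposite pairs; what remains is a pentad up to sign.\<close>

lemma koszul:
  assumes A: "exok a b c d" and B: "exok e f g h"
  shows "KZ a b c d e f g h \<in> J"
proof (cases "a = d \<or> b = c \<or> e = h \<or> f = g")
  case True
  then have "KZ a b c d e f g h = 0"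
    by (auto simp: KZ_def poly_defs algebra_simps y_commute)
  then show ?thesis by (simp add: J_zero)
next
  case False
  have V: "a \<in> V" "b \<in> V" "c \<in> V" "d \<in> V" "e \<in> V" "f \<in> V" "g \<in> V" "h \<in> V"
    "a \<noteq> k" "b \<noteq> k" "c \<noteq> k" "d \<noteq> k"
    using A B by (auto simp: exok_def okv_def okp_def)
  have KZ_flip: "KZ b a d c e f g h = KZ a b c d e f g h" "KZ a b c d f e h g = KZ a b c d e f g h"
    "KZ b a d c f e h g = KZ a b c d e f g h"
    by (simp_all add: KZ_def NN_flip)
  consider "ok e b \<and> ok e c \<and> ok h b \<and> ok h c" | "ok f b \<and> ok f c \<and> ok g b \<and> ok g c"
    | "ok e a \<and> ok e d \<and> ok h a \<and> ok h d" | "ok f a \<and> ok f d \<and> ok g a \<and> ok g d"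
    | "\<not> (ok e b \<and> ok e c \<and> ok h b \<and> ok h c)" "\<not> (ok f b \<and> ok f c \<and> ok g b \<and> ok g c)"
      "\<not> (ok e a \<and> ok e d \<and> ok h a \<and> ok h d)" "\<not> (ok f a \<and> ok f d \<and> ok g a \<and> ok g d)"
    by blast
  then show ?thesis
  proof cases
    case 1 then show ?thesis using koszul_core A B by blast
  next
    case 2 then show ?thesis using koszul_core[OF A exok_flip[OF B]] KZ_flip by simp
  next
    case 3 then show ?thesis using koszul_core[OF exok_flip[OF A] B] KZ_flip by simp
  next
    case 4 then show ?thesis using koszul_core[OF exok_flip[OF A] exok_flip[OF B]] KZ_flip by simp
  next
    case 5
    have dA: "a = b \<longrightarrow> a \<in> L" "c = d \<longrightarrow> c \<in> L" "a = c \<longrightarrow> a \<in> L" "b = d \<longrightarrow> b \<in> L" "a \<noteq> d" "b \<noteq> c"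
      using A False by (auto simp: exok_def okv_def okp_def)
    have dB: "e = f \<longrightarrow> e \<in> L" "g = h \<longrightarrow> g \<in> L" "e = g \<longrightarrow> e \<in> L" "f = h \<longrightarrow> f \<in> L" "e \<noteq> h" "f \<noteq> g"
      using B False by (auto simp: exok_def okv_def okp_def)
    have cl: "(e = b \<and> e \<notin> L) \<or> (e = c \<and> e \<notin> L) \<or> (h = b \<and> h \<notin> L) \<or> (h = c \<and> h \<notin> L)"
      "(f = b \<and> f \<notin> L) \<or> (f = c \<and> f \<notin> L) \<or> (g = b \<and> g \<notin> L) \<or> (g = c \<and> g \<notin> L)"
      "(e = a \<and> e \<notin> L) \<or> (e = d \<and> e \<notin> L) \<or> (h = a \<and> h \<notin> L) \<or> (h = d \<and> h \<notin> L)"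
      "(f = a \<and> f \<notin> L) \<or> (f = d \<and> f \<notin> L) \<or> (g = a \<and> g \<notin> L) \<or> (g = d \<and> g \<notin> L)"
      using 5 V by (auto simp: okp_def)
    have eh: "e = a \<and> h = b \<and> a \<notin> L \<and> b \<notin> L
      \<or> e = b \<and> h = a \<and> a \<notin> L \<and> b \<notin> L
      \<or> e = a \<and> h = c \<and> a \<notin> L \<and> c \<notin> L
      \<or> e = c \<and> h = a \<and> a \<notin> L \<and> c \<notin> L
      \<or> e = d \<and> h = b \<and> d \<notin> L \<and> b \<notin> L
      \<or> e = b \<and> h = d \<and> d \<notin> L \<and> b \<notin> L
      \<or> e = d \<and> h = c \<and> d \<notin> L \<and> c \<notin> L
      \<or> e = c \<and> h = d \<and> d \<notin> L \<and> c \<notin> L"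
      using cl(1,3) dA dB(5) by (elim disjE conjE) simp_all
    have fg: "f = a \<and> g = b \<and> a \<notin> L \<and> b \<notin> L
      \<or> f = b \<and> g = a \<and> a \<notin> L \<and> b \<notin> L
      \<or> f = a \<and> g = c \<and> a \<notin> L \<and> c \<notin> L
      \<or> f = c \<and> g = a \<and> a \<notin> L \<and> c \<notin> L
      \<or> f = d \<and> g = b \<and> d \<notin> L \<and> b \<notin> L
      \<or> f = b \<and> g = d \<and> d \<notin> L \<and> b \<notin> L
      \<or> f = d \<and> g = c \<and> d \<notin> L \<and> c \<notin> L
      \<or> f = c \<and> g = d \<and> d \<notin> L \<and> c \<notin> L"
      using cl(2,4) dA dB(6) by (elim disjE conjE) simp_all
    \<comment> \<open>The edges of the second tetrad keep \<open>e\<close>, \<open>h\<close> apart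
      from \<open>f\<close>, \<open>g\<close>, since a coincidence would need a loop. Four distinct
      vertices among \<open>a\<close>, \<open>b\<close>, \<open>c\<close>, \<open>d\<close> exhaust
      them.\<close>
    have mem: "a \<notin> L \<and> b \<notin> L \<and> c \<notin> L \<and> d \<notin> L"
      using eh fg dB(1-4) by (elim disjE conjE) simp_all
    have P: "pentf k a b c d \<in> J"
      unfolding J_eq by (rule pentf_in_JJ) (use mem V dA kV kL in auto)
    have "e = a \<and> f = d \<and> g = c \<and> h = b
      \<or> e = a \<and> f = c \<and> g = d \<and> h = b
      \<or> e = b \<and> f = d \<and> g = c \<and> h = a
      \<or> e = b \<and> f = c \<and> g = d \<and> h = a
      \<or> e = a \<and> f = d \<and> g = b \<and> h = c
      \<or> e = a \<and> f = b \<and> g = d \<and> h = c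
      \<or> e = c \<and> f = d \<and> g = b \<and> h = a
      \<or> e = c \<and> f = b \<and> g = d \<and> h = a
      \<or> e = d \<and> f = a \<and> g = c \<and> h = b
      \<or> e = d \<and> f = c \<and> g = a \<and> h = b
      \<or> e = b \<and> f = a \<and> g = c \<and> h = d
      \<or> e = b \<and> f = c \<and> g = a \<and> h = d
      \<or> e = d \<and> f = a \<and> g = b \<and> h = c
      \<or> e = d \<and> f = b \<and> g = a \<and> h = c
      \<or> e = c \<and> f = a \<and> g = b \<and> h = d
      \<or> e = c \<and> f = b \<and> g = a \<and> h = d"
      using eh fg dB(1-4) by (elim disjE conjE) simp_all
    then have "KZ a b c d e f g h = pentf k a b c d \<or> KZ a b c d e f g h = - pentf k a b c d"
      by (elim disjE conjE; hypsubst; simp add: KZ_def poly_defs algebra_simps y_commute)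
    then show ?thesis using P J_uminus by auto
  qed
qed

end

section \<open>Multiplication by a missing loop\<close>

definition E :: "nat \<Rightarrow> nat \<Rightarrow> (nat \<times> nat) \<Rightarrow>\<^sub>0 nat" where
  "E a b = Poly_Mapping.single (yv a b) 1"

lemma E_commute: "E a b = E b a"
  by (simp add: E_def yv_commute)

lemma keys_E [simp]: "Poly_Mapping.keys (E a b) = {yv a b}"
  by (simp add: E_def)

lemma mon_E: "mon (E a b) = y a b"
  by (simp add: E_def y_def Var_def)

lemma mon_E_add: "mon (E a b + X) = y a b * mon X"
  by (simp add: mon_E[symmetric] mult_single)

lemma E_splitE:
  assumes "yv a b \<in> Poly_Mapping.keys M"
  obtains X where "M = E a b + X"
  using keys_splitE[OF assms] unfolding E_def by blast

text \<open>A loop counts twice, as s_v^2 does in the target. With this convention an exchange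
  preserves all vertex degrees, even if it creates or destroys loops.\<close>

definition dg :: "nat \<Rightarrow> (nat \<times> nat \<Rightarrow>\<^sub>0 nat) \<Rightarrow> nat" where
  "dg v = wsum (\<lambda>e. (if fst e = v then 1 else 0) + (if snd e = v then 1 else 0))"

definition tot :: "(nat \<times> nat \<Rightarrow>\<^sub>0 nat) \<Rightarrow> nat" where
  "tot = wsum (\<lambda>_. 1)"

lemma dg_add [simp]: "dg v (X + Y) = dg v X + dg v Y"
  by (simp add: dg_def)

lemma tot_add [simp]: "tot (X + Y) = tot X + tot Y"
  by (simp add: tot_def)

lemma dg_E [simp]: "dg v (E a b) = (if a = v then 1 else 0) + (if b = v then 1 else 0)"
  by (simp add: dg_def E_def yv_def max_def min_def)

lemma tot_E [simp]: "tot (E a b) = 1"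
  by (simp add: tot_def E_def)

lemma wsum_add_fun: "wsum (\<lambda>e. f e + g e) m = wsum f m + wsum g m"
  by (simp add: wsum_def sum.distrib distrib_left)

lemma wsum_mono: "(\<And>e. e \<in> Poly_Mapping.keys m \<Longrightarrow> f e \<le> g e) \<Longrightarrow> wsum f m \<le> wsum g m"
  unfolding wsum_def by (intro sum_mono mult_left_mono) auto

context loop_step
begin

definition vmon :: "(nat \<times> nat \<Rightarrow>\<^sub>0 nat) \<Rightarrow> bool" where
  "vmon M \<longleftrightarrow> Poly_Mapping.keys M \<subseteq> {yv a b | a b. okv a b}"

lemma vmon_E_add [simp]: "vmon (E a b + X) \<longleftrightarrow> okv a b \<and> vmon X"
proof -
  have "yv a b \<in> {yv a b | a b. okv a b} \<longleftrightarrow> okv a b"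
    using okv_commute by (auto simp: yv_eq_iff)
  then show ?thesis by (auto simp: vmon_def keys_add_nat)
qed

lemma vmon_mon: "vmon X \<Longrightarrow> mon X \<in> R"
  unfolding R_eq vmon_def by (rule polyring_single) (fastforce simp: evars_def okv_def)

lemma dg_posE:
  assumes "vmon M" "dg v M > 0"
  obtains u X where "M = E v u + X" "okv v u"
proof -
  have "\<exists>e\<in>Poly_Mapping.keys M. fst e = v \<or> snd e = v"
  proof (rule ccontr)
    assume "\<not> ?thesis"
    then have "dg v M = 0" unfolding dg_def wsum_def by (intro sum.neutral) auto
    then show False using assms(2) by simp
  qed
  then obtain e where e: "e \<in> Poly_Mapping.keys M" "fst e = v \<or> snd e = v" by blast
  then obtain a b where ab: "e = yv a b" "okv a b" using assms(1) by (auto simp: vmon_def)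
  then have "v = a \<or> v = b" using e(2) by (auto simp: yv_def max_def min_def split: if_splits)
  then obtain u where u: "e = yv v u" "okv v u" using ab okv_commute yv_commute by blast
  then obtain X where "M = E v u + X" using e(1) E_splitE by blast
  then show thesis using u that by blast
qed

lemma okv_vertices: "okv a b \<Longrightarrow> okv c d \<Longrightarrow> a \<noteq> c \<Longrightarrow> okv a c"
  by (auto simp: okv_def okp_def)

text \<open>Ends of available edges lie in \<open>V\<close> and differ from \<open>k\<close>, so the
  sole obstruction to joining two of them is a coincidence at a vertex without a loop.\<close>

lemma not_okv: "okv a b \<Longrightarrow> okv c d \<Longrightarrow> \<not> okv a c \<Longrightarrow> a = c \<and> a \<notin> L"
  by (auto simp: okv_def okp_def)

text \<open>A function $\psi$ of this kind is a model of $M \mapsto y_{kk} (M - M_0)$ on the monomials \<open>M\<close> of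
  degree \<open>n\<close> avoiding \<open>k\<close>, where $M_0$ is a reference monomial with the same vertex degrees.\<close>

definition consist :: "nat \<Rightarrow> ((nat \<times> nat \<Rightarrow>\<^sub>0 nat) \<Rightarrow> (nat \<times> nat, 'a) mpoly) \<Rightarrow> bool" where
  "consist n \<psi> \<longleftrightarrow> (\<forall>a b c d X. exok a b c d \<longrightarrow> vmon X \<longrightarrow> tot X + 2 = n \<longrightarrow>
     \<psi> (E a b + (E c d + X)) - \<psi> (E a c + (E b d + X)) - mon X * NN k a b c d \<in> J)"

text \<open>The values at \<open>M\<close> obtained by exchanging two edges at $o_1$ and $o_2$ so as to split off the edge
  $o_1 o_2$, and applying a \<open>\<psi>\<close> of smaller degree to the rest.\<close>

definition Val where
  "Val o1 o2 \<psi> M x \<longleftrightarrow> (\<exists>X. M = E o1 o2 + X \<and> x = y o1 o2 * \<psi> X) \<or>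
     (\<exists>u v X. M = E o1 u + (E o2 v + X) \<and> u \<noteq> o2 \<and> v \<noteq> o1 \<and> okv u v \<and>
        x = mon X * NN k o1 u o2 v + y o1 o2 * \<psi> (E u v + X))"

lemma NN_swap_pairs: "NN k c d a b = NN k a b c d"
  by (simp add: poly_defs algebra_simps y_commute)

lemma Val_commute: "Val o1 o2 \<psi> M x \<Longrightarrow> Val o2 o1 \<psi> M x"
proof -
  assume "Val o1 o2 \<psi> M x"
  then consider X where "M = E o1 o2 + X" "x = y o1 o2 * \<psi> X"
    | u v X where "M = E o1 u + (E o2 v + X)" "u \<noteq> o2" "v \<noteq> o1" "okv u v"
        "x = mon X * NN k o1 u o2 v + y o1 o2 * \<psi> (E u v + X)"
    unfolding Val_def by blast
  then show ?thesis
  proof cases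
    case 1
    then show ?thesis unfolding Val_def using E_commute y_commute by metis
  next
    case 2
    have "M = E o2 v + (E o1 u + X)" using 2(1) by (simp add: ac_simps)
    moreover have "x = mon X * NN k o2 v o1 u + y o2 o1 * \<psi> (E v u + X)"
      using 2(5) NN_swap_pairs y_commute E_commute by metis
    moreover have "okv v u" using 2(4) okv_commute by blast
    ultimately show ?thesis unfolding Val_def using 2(2,3) by blast
  qed
qed

lemma Val_edge: "Val o1 o2 \<psi> (E o1 o2 + X) (y o1 o2 * \<psi> X)"
  unfolding Val_def by blast

lemma Val_pair:
  "u \<noteq> o2 \<Longrightarrow> v \<noteq> o1 \<Longrightarrow> okv u v \<Longrightarrow> M = E o1 u + (E o2 v + X) \<Longrightarrow>
   Val o1 o2 \<psi> M (mon X * NN k o1 u o2 v + y o1 o2 * \<psi> (E u v + X))"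
  unfolding Val_def by blast

section \<open>Independence of the value from the exchange that is chosen\<close>

context
  fixes n \<psi>
  assumes cons: "consist n \<psi>"
begin

lemma consD:
  assumes "exok a b c d" "vmon X" "tot X + 2 = n"
    "M = E a b + (E c d + X)" "M' = E a c + (E b d + X)"
  shows "\<psi> M - \<psi> M' - mon X * NN k a b c d \<in> J"
  using cons assms unfolding consist_def by blast

text \<open>Two choices are compared through the minor that closes the cycle formed by the three
  monomials with edges $o_1u, o_2v, o_2v'$, then $o_1o_2, uv, o_2v'$, then $o_1o_2, uv', o_2v$.\<close>

lemma choice_step:
  assumes ok: "okv o1 u" "okv o2 v" "okv o2 v'" "okv u v" "okv u v'" "vmon Z" and "o1 \<noteq> o2"
    and "v \<noteq> o1" "v' \<noteq> o1"
    and t: "tot Z + 2 = n"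
  shows "(mon (E o2 v' + Z) * NN k o1 u o2 v + y o1 o2 * \<psi> (E u v + (E o2 v' + Z)))
       - (mon (E o2 v + Z) * NN k o1 u o2 v' + y o1 o2 * \<psi> (E u v' + (E o2 v + Z))) \<in> J"
proof -
  have o12: "okv o1 o2" using ok okv_vertices assms by blast
  have ex: "exok u v v' o2" using ok okv_commute by (auto simp: exok_def)
  have c: "\<psi> (E u v + (E o2 v' + Z)) - \<psi> (E u v' + (E o2 v + Z)) - mon Z * NN k u v v' o2 \<in> J"
    by (rule consD[OF ex ok(6) t]) (simp_all add: E_commute)
  have m: "mn o2 k u o1 v v' \<in> J"
    by (rule J_mn) (use ok o12 okvD in auto)
  have ko2: "y k o2 \<in> R" using ok(2) R_y okvD by blast
  have eq: "(mon (E o2 v' + Z) * NN k o1 u o2 v + y o1 o2 * \<psi> (E u v + (E o2 v' + Z)))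
       - (mon (E o2 v + Z) * NN k o1 u o2 v' + y o1 o2 * \<psi> (E u v' + (E o2 v + Z)))
     = y o1 o2 * (\<psi> (E u v + (E o2 v' + Z)) - \<psi> (E u v' + (E o2 v + Z)) - mon Z * NN k u v v' o2)
     - mon Z * (y k o2 * mn o2 k u o1 v v')"
    unfolding mon_E_add by (simp add: poly_defs algebra_simps y_commute)
  show ?thesis
    unfolding eq by (intro J_diff J_mult R_mult R_y c m ko2 vmon_mon ok okvD(1)[OF o12])
qed

lemma choice_step':
  assumes ok: "okv o1 u" "okv o1 u'" "okv o2 v" "okv u v" "okv u' v" "vmon Z" and "o1 \<noteq> o2"
    and "u \<noteq> o2" "u' \<noteq> o2"
    and t: "tot Z + 2 = n"
  shows "(mon (E o1 u' + Z) * NN k o1 u o2 v + y o1 o2 * \<psi> (E u v + (E o1 u' + Z)))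
       - (mon (E o1 u + Z) * NN k o1 u' o2 v + y o1 o2 * \<psi> (E u' v + (E o1 u + Z))) \<in> J"
  using choice_step[of o2 v o1 u u' Z] assms okv_commute
  by (simp add: NN_swap_pairs y_commute E_commute[of v] okv_commute)

text \<open>The two edges are changed one at a time by \<open>choice_step\<close> and
  \<open>choice_step'\<close>, passing through the choice u, v' or the choice u', v. If neither is
  possible, then v' = u and v = u' have no loops, and the two choices are compared directly.\<close>

lemma Val_unique_pair:
  assumes M: "vmon M" "tot M = Suc n" "o1 \<noteq> o2"
    and 1: "M = E o1 u + (E o2 v + X)" "u \<noteq> o2" "v \<noteq> o1" "okv u v"
    and 2: "M = E o1 u' + (E o2 v' + X')" "u' \<noteq> o2" "v' \<noteq> o1" "okv u' v'"
  shows "(mon X * NN k o1 u o2 v + y o1 o2 * \<psi> (E u v + X))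
       - (mon X' * NN k o1 u' o2 v' + y o1 o2 * \<psi> (E u' v' + X')) \<in> J"
proof -
  have okM: "okv o1 u" "okv o2 v" "vmon X" "okv o1 u'" "okv o2 v'" "vmon X'"
    using M(1)[unfolded 1(1)] M(1)[unfolded 2(1)] by simp_all
  have ne: "yv o1 u \<noteq> yv o2 v'" "yv o2 v \<noteq> yv o1 u'"
    using M(3) 1 2 by (auto simp: yv_eq_iff)
  consider "u = u'" "v = v'" | "u = u'" "v \<noteq> v'" | "u \<noteq> u'" "v = v'" | "u \<noteq> u'" "v \<noteq> v'" by blast
  then show ?thesis
  proof cases
    case 1
    then have "X = X'" using \<open>M = E o1 u + (E o2 v + X)\<close> \<open>M = E o1 u' + (E o2 v' + X')\<close> by simp
    then show ?thesis using 1 by (simp add: J_zero)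
  next
    case c: 2
    then have "E o2 v + X = E o2 v' + X'" using 1(1) 2(1) by simp
    moreover have "yv o2 v \<noteq> yv o2 v'" using c by (auto simp: yv_eq_iff)
    ultimately obtain Z where Z: "X = E o2 v' + Z" "X' = E o2 v + Z"
      unfolding E_def by (rule single_add_eqE)
    show ?thesis unfolding Z c(1)[symmetric]
      by (rule choice_step) (use okM Z 1 2 c M in auto)
  next
    case c: 3
    have "E o2 v + (E o1 u + X) = E o2 v + (E o1 u' + X')"
      using 1(1) 2(1) c by (metis add.left_commute)
    then have "E o1 u + X = E o1 u' + X'" by simp
    moreover have "yv o1 u \<noteq> yv o1 u'" using c by (auto simp: yv_eq_iff)
    ultimately obtain Z where Z: "X = E o1 u' + Z" "X' = E o1 u + Z"
      unfolding E_def by (rule single_add_eqE)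
    show ?thesis unfolding Z c(2)[symmetric]
      by (rule choice_step') (use okM Z 1 2 c M in auto)
  next
    case c: 4
    have "E o1 u + (E o2 v + X) = E o1 u' + (E o2 v' + X')" using 1(1) 2(1) by simp
    moreover have "yv o1 u \<noteq> yv o1 u'" using c by (auto simp: yv_eq_iff)
    ultimately obtain Z1 where Z1: "E o2 v + X = E o1 u' + Z1" "E o2 v' + X' = E o1 u + Z1"
      unfolding E_def by (rule single_add_eqE)
    obtain Z2 where Z2: "X = E o1 u' + Z2" "Z1 = E o2 v + Z2"
      using Z1(1) ne(2) unfolding E_def by (rule single_add_eqE)
    obtain Z3 where Z3: "X' = E o1 u + Z3" "Z1 = E o2 v' + Z3"
      using Z1(2) ne(1)[symmetric] unfolding E_def by (rule single_add_eqE)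
    have "yv o2 v \<noteq> yv o2 v'" using c by (auto simp: yv_eq_iff)
    then obtain Z where Z: "Z2 = E o2 v' + Z" "Z3 = E o2 v + Z"
      using Z2(2) Z3(2) unfolding E_def by (metis single_add_eqE)
    have X: "X = E o1 u' + (E o2 v' + Z)" "X' = E o1 u + (E o2 v + Z)"
      using Z2 Z3 Z by auto
    have Zv: "vmon Z" "tot Z + 3 = n" using okM(3) X(1) M(2) 1(1) by auto
    consider "okv u v'" | "okv u' v" | "\<not> okv u v'" "\<not> okv u' v" by blast
    then show ?thesis
    proof cases
      case d: 1
      have "(mon (E o2 v' + (E o1 u' + Z)) * NN k o1 u o2 v + y o1 o2 * \<psi> (E u v + (E o2 v' + (E o1 u' + Z))))
       - (mon (E o2 v + (E o1 u' + Z)) * NN k o1 u o2 v' + y o1 o2 * \<psi> (E u v' + (E o2 v + (E o1 u' + Z)))) \<in> J"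
        by (rule choice_step) (use okM Zv 1 2 c d M in auto)
      moreover have "(mon (E o1 u' + (E o2 v + Z)) * NN k o1 u o2 v' + y o1 o2 * \<psi> (E u v' + (E o1 u' + (E o2 v + Z))))
       - (mon (E o1 u + (E o2 v + Z)) * NN k o1 u' o2 v' + y o1 o2 * \<psi> (E u' v' + (E o1 u + (E o2 v + Z)))) \<in> J"
        by (rule choice_step') (use okM Zv 1 2 c d M in auto)
      ultimately show ?thesis unfolding X by (simp add: add.left_commute[of "E o1 u'"]) (rule J_trans)
    next
      case d: 2
      have "(mon (E o1 u' + (E o2 v' + Z)) * NN k o1 u o2 v + y o1 o2 * \<psi> (E u v + (E o1 u' + (E o2 v' + Z))))
       - (mon (E o1 u + (E o2 v' + Z)) * NN k o1 u' o2 v + y o1 o2 * \<psi> (E u' v + (E o1 u + (E o2 v' + Z)))) \<in> J"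
        by (rule choice_step') (use okM Zv 1 2 c d M in auto)
      moreover have "(mon (E o2 v' + (E o1 u + Z)) * NN k o1 u' o2 v + y o1 o2 * \<psi> (E u' v + (E o2 v' + (E o1 u + Z))))
       - (mon (E o2 v + (E o1 u + Z)) * NN k o1 u' o2 v' + y o1 o2 * \<psi> (E u' v' + (E o2 v + (E o1 u + Z)))) \<in> J"
        by (rule choice_step) (use okM Zv 1 2 c d M in auto)
      ultimately show ?thesis unfolding X by (simp add: add.left_commute[of "E o1 u"]) (rule J_trans)
    next
      case d: 3
      have v': "v' = u" "u \<notin> L" and v: "v = u'" "u' \<notin> L"
        using not_okv[of u o1 v' o2] not_okv[of u' o1 v o2] okM d okv_commute by blast+
      have uu': "okv u u'" using 1(4) v by simp
      have o12: "okv o1 o2" using okM okv_vertices M(3) by blast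
      have ex: "exok o1 u' u o2" using okM v v' okv_commute by (auto simp: exok_def)
      have c1: "\<psi> (E u v + X) - \<psi> (E u' v' + X') - mon (E u u' + Z) * NN k o1 u' u o2 \<in> J"
      proof (rule consD[OF ex])
        show "vmon (E u u' + Z)" "tot (E u u' + Z) + 2 = n" using Zv uu' by simp_all
        show "E u v + X = E o1 u' + (E u o2 + (E u u' + Z))"
          "E u' v' + X' = E o1 u + (E u' o2 + (E u u' + Z))"
          unfolding X v v' by (simp_all add: E_commute ac_simps)
      qed
      \<comment> \<open>Both tetrads live on \<open>o1\<close>, \<open>u\<close>, \<open>u'\<close>,
        \<open>o2\<close>, and the expression is \<open>- pentf k o1 u u' o2\<close>. This is how
        pentads enter the comparison of choices.\<close>
      have K: "KZ o1 u u' o2 o1 u o2 u' \<in> J"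
        by (rule koszul) (use okM v v' uu' o12 okv_commute in \<open>auto simp: exok_def\<close>)
      have eq: "(mon X * NN k o1 u o2 v + y o1 o2 * \<psi> (E u v + X))
       - (mon X' * NN k o1 u' o2 v' + y o1 o2 * \<psi> (E u' v' + X'))
       = y o1 o2 * (\<psi> (E u v + X) - \<psi> (E u' v' + X') - mon (E u u' + Z) * NN k o1 u' u o2)
         + mon Z * KZ o1 u u' o2 o1 u o2 u'"
        unfolding X v v' mon_E_add KZ_def by (simp add: poly_defs algebra_simps y_commute)
      show ?thesis unfolding eq
        by (intro J_add J_mult c1 K vmon_mon Zv R_y okvD(1)[OF o12])
    qed
  qed
qed

text \<open>Both values have the factor \<open>y o1 o2\<close>, and the remainders \<open>X\<close>
  and \<open>E u v + X'\<close> differ by the single exchange of o1 u, o2 v for o1 o2, u v.\<close>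

lemma Val_unique_mixed:
  assumes M: "vmon M" "tot M = Suc n" "o1 \<noteq> o2"
    and 1: "M = E o1 o2 + X"
    and 2: "M = E o1 u + (E o2 v + X')" "u \<noteq> o2" "v \<noteq> o1" "okv u v"
  shows "y o1 o2 * \<psi> X - (mon X' * NN k o1 u o2 v + y o1 o2 * \<psi> (E u v + X')) \<in> J"
proof -
  have "E o1 o2 + X = E o1 u + (E o2 v + X')" using 1 2 by simp
  moreover have "yv o1 o2 \<noteq> yv o1 u" "yv o1 o2 \<noteq> yv o2 v" using 2 by (auto simp: yv_eq_iff)
  ultimately obtain Z1 where Z1: "X = E o1 u + Z1" "E o2 v + X' = E o1 o2 + Z1"
    unfolding E_def by (metis single_add_eqE)
  obtain Z where Z: "X' = E o1 o2 + Z" "Z1 = E o2 v + Z"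
    using Z1(2) \<open>yv o1 o2 \<noteq> yv o2 v\<close> unfolding E_def by (metis single_add_eqE)
  have ok: "okv o1 o2" "okv o1 u" "okv o2 v" "vmon Z" "tot Z + 2 = n"
    using M 1 2 Z Z1 by auto
  have "\<psi> X - \<psi> (E u v + X') - mon Z * NN k o1 u o2 v \<in> J"
    by (rule consD[of o1 u o2 v Z]) (use ok 2 Z Z1 in \<open>auto simp: exok_def ac_simps\<close>)
  then have "y o1 o2 * (\<psi> X - \<psi> (E u v + X') - mon Z * NN k o1 u o2 v) \<in> J"
    by (intro J_mult R_y okvD(1)[OF ok(1)])
  then show ?thesis unfolding Z mon_E_add by (simp add: algebra_simps)
qed

lemma Val_unique:
  assumes M: "vmon M" "tot M = Suc n" "o1 \<noteq> o2"
    and "Val o1 o2 \<psi> M x" "Val o1 o2 \<psi> M x'"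
  shows "x - x' \<in> J"
proof -
  have "x - x' \<in> J" if "M = E o1 o2 + X" "x = y o1 o2 * \<psi> X" "Val o1 o2 \<psi> M x'" for X x x'
    using that(3) unfolding Val_def
  proof (elim disjE exE conjE)
    fix X' assume "M = E o1 o2 + X'" "x' = y o1 o2 * \<psi> X'"
    with that show ?thesis by (simp add: J_zero)
  next
    fix u v X' assume "M = E o1 u + (E o2 v + X')" "u \<noteq> o2" "v \<noteq> o1" "okv u v"
      "x' = mon X' * NN k o1 u o2 v + y o1 o2 * \<psi> (E u v + X')"
    with that show ?thesis using Val_unique_mixed[OF M] by blast
  qed
  note A = this
  from assms(4) show ?thesis unfolding Val_def
  proof (elim disjE exE conjE)
    fix X assume "M = E o1 o2 + X" "x = y o1 o2 * \<psi> X"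
    then show ?thesis using A assms(5) by blast
  next
    fix u v X assume B: "M = E o1 u + (E o2 v + X)" "u \<noteq> o2" "v \<noteq> o1" "okv u v"
      "x = mon X * NN k o1 u o2 v + y o1 o2 * \<psi> (E u v + X)"
    from assms(5) show ?thesis unfolding Val_def
    proof (elim disjE exE conjE)
      fix X' assume "M = E o1 o2 + X'" "x' = y o1 o2 * \<psi> X'"
      then show ?thesis using A assms(4) J_sym by blast
    next
      fix u' v' X' assume "M = E o1 u' + (E o2 v' + X')" "u' \<noteq> o2" "v' \<noteq> o1" "okv u' v'"
        "x' = mon X' * NN k o1 u' o2 v' + y o1 o2 * \<psi> (E u' v' + X')"
      then show ?thesis using B Val_unique_pair[OF M] by blast
    qed
  qed
qed

end

end

section \<open>Compatibility of the values with every exchange\<close>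

context loop_step
begin

text \<open>Because values are unique modulo \<open>J\<close>, one convenient pair of values settles
  the exchange for all of them.\<close>

definition Good where
  "Good o1 o2 \<psi> a b c d X \<longleftrightarrow> (\<exists>x x'. Val o1 o2 \<psi> (E a b + (E c d + X)) x \<and>
     Val o1 o2 \<psi> (E a c + (E b d + X)) x' \<and> x - x' - mon X * NN k a b c d \<in> J)"

lemma GoodI:
  assumes "Val o1 o2 \<psi> (E a b + (E c d + X)) x" "Val o1 o2 \<psi> (E a c + (E b d + X)) x'"
    "x - x' - mon X * NN k a b c d \<in> J"
  shows "Good o1 o2 \<psi> a b c d X"
  using assms unfolding Good_def by blast

lemma Good_swap: "Good o1 o2 \<psi> a b c d X \<Longrightarrow> Good o2 o1 \<psi> a b c d X"
  unfolding Good_def using Val_commute by blast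

lemma okv_vertices2: "okv a b \<Longrightarrow> okv c d \<Longrightarrow> a \<noteq> d \<Longrightarrow> okv a d"
  by (auto simp: okv_def okp_def)

lemma Good_flip:
  assumes "Good o1 o2 \<psi> b a d c X"
  shows "Good o1 o2 \<psi> a b c d X"
proof -
  have eq: "E b a + (E d c + X) = E a b + (E c d + X)" "E b d + (E a c + X) = E a c + (E b d + X)"
    by (simp_all add: E_commute ac_simps)
  show ?thesis
    using assms unfolding Good_def eq NN_flip(1)[of k a b c d] .
qed

lemma Good_flip':
  assumes "Good o1 o2 \<psi> c d a b X"
  shows "Good o1 o2 \<psi> a b c d X"
proof -
  have eq: "E c d + (E a b + X) = E a b + (E c d + X)" "E c a + (E d b + X) = E a c + (E b d + X)"
    by (simp_all add: E_commute ac_simps)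
  show ?thesis
    using assms unfolding Good_def eq NN_swap_pairs[of c d a b] .
qed

lemma Good_inv: "Good o1 o2 \<psi> a c b d X \<Longrightarrow> Good o1 o2 \<psi> a b c d X"
proof -
  assume "Good o1 o2 \<psi> a c b d X"
  then obtain x x' where x: "Val o1 o2 \<psi> (E a c + (E b d + X)) x" "Val o1 o2 \<psi> (E a b + (E c d + X)) x'"
    "x - x' - mon X * NN k a c b d \<in> J" unfolding Good_def by blast
  have eq: "x' - x - mon X * NN k a b c d = - (x - x' - mon X * NN k a c b d)"
    by (simp add: NN_def algebra_simps)
  have "x' - x - mon X * NN k a b c d \<in> J" unfolding eq by (rule J_uminus[OF x(3)])
  with x(1,2) show ?thesis unfolding Good_def by blast
qed

context
  fixes n \<psi>
  assumes cons: "consist n \<psi>"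
begin

lemma Good_common_edge:
  assumes "exok a b c d" "okv o1 o2" "vmon Z" "tot Z + 2 = n"
  shows "Good o1 o2 \<psi> a b c d (E o1 o2 + Z)"
proof (rule GoodI)
  show "Val o1 o2 \<psi> (E a b + (E c d + (E o1 o2 + Z))) (y o1 o2 * \<psi> (E a b + (E c d + Z)))"
    using Val_edge[of o1 o2 \<psi> "E a b + (E c d + Z)"] by (simp add: ac_simps)
  show "Val o1 o2 \<psi> (E a c + (E b d + (E o1 o2 + Z))) (y o1 o2 * \<psi> (E a c + (E b d + Z)))"
    using Val_edge[of o1 o2 \<psi> "E a c + (E b d + Z)"] by (simp add: ac_simps)
  have "y o1 o2 * (\<psi> (E a b + (E c d + Z)) - \<psi> (E a c + (E b d + Z)) - mon Z * NN k a b c d) \<in> J"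
    by (intro J_mult R_y okvD(1)[OF assms(2)] consD[OF cons assms(1,3,4)] refl)
  then show "y o1 o2 * \<psi> (E a b + (E c d + Z)) - y o1 o2 * \<psi> (E a c + (E b d + Z)) -
    mon (E o1 o2 + Z) * NN k a b c d \<in> J"
    unfolding mon_E_add by (simp add: algebra_simps)
qed

text \<open>Two exchanges on separate edges are performed in either order. The discrepancy is
  exactly the Koszul expression of the two tetrads.\<close>

lemma Good_common_pair:
  assumes "exok a b c d" "okv o1 u" "okv o2 v" "okv u v" "o1 \<noteq> o2" "u \<noteq> o2" "v \<noteq> o1"
    "vmon Z" "tot Z + 3 = n"
  shows "Good o1 o2 \<psi> a b c d (E o1 u + (E o2 v + Z))"
proof (rule GoodI)
  have o12: "okv o1 o2" by (rule okv_vertices[OF assms(2,3,5)])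
  show "Val o1 o2 \<psi> (E a b + (E c d + (E o1 u + (E o2 v + Z))))
    (mon (E a b + (E c d + Z)) * NN k o1 u o2 v + y o1 o2 * \<psi> (E u v + (E a b + (E c d + Z))))"
    by (rule Val_pair) (use assms in \<open>auto simp: ac_simps\<close>)
  show "Val o1 o2 \<psi> (E a c + (E b d + (E o1 u + (E o2 v + Z))))
    (mon (E a c + (E b d + Z)) * NN k o1 u o2 v + y o1 o2 * \<psi> (E u v + (E a c + (E b d + Z))))"
    by (rule Val_pair) (use assms in \<open>auto simp: ac_simps\<close>)
  have c: "\<psi> (E u v + (E a b + (E c d + Z))) - \<psi> (E u v + (E a c + (E b d + Z)))
      - mon (E u v + Z) * NN k a b c d \<in> J"
  proof (rule consD[OF cons assms(1)])
    show "vmon (E u v + Z)" "tot (E u v + Z) + 2 = n" using assms by simp_all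
  qed (simp_all add: ac_simps)
  have K: "KZ o1 u o2 v a b c d \<in> J"
    by (rule koszul) (use assms o12 in \<open>auto simp: exok_def\<close>)
  have eq: "mon (E a b + (E c d + Z)) * NN k o1 u o2 v + y o1 o2 * \<psi> (E u v + (E a b + (E c d + Z))) -
    (mon (E a c + (E b d + Z)) * NN k o1 u o2 v + y o1 o2 * \<psi> (E u v + (E a c + (E b d + Z)))) -
    mon (E o1 u + (E o2 v + Z)) * NN k a b c d =
    y o1 o2 * (\<psi> (E u v + (E a b + (E c d + Z))) - \<psi> (E u v + (E a c + (E b d + Z)))
      - mon (E u v + Z) * NN k a b c d) + mon Z * KZ o1 u o2 v a b c d"
    unfolding mon_E_add KZ_def DD_def by (simp add: algebra_simps)
  show "mon (E a b + (E c d + Z)) * NN k o1 u o2 v + y o1 o2 * \<psi> (E u v + (E a b + (E c d + Z))) -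
    (mon (E a c + (E b d + Z)) * NN k o1 u o2 v + y o1 o2 * \<psi> (E u v + (E a c + (E b d + Z)))) -
    mon (E o1 u + (E o2 v + Z)) * NN k a b c d \<in> J"
    unfolding eq by (intro J_add J_mult R_y vmon_mon assms okvD(1)[OF o12] c K)
qed

lemma Good_edge:
  assumes "okv c d" "c \<noteq> o2" "d \<noteq> o1"
  shows "Good o1 o2 \<psi> o1 o2 c d X"
proof (rule GoodI)
  show "Val o1 o2 \<psi> (E o1 o2 + (E c d + X)) (y o1 o2 * \<psi> (E c d + X))"
    by (rule Val_edge)
  show "Val o1 o2 \<psi> (E o1 c + (E o2 d + X)) (mon X * NN k o1 c o2 d + y o1 o2 * \<psi> (E c d + X))"
    by (rule Val_pair) (use assms in auto)
  show "y o1 o2 * \<psi> (E c d + X) - (mon X * NN k o1 c o2 d + y o1 o2 * \<psi> (E c d + X))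
      - mon X * NN k o1 o2 c d \<in> J"
    by (simp add: NN_def algebra_simps J_zero)
qed

text \<open>Both monomials are split to the same remainder \<open>E b c + X\<close>. The three ways
  to pair off o1, o2, b, c give three values of \<open>nn k\<close>, whose differences add
  up.\<close>

lemma Good_opposite:
  assumes "okv b c" "b \<noteq> o1" "c \<noteq> o1" "b \<noteq> o2" "c \<noteq> o2"
  shows "Good o1 o2 \<psi> o1 b c o2 X"
proof (rule GoodI)
  show "Val o1 o2 \<psi> (E o1 b + (E c o2 + X)) (mon X * NN k o1 b o2 c + y o1 o2 * \<psi> (E b c + X))"
    by (rule Val_pair) (use assms in \<open>auto simp: E_commute\<close>)
  show "Val o1 o2 \<psi> (E o1 c + (E b o2 + X)) (mon X * NN k o1 c o2 b + y o1 o2 * \<psi> (E c b + X))"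
    by (rule Val_pair) (use assms okv_commute in \<open>auto simp: E_commute\<close>)
  show "mon X * NN k o1 b o2 c + y o1 o2 * \<psi> (E b c + X)
      - (mon X * NN k o1 c o2 b + y o1 o2 * \<psi> (E c b + X)) - mon X * NN k o1 b c o2 \<in> J"
  proof -
    have "mon X * NN k o1 b o2 c + y o1 o2 * \<psi> (E b c + X)
      - (mon X * NN k o1 c o2 b + y o1 o2 * \<psi> (E c b + X)) - mon X * NN k o1 b c o2 = 0"
      by (simp add: E_commute[of c b] poly_defs algebra_simps y_commute)
    then show ?thesis by (simp add: J_zero)
  qed
qed

text \<open>Both monomials are split with the same edge o2 v. Comparing the remainders takes one
  exchange of p v, q r for p r, q v, and the resulting cycle is that of
  \<open>four_cycle\<close>.\<close>

lemma Good_hexagon: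
  assumes "exok o1 p q r" "p \<noteq> o2" "q \<noteq> o2" "o1 \<noteq> o2" "o1 \<noteq> r" "p \<noteq> q"
    "okv o2 v" "v \<noteq> o1" "okv p v" "okv q v" "vmon Z" "tot Z + 2 = n"
  shows "Good o1 o2 \<psi> o1 p q r (E o2 v + Z)"
proof (rule GoodI)
  have ok: "okv o1 p" "okv q r" "okv o1 q" "okv p r" using assms(1) by (auto simp: exok_def)
  have o12: "okv o1 o2" by (rule okv_vertices[OF ok(1) assms(7,4)])
  have okx: "okv o1 v" using okv_vertices2[OF ok(1) assms(7)] assms(8) by simp
  show "Val o1 o2 \<psi> (E o1 p + (E q r + (E o2 v + Z)))
    (mon (E q r + Z) * NN k o1 p o2 v + y o1 o2 * \<psi> (E p v + (E q r + Z)))"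
    by (rule Val_pair) (use assms in \<open>auto simp: ac_simps\<close>)
  show "Val o1 o2 \<psi> (E o1 q + (E p r + (E o2 v + Z)))
    (mon (E p r + Z) * NN k o1 q o2 v + y o1 o2 * \<psi> (E q v + (E p r + Z)))"
    by (rule Val_pair) (use assms in \<open>auto simp: ac_simps\<close>)
  have ex: "exok p v r q" using ok assms okv_commute by (auto simp: exok_def)
  have c: "\<psi> (E p v + (E q r + Z)) - \<psi> (E q v + (E p r + Z)) - mon Z * NN k p v r q \<in> J"
    by (rule consD[OF cons ex assms(11,12)]) (auto simp: ac_simps E_commute)
  have m1: "mn k p q v o1 r \<in> J"
    by (rule J_mn) (use okvD(1,2,3,4)[OF ok(1)] okvD(1,2,3,4)[OF ok(2)] okvD(1,2)[OF ok(3)]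
        okvD(1,2)[OF ok(4)] okvD[OF assms(7)] okvD(1,2)[OF assms(9)] okvD(1,2)[OF assms(10)] in auto)
  have m2: "mn p q o2 k v o1 \<in> J"
    by (rule J_mn) (use okvD[OF ok(1)] okvD[OF ok(2)] okvD[OF ok(3)]
        okvD[OF assms(7)] okvD[OF assms(9)] okvD[OF assms(10)] okvD[OF o12] in auto)
  have eq: "mon (E q r + Z) * NN k o1 p o2 v + y o1 o2 * \<psi> (E p v + (E q r + Z))
      - (mon (E p r + Z) * NN k o1 q o2 v + y o1 o2 * \<psi> (E q v + (E p r + Z)))
      - mon (E o2 v + Z) * NN k o1 p q r
    = y o1 o2 * (\<psi> (E p v + (E q r + Z)) - \<psi> (E q v + (E p r + Z)) - mon Z * NN k p v r q)
      + mon Z * (y k o2 * mn k p q v o1 r - y k r * mn p q o2 k v o1)"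
    unfolding mon_E_add four_cycle[symmetric] by (simp add: algebra_simps)
  show "mon (E q r + Z) * NN k o1 p o2 v + y o1 o2 * \<psi> (E p v + (E q r + Z))
      - (mon (E p r + Z) * NN k o1 q o2 v + y o1 o2 * \<psi> (E q v + (E p r + Z)))
      - mon (E o2 v + Z) * NN k o1 p q r \<in> J"
    unfolding eq
    by (intro J_add J_diff J_mult c m1 m2 R_y vmon_mon assms okvD(1)[OF o12]
        okvD(3)[OF assms(7)] okvD(4)[OF ok(2)])
qed

text \<open>Needed when \<open>p\<close> and \<open>q\<close> have no loops, so that one side can
  only be split with o2 q and the other only with o2 p. The remainders then differ by the exchange
  of r q, p o2 for r p, q o2, and closing the cycle costs a Koszul expression and one minor.\<close>

lemma Good_double:
  assumes "exok o1 p q r" "p \<noteq> o2" "q \<noteq> o2" "r \<noteq> o2" "o1 \<noteq> o2" "o1 \<noteq> r" "p \<noteq> q" "p \<noteq> o1" "q \<noteq> o1"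
    "okv o2 p" "okv o2 q" "vmon Z" "tot Z + 3 = n"
  shows "Good o1 o2 \<psi> o1 p q r (E o2 p + (E o2 q + Z))"
proof (rule GoodI)
  have ok: "okv o1 p" "okv q r" "okv o1 q" "okv p r" using assms(1) by (auto simp: exok_def)
  have o12: "okv o1 o2" by (rule okv_vertices[OF ok(1) assms(10,5)])
  have pq: "okv p q" "okv q p"
    using okv_vertices[OF ok(4) ok(2)] okv_vertices[OF ok(2) ok(4)] assms(7) by auto
  show "Val o1 o2 \<psi> (E o1 p + (E q r + (E o2 p + (E o2 q + Z))))
    (mon (E q r + (E o2 p + Z)) * NN k o1 p o2 q + y o1 o2 * \<psi> (E p q + (E q r + (E o2 p + Z))))"
    by (rule Val_pair) (use assms pq in \<open>auto simp: ac_simps\<close>)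
  show "Val o1 o2 \<psi> (E o1 q + (E p r + (E o2 p + (E o2 q + Z))))
    (mon (E p r + (E o2 q + Z)) * NN k o1 q o2 p + y o1 o2 * \<psi> (E q p + (E p r + (E o2 q + Z))))"
    by (rule Val_pair) (use assms pq in \<open>auto simp: ac_simps\<close>)
  have ex: "exok r q p o2" using ok assms okv_commute by (auto simp: exok_def)
  have c: "\<psi> (E p q + (E q r + (E o2 p + Z))) - \<psi> (E q p + (E p r + (E o2 q + Z)))
      - mon (E p q + Z) * NN k r q p o2 \<in> J"
  proof (rule consD[OF cons ex])
    show "vmon (E p q + Z)" "tot (E p q + Z) + 2 = n" using assms pq by auto
  qed (auto simp: ac_simps E_commute)
  have K: "KZ o1 p o2 q r q p o2 \<in> J"
    by (rule koszul) (use ok assms o12 pq okv_commute in \<open>auto simp: exok_def\<close>)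
  have m: "mn p k q o1 r o2 \<in> J"
    by (rule J_mn) (use okvD[OF ok(1)] okvD[OF ok(2)] okvD[OF ok(3)] okvD[OF ok(4)]
        okvD[OF assms(10)] okvD[OF assms(11)] in auto)
  have eq: "mon (E q r + (E o2 p + Z)) * NN k o1 p o2 q + y o1 o2 * \<psi> (E p q + (E q r + (E o2 p + Z)))
      - (mon (E p r + (E o2 q + Z)) * NN k o1 q o2 p + y o1 o2 * \<psi> (E q p + (E p r + (E o2 q + Z))))
      - mon (E o2 p + (E o2 q + Z)) * NN k o1 p q r
    = y o1 o2 * (\<psi> (E p q + (E q r + (E o2 p + Z))) - \<psi> (E q p + (E p r + (E o2 q + Z)))
        - mon (E p q + Z) * NN k r q p o2)
      + mon Z * (KZ o1 p o2 q r q p o2 - y o2 q * (y k p * mn p k q o1 r o2))"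
    unfolding mon_E_add KZ_def by (simp add: poly_defs algebra_simps y_commute)
  show "mon (E q r + (E o2 p + Z)) * NN k o1 p o2 q + y o1 o2 * \<psi> (E p q + (E q r + (E o2 p + Z)))
      - (mon (E p r + (E o2 q + Z)) * NN k o1 q o2 p + y o1 o2 * \<psi> (E q p + (E p r + (E o2 q + Z))))
      - mon (E o2 p + (E o2 q + Z)) * NN k o1 p q r \<in> J"
    unfolding eq
    by (intro J_add J_diff J_mult c m K R_y vmon_mon assms okvD(1)[OF o12]
        okvD(1)[OF assms(11)] okvD(4)[OF ok(1)])
qed

lemma Val_cases_no_edge:
  assumes "Val o1 o2 \<psi> M x" "yv o1 o2 \<notin> Poly_Mapping.keys M" "vmon M"
  obtains u v X where "M = E o1 u + (E o2 v + X)" "u \<noteq> o2" "v \<noteq> o1" "okv u v" "okv o1 u" "okv o2 v"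
proof -
  obtain u v X where "M = E o1 u + (E o2 v + X)" "u \<noteq> o2" "v \<noteq> o1" "okv u v"
    using assms(1,2) unfolding Val_def by (auto simp: keys_add_nat)
  then show thesis using that assms(3) by auto
qed

text \<open>As \<open>o2\<close> takes no part in the exchange, the edge at \<open>o2\<close> used
  for splitting lies in \<open>X\<close> on either side. The position of the edge used at
  \<open>o1\<close> decides the case.\<close>

lemma Good_one_label:
  assumes ex: "exok o1 p q r" and ne: "p \<noteq> o2" "q \<noteq> o2" "r \<noteq> o2" "o1 \<noteq> o2" "o1 \<noteq> r" "p \<noteq> q"
    and X: "vmon X" "tot X + 1 = n"
    and V: "Val o1 o2 \<psi> (E o1 p + (E q r + X)) x" and V': "Val o1 o2 \<psi> (E o1 q + (E p r + X)) x'"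
  shows "Good o1 o2 \<psi> o1 p q r X"
proof (cases "yv o1 o2 \<in> Poly_Mapping.keys X")
  case True
  then obtain Z where Z: "X = E o1 o2 + Z" by (rule E_splitE)
  show ?thesis unfolding Z by (rule Good_common_edge[OF ex]) (use X Z in auto)
next
  case False
  have ok: "okv o1 p" "okv q r" "okv o1 q" "okv p r" using ex by (auto simp: exok_def)
  have no: "yv o1 o2 \<notin> Poly_Mapping.keys (E o1 p + (E q r + X))"
    "yv o1 o2 \<notin> Poly_Mapping.keys (E o1 q + (E p r + X))"
    using False ne by (auto simp: keys_add_nat yv_eq_iff)
  obtain u v Y where M: "E o1 p + (E q r + X) = E o1 u + (E o2 v + Y)" "u \<noteq> o2" "v \<noteq> o1"
    "okv u v" "okv o1 u" "okv o2 v"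
    by (rule Val_cases_no_edge[OF V no(1)]) (use ok X in auto)
  obtain u' v' Y' where M': "E o1 q + (E p r + X) = E o1 u' + (E o2 v' + Y')" "u' \<noteq> o2" "v' \<noteq> o1"
    "okv u' v'" "okv o1 u'" "okv o2 v'"
    by (rule Val_cases_no_edge[OF V' no(2)]) (use ok X in auto)
  have "yv o2 v \<in> Poly_Mapping.keys (E o1 p + (E q r + X))"
    unfolding M(1) by (simp add: keys_add_nat)
  then have vX: "yv o2 v \<in> Poly_Mapping.keys X" using ne by (auto simp: keys_add_nat yv_eq_iff)
  then obtain X1 where X1: "X = E o2 v + X1" by (rule E_splitE)
  have "yv o2 v' \<in> Poly_Mapping.keys (E o1 q + (E p r + X))"
    unfolding M'(1) by (simp add: keys_add_nat)
  then have vX': "yv o2 v' \<in> Poly_Mapping.keys X" using ne by (auto simp: keys_add_nat yv_eq_iff)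
  then obtain X1' where X1': "X = E o2 v' + X1'" by (rule E_splitE)
  have in_pair: ?thesis
    if "yv o1 w \<in> Poly_Mapping.keys X2" "X = E o2 z + X2" "w \<noteq> o2" "z \<noteq> o1" "okv w z" for w z X2
  proof -
    obtain X3 where X3: "X2 = E o1 w + X3" using \<open>yv o1 w \<in> _\<close> by (rule E_splitE)
    have eq: "X = E o1 w + (E o2 z + X3)" using that(2) X3 by (simp add: ac_simps)
    show ?thesis unfolding eq by (rule Good_common_pair[OF ex]) (use X eq that ne in auto)
  qed
  have hex: ?thesis if "okv p z" "okv q z" "X = E o2 z + X2" "z \<noteq> o1" for z X2
    unfolding that(3) by (rule Good_hexagon[OF ex]) (use that X ne in auto)
  have u: "yv o1 u \<in> {yv o1 p, yv q r} \<union> Poly_Mapping.keys X1"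
  proof -
    have "E o2 v + (E o1 p + (E q r + X1)) = E o2 v + (E o1 u + Y)"
      using M(1) X1 by (simp add: ac_simps)
    then have "E o1 p + (E q r + X1) = E o1 u + Y" by simp
    then have "yv o1 u \<in> Poly_Mapping.keys (E o1 p + (E q r + X1))" by (simp add: keys_add_nat)
    then show ?thesis by (auto simp: keys_add_nat)
  qed
  have u': "yv o1 u' \<in> {yv o1 q, yv p r} \<union> Poly_Mapping.keys X1'"
  proof -
    have "E o2 v' + (E o1 q + (E p r + X1')) = E o2 v' + (E o1 u' + Y')"
      using M'(1) X1' by (simp add: ac_simps)
    then have "E o1 q + (E p r + X1') = E o1 u' + Y'" by simp
    then have "yv o1 u' \<in> Poly_Mapping.keys (E o1 q + (E p r + X1'))" by (simp add: keys_add_nat)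
    then show ?thesis by (auto simp: keys_add_nat)
  qed
  \<comment> \<open>The edge at \<open>o1\<close> lies in the common factor, or is o1 p on one side
    and o1 q on the other. If \<open>q\<close> or \<open>p\<close> equals \<open>o1\<close>, it may
    also be q r or p r; the exchange is then rewritten to start with that edge.\<close>
  consider "yv o1 u \<in> Poly_Mapping.keys X1" | "yv o1 u' \<in> Poly_Mapping.keys X1'"
    | "q = o1" "u = r" | "p = o1" "u' = r" | "u = p" "u' = q"
    using u u' ne by (auto simp: yv_eq_iff)
  then show ?thesis
  proof cases
    case 1
    then show ?thesis using in_pair X1 M by blast
  next
    case 2
    then show ?thesis using in_pair X1' M' by blast
  next
    case 3
    have "okv o1 v" using okv_vertices2[OF ok(1) M(6)] M(3) by simp
    have "Good o1 o2 \<psi> o1 r o1 p X"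
      unfolding X1 by (rule Good_hexagon) (use ex ne M 3 X X1 \<open>okv o1 v\<close> in \<open>auto simp: exok_def okv_commute\<close>)
    then show ?thesis using Good_flip' 3 by blast
  next
    case 4
    have "okv o1 v'" using okv_vertices2[OF ok(1) M'(6)] M'(3) by simp
    have "Good o1 o2 \<psi> o1 o1 r q X"
      unfolding X1' by (rule Good_hexagon) (use ex ne M' 4 X X1' \<open>okv o1 v'\<close> in \<open>auto simp: exok_def okv_commute\<close>)
    then show ?thesis using Good_flip 4 by blast
  next
    case 5
    show ?thesis
    proof (cases "okv q v \<or> okv p v'")
      case True
      then show ?thesis using hex M M' X1 X1' 5 by blast
    next
      case F: False
      \<comment> \<open>Neither splitting edge at \<open>o2\<close> serves for both sides. This pins
        down both edges, and \<open>X\<close> must contain o2 p as well as o2 q.\<close>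
      have v: "v = q" "q \<notin> L" and v': "v' = p" "p \<notin> L"
        using not_okv[OF ok(2) M(6)[unfolded okv_commute[of o2]]]
          not_okv[OF ok(4) M'(6)[unfolded okv_commute[of o2]]] F by auto
      have "yv o2 p \<in> Poly_Mapping.keys (E o2 q + X1)" using vX' X1 v v' by simp
      then have "yv o2 p \<in> Poly_Mapping.keys X1" using ne by (auto simp: keys_add_nat yv_eq_iff)
      then obtain Z where Z: "X1 = E o2 p + Z" by (rule E_splitE)
      have eq: "X = E o2 p + (E o2 q + Z)" using X1 Z v by (simp add: ac_simps)
      show ?thesis unfolding eq
        by (rule Good_double[OF ex]) (use ne M M' v v' X eq in auto)
    qed
  qed
qed

text \<open>With \<open>o1\<close> in first place, \<open>o2\<close> is joined to it before or after
  the exchange (\<open>Good_edge\<close>), or lies opposite to it (\<open>Good_opposite\<close>), or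
  is absent (\<open>Good_one_label\<close>). An opposite \<open>o2\<close> combined with a further
  occurrence of \<open>o1\<close> is again \<open>Good_edge\<close>, read from another end.\<close>

lemma Good_label:
  assumes ex: "exok o1 b c d" and ne: "o1 \<noteq> d" "b \<noteq> c" "o1 \<noteq> o2"
    and X: "vmon X" "tot X + 1 = n"
    and V: "Val o1 o2 \<psi> (E o1 b + (E c d + X)) x" and V': "Val o1 o2 \<psi> (E o1 c + (E b d + X)) x'"
  shows "Good o1 o2 \<psi> o1 b c d X"
proof -
  have ok: "okv o1 b" "okv c d" "okv o1 c" "okv b d" using ex by (auto simp: exok_def)
  consider "b = o2" | "c = o2" | "d = o2" "b = o1" "b \<noteq> o2" "c \<noteq> o2" | "d = o2" "c = o1" "b \<noteq> o2" "c \<noteq> o2"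
    | "d = o2" "b \<noteq> o1" "c \<noteq> o1" "b \<noteq> o2" "c \<noteq> o2" | "b \<noteq> o2" "c \<noteq> o2" "d \<noteq> o2"
    by blast
  then show ?thesis
  proof cases
    case 1
    then show ?thesis using Good_edge[of c d o2 o1 X] ok ne by auto
  next
    case 2
    then show ?thesis using Good_inv Good_edge[of b d o2 o1 X] ok ne by auto
  next
    case 3
    have "Good o1 o2 \<psi> o1 o2 o1 c X" by (rule Good_edge) (use 3 ok ne in auto)
    then show ?thesis using Good_flip[OF Good_inv] 3 by blast
  next
    case 4
    have "Good o1 o2 \<psi> o1 o2 o1 b X" by (rule Good_edge) (use 4 ok ne in auto)
    then show ?thesis using Good_flip' 4 by blast
  next
    case 5
    then have "okv b c" using okv_vertices[OF ok(4) ok(2)] ne by simp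
    then show ?thesis using Good_opposite[of b c o1 o2 X] 5 by simp
  next
    case 6
    then show ?thesis using Good_one_label[OF ex] ne X V V' by blast
  qed
qed

lemma Good_any_label:
  assumes ex: "exok a b c d" and l: "o1 \<in> {a, b, c, d}" and ne: "a \<noteq> d" "b \<noteq> c" "o1 \<noteq> o2"
    and X: "vmon X" "tot X + 1 = n"
    and V: "Val o1 o2 \<psi> (E a b + (E c d + X)) x" and V': "Val o1 o2 \<psi> (E a c + (E b d + X)) x'"
  shows "Good o1 o2 \<psi> a b c d X"
proof -
  have ok: "okv a b" "okv c d" "okv a c" "okv b d" using ex by (auto simp: exok_def)
  consider "o1 = a" | "o1 = b" | "o1 = c" | "o1 = d" using l by blast
  then show ?thesis
  proof cases
    case 1
    then show ?thesis using Good_label assms by blast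
  next
    case 2
    have eq: "E a b + (E c d + X) = E o1 a + (E d c + X)" "E a c + (E b d + X) = E o1 d + (E a c + X)"
      by (simp_all add: 2 E_commute ac_simps)
    note V2 = V[unfolded eq(1)] V'[unfolded eq(2)]
    have "Good o1 o2 \<psi> o1 a d c X"
      by (rule Good_label[OF _ _ _ _ _ _ V2]) (use ok ne 2 X okv_commute in \<open>auto simp: exok_def\<close>)
    then show ?thesis using Good_flip 2 by blast
  next
    case 3
    have eq: "E a b + (E c d + X) = E o1 d + (E a b + X)" "E a c + (E b d + X) = E o1 a + (E d b + X)"
      by (simp_all add: 3 E_commute ac_simps)
    note V2 = V[unfolded eq(1)] V'[unfolded eq(2)]
    have "Good o1 o2 \<psi> o1 d a b X"
      by (rule Good_label[OF _ _ _ _ _ _ V2]) (use ok ne 3 X okv_commute in \<open>auto simp: exok_def\<close>)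
    then show ?thesis using Good_flip' 3 by blast
  next
    case 4
    have eq: "E a b + (E c d + X) = E o1 c + (E b a + X)" "E a c + (E b d + X) = E o1 b + (E c a + X)"
      by (simp_all add: 4 E_commute ac_simps)
    note V2 = V[unfolded eq(1)] V'[unfolded eq(2)]
    have "Good o1 o2 \<psi> o1 c b a X"
      by (rule Good_label[OF _ _ _ _ _ _ V2]) (use ok ne 4 X okv_commute in \<open>auto simp: exok_def\<close>)
    then have "Good o1 o2 \<psi> b a d c X" using Good_flip' 4 by blast
    then show ?thesis by (rule Good_flip)
  qed
qed

text \<open>A coincidence a = d or b = c leaves the monomial unchanged and has N = 0. If neither
  \<open>o1\<close> nor \<open>o2\<close> is a vertex of the exchange, the edge or edges used for
  splitting lie in \<open>X\<close> and serve both sides.\<close>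

lemma Good_all:
  assumes ex: "exok a b c d" and ne: "o1 \<noteq> o2"
    and X: "vmon X" "tot X + 1 = n"
    and V: "Val o1 o2 \<psi> (E a b + (E c d + X)) x" and V': "Val o1 o2 \<psi> (E a c + (E b d + X)) x'"
  shows "Good o1 o2 \<psi> a b c d X"
proof -
  have ok: "okv a b" "okv c d" "okv a c" "okv b d" using ex by (auto simp: exok_def)
  consider "a = d \<or> b = c" | "a \<noteq> d" "b \<noteq> c" "o1 \<in> {a, b, c, d}" | "a \<noteq> d" "b \<noteq> c" "o2 \<in> {a, b, c, d}"
    | "o1 \<notin> {a, b, c, d}" "o2 \<notin> {a, b, c, d}"
    by blast
  then show ?thesis
  proof cases
    case 1
    then have "E a c + (E b d + X) = E a b + (E c d + X)"
      by (auto simp: E_commute ac_simps)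
    moreover have "NN k a b c d = (0 :: (nat \<times> nat, 'a) mpoly)" using 1 by (auto simp: poly_defs algebra_simps y_commute)
    ultimately show ?thesis using V by (intro GoodI[OF V]) (auto simp: J_zero)
  next
    case 2
    then show ?thesis using Good_any_label[OF ex] ne X V V' by blast
  next
    case 3
    then show ?thesis using Good_any_label[OF ex, of o2 o1] ne X V V' Val_commute Good_swap by blast
  next
    case 4
    show ?thesis
    proof (cases "yv o1 o2 \<in> Poly_Mapping.keys X")
      case True
      then obtain Z where Z: "X = E o1 o2 + Z" by (rule E_splitE)
      show ?thesis unfolding Z by (rule Good_common_edge[OF ex]) (use X Z in auto)
    next
      case False
      then have no: "yv o1 o2 \<notin> Poly_Mapping.keys (E a b + (E c d + X))"
        using 4 by (auto simp: keys_add_nat yv_eq_iff)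
      obtain u v Y where M: "E a b + (E c d + X) = E o1 u + (E o2 v + Y)" "u \<noteq> o2" "v \<noteq> o1"
        "okv u v" "okv o1 u" "okv o2 v"
        by (rule Val_cases_no_edge[OF V no]) (use ok X in auto)
      have "yv o1 u \<in> Poly_Mapping.keys (E a b + (E c d + X))"
        unfolding M(1) by (simp add: keys_add_nat)
      then have "yv o1 u \<in> Poly_Mapping.keys X" using 4 by (auto simp: keys_add_nat yv_eq_iff)
      then obtain X1 where X1: "X = E o1 u + X1" by (rule E_splitE)
      have "yv o2 v \<in> Poly_Mapping.keys (E a b + (E c d + X))"
        unfolding M(1) by (simp add: keys_add_nat)
      then have "yv o2 v \<in> Poly_Mapping.keys X" using 4 by (auto simp: keys_add_nat yv_eq_iff)
      then have "yv o2 v \<in> Poly_Mapping.keys X1"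
        using X1 ne M by (auto simp: keys_add_nat yv_eq_iff)
      then obtain Z where Z: "X1 = E o2 v + Z" by (rule E_splitE)
      show ?thesis unfolding X1 Z
        by (rule Good_common_pair[OF ex]) (use X X1 Z M ne in auto)
    qed
  qed
qed

end

end

definition restr :: "'v set \<Rightarrow> ('v \<Rightarrow>\<^sub>0 nat) \<Rightarrow> 'v \<Rightarrow>\<^sub>0 nat" where
  "restr A m = Poly_Mapping.mapp (\<lambda>v n. if v \<in> A then n else 0) m"

lemma lookup_restr: "Poly_Mapping.lookup (restr A m) v = (if v \<in> A then Poly_Mapping.lookup m v else 0)"
  by (auto simp: restr_def lookup_mapp when_def in_keys_iff)

lemma restr_add: "restr A (m + m') = restr A m + restr A m'"
  by (rule poly_mapping_eqI) (simp add: lookup_restr lookup_add)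

lemma restr_split: "restr (- A) m + restr A m = m"
  by (rule poly_mapping_eqI) (simp add: lookup_restr lookup_add)

lemma keys_restr: "Poly_Mapping.keys (restr A m) = Poly_Mapping.keys m \<inter> A"
  by (auto simp: in_keys_iff lookup_restr split: if_splits)

lemma restr_E: "restr A (E a b) = (if yv a b \<in> A then E a b else 0)"
  by (rule poly_mapping_eqI) (auto simp: lookup_restr E_def lookup_single when_def)

lemma mn_move_row:
  assumes "k \<in> {a, b, c}" "distinct [a, b, c]"
  shows "\<exists>r s. distinct [k, r, s] \<and> {k, r, s} = {a, b, c} \<and>
    (\<forall>d e f. mn a b c d e f = (mn k r s d e f :: (nat \<times> nat, 'a::comm_ring_1) mpoly) \<or>
      mn a b c d e f = - (mn k r s d e f :: (nat \<times> nat, 'a) mpoly))"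
proof -
  consider "a = k" | "b = k" | "c = k" using assms(1) by blast
  then show ?thesis
  proof cases
    case 1
    then show ?thesis using assms(2) by blast
  next
    case 2
    then show ?thesis using assms(2) mn_swap_rows1[of a b]
      by (intro exI[of _ a] exI[of _ c]) auto
  next
    case 3
    have "mn a b k d e f = (mn k a b d e f :: (nat \<times> nat, 'a) mpoly)" for d e f
      by (simp add: mn_def algebra_simps)
    then show ?thesis using assms(2) 3
      by (intro exI[of _ a] exI[of _ b]) auto
  qed
qed

text \<open>The condition refers to the degrees \<open>D\<close> only, so it selects the same pair
  for both monomials of an exchange. \<open>U\<close> will be the set of vertices without a
  loop.\<close>

definition adm :: "nat set \<Rightarrow> (nat \<Rightarrow> nat) \<Rightarrow> nat \<Rightarrow> nat \<Rightarrow> bool" where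
  "adm U D o1 o2 \<longleftrightarrow> o1 \<noteq> o2 \<and> D o1 > 0 \<and> D o2 > 0 \<and> (\<forall>p\<in>U. D p < D o1 + D o2)"

lemma adm_exists:
  assumes "finite U" "D w > 0" "D w' > 0" "w \<noteq> w'"
  shows "\<exists>o1 o2. adm U D o1 o2"
proof (cases "\<exists>u\<in>U. D u > 0")
  case True
  let ?U = "{u \<in> U. D u > 0}"
  have U: "finite ?U" "?U \<noteq> {}" using assms(1) True by auto
  \<comment> \<open>For a vertex of maximal degree in \<open>U\<close>, adding any positive degree
    exceeds every degree in \<open>U\<close>.\<close>
  obtain o1 where o1: "o1 \<in> ?U" "\<forall>p\<in>?U. D p \<le> D o1"
    using U Max_in[of "D ` ?U"] Max_ge[of "D ` ?U"] by fastforce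
  obtain o2 where o2: "o2 \<noteq> o1" "D o2 > 0" using assms(2-4) by metis
  have "D p < D o1 + D o2" if "p \<in> U" for p
  proof (cases "D p > 0")
    case True
    then have "D p \<le> D o1" using o1(2) that by simp
    then show ?thesis using o2 by simp
  next
    case False
    then show ?thesis using o2 by simp
  qed
  then have "adm U D o1 o2" using o1 o2 by (simp add: adm_def)
  then show ?thesis by blast
next
  case False
  then have "\<forall>p\<in>U. D p = 0" by simp
  then have "adm U D w w'" using assms by (simp add: adm_def)
  then show ?thesis by blast
qed

section \<open>Recursion on the degree and extension to polynomials\<close>

context loop_step
begin

text \<open>If no pair of edges at $o_1$ and $o_2$ could be used, all of them would end in one and the same
  vertex $p$ without a loop, whose degree would then be too large.\<close>

lemma Val_exists:
  assumes M: "vmon M" and adm: "adm (V - L) (\<lambda>v. dg v M) o1 o2"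
  shows "\<exists>x. Val o1 o2 \<psi> M x"
proof (rule ccontr)
  assume no: "\<not> ?thesis"
  have ne: "o1 \<noteq> o2" and pos: "dg o1 M > 0" "dg o2 M > 0" using adm by (auto simp: adm_def)
  have no1: "yv o1 o2 \<notin> Poly_Mapping.keys M"
    using no Val_edge E_splitE by metis
  have no2: "yv o2 o1 \<notin> Poly_Mapping.keys M"
    using no1 by (simp add: yv_commute[of o2 o1])
  have same: "u = v \<and> u \<notin> L"
    if uv: "yv o1 u \<in> Poly_Mapping.keys M" "yv o2 v \<in> Poly_Mapping.keys M" for u v
  proof -
    have "yv o1 u \<noteq> yv o2 v" "u \<noteq> o2" "v \<noteq> o1"
      using uv no1 no2 ne by (auto simp: yv_eq_iff)
    obtain X where X: "M = E o1 u + X" using uv(1) by (rule E_splitE)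
    then have "yv o2 v \<in> Poly_Mapping.keys X"
      using uv(2) \<open>yv o1 u \<noteq> yv o2 v\<close> by (auto simp: keys_add_nat)
    then obtain Y where Y: "X = E o2 v + Y" by (rule E_splitE)
    have "\<not> okv u v"
    proof
      assume "okv u v"
      then have "Val o1 o2 \<psi> M (mon Y * NN k o1 u o2 v + y o1 o2 * \<psi> (E u v + Y))"
        using X Y \<open>u \<noteq> o2\<close> \<open>v \<noteq> o1\<close> by (intro Val_pair) auto
      then show False using no by blast
    qed
    moreover have "okv o1 u" "okv o2 v" using M X Y by auto
    ultimately show ?thesis using okv_commute not_okv by blast
  qed
  obtain p X1 where p: "M = E o1 p + X1" "okv o1 p" using dg_posE[OF M pos(1)] .
  obtain p' X2 where p': "M = E o2 p' + X2" "okv o2 p'" using dg_posE[OF M pos(2)] .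
  have pk: "yv o1 p \<in> Poly_Mapping.keys M" unfolding p(1) by (simp add: keys_add_nat)
  have pk': "yv o2 p' \<in> Poly_Mapping.keys M" unfolding p'(1) by (simp add: keys_add_nat)
  have pL: "p' = p" "p \<notin> L" using same[OF pk pk'] by auto
  have all1: "u = p" if "yv o1 u \<in> Poly_Mapping.keys M" for u using same[OF that pk'] pL by auto
  have all2: "v = p" if "yv o2 v \<in> Poly_Mapping.keys M" for v using same[OF pk that] pL by auto
  have pne: "p \<noteq> o1" "p \<noteq> o2" using p p' pL by (auto simp: okv_def okp_def)
  have "dg o1 M + dg o2 M \<le> dg p M"
    unfolding dg_def wsum_add_fun[symmetric]
  proof (rule wsum_mono)
    fix e assume e: "e \<in> Poly_Mapping.keys M"
    then obtain a b where ab: "e = yv a b" using M by (auto simp: vmon_def)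
    have k1: "yv a b \<in> Poly_Mapping.keys M" using e ab by simp
    have k2: "yv b a \<in> Poly_Mapping.keys M" using k1 by (simp add: yv_commute[of b a])
    have ind: "(if fst e = v then 1 else 0) + (if snd e = v then 1 else 0)
        = (if a = v then 1 else 0) + (if b = v then (1::nat) else 0)" for v
      by (simp add: ab yv_def max_def min_def)
    consider "a = o1" "b = p" | "a = o2" "b = p" | "b = o1" "a = p" | "b = o2" "a = p"
      | "a \<noteq> o1" "a \<noteq> o2" "b \<noteq> o1" "b \<noteq> o2"
      using all1[of a] all1[of b] all2[of a] all2[of b] k1 k2 by metis
    then show "(if fst e = o1 then 1 else 0) + (if snd e = o1 then 1 else 0)
      + ((if fst e = o2 then 1 else 0) + (if snd e = o2 then 1 else 0))
      \<le> (if fst e = p then 1 else 0) + (if snd e = p then (1::nat) else 0)"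
      unfolding ind by cases (use pne ne in auto)
  qed
  moreover have "p \<in> V - L" using p pL by (auto simp: okv_def okp_def)
  ultimately show False using adm by (metis adm_def not_less)
qed

lemma consist_Suc:
  assumes cons: "consist n \<psi>"
  shows "\<exists>\<psi>'. consist (Suc n) \<psi>'"
proof -
  \<comment> \<open>The pair is a function of the degrees, not of the monomial, so that
    \<open>?M\<close> and \<open>?M'\<close> are split along the same pair.\<close>
  define sel where "sel D = (SOME p. adm (V - L) D (fst p) (snd p))" for D
  define \<psi>' where "\<psi>' M = (if \<exists>o1 o2. adm (V - L) (\<lambda>v. dg v M) o1 o2
    then SOME x. Val (fst (sel (\<lambda>v. dg v M))) (snd (sel (\<lambda>v. dg v M))) \<psi> M x else 0)" for M
  have "\<psi>' (E a b + (E c d + X)) - \<psi>' (E a c + (E b d + X)) - mon X * NN k a b c d \<in> J"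
    if ex: "exok a b c d" and X: "vmon X" "tot X + 2 = Suc n" for a b c d X
  proof -
    let ?M = "E a b + (E c d + X)" and ?M' = "E a c + (E b d + X)"
    define D where "D = (\<lambda>v. dg v ?M)"
    have D': "(\<lambda>v. dg v ?M') = D" by (auto simp: D_def)
    have ok: "okv a b" "okv c d" "okv a c" "okv b d" using ex by (auto simp: exok_def)
    have vm: "vmon ?M" "vmon ?M'" using ok X by auto
    show ?thesis
    proof (cases "\<exists>o1 o2. adm (V - L) D o1 o2")
      case True
      define o1 o2 where "o1 = fst (sel D)" and "o2 = snd (sel D)"
      have adm: "adm (V - L) D o1 o2"
        unfolding o1_def o2_def sel_def using True by (metis (mono_tags, lifting) fst_conv snd_conv someI_ex)
      have "\<exists>x. Val o1 o2 \<psi> ?M x" using Val_exists[OF vm(1)] adm unfolding D_def by blast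
      then have V: "Val o1 o2 \<psi> ?M (\<psi>' ?M)"
        unfolding \<psi>'_def using True
        by (simp only: D_def[symmetric] o1_def[symmetric] o2_def[symmetric] if_True) (rule someI_ex)
      have "\<exists>x. Val o1 o2 \<psi> ?M' x" using Val_exists[OF vm(2)] adm unfolding D' by blast
      then have V': "Val o1 o2 \<psi> ?M' (\<psi>' ?M')"
        unfolding \<psi>'_def using True
        by (simp only: D' o1_def[symmetric] o2_def[symmetric] if_True) (rule someI_ex)
      have ne: "o1 \<noteq> o2" using adm by (auto simp: adm_def)
      have "Good o1 o2 \<psi> a b c d X"
        using Good_all[OF cons ex ne X(1) _ V V'] X(2) by simp
      then obtain x x' where x: "Val o1 o2 \<psi> ?M x" "Val o1 o2 \<psi> ?M' x'"
        "x - x' - mon X * NN k a b c d \<in> J" unfolding Good_def by blast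
      have "\<psi>' ?M - x \<in> J" by (rule Val_unique[OF cons vm(1) _ ne V x(1)]) (use X in simp)
      moreover have "\<psi>' ?M' - x' \<in> J" by (rule Val_unique[OF cons vm(2) _ ne V' x(2)]) (use X in simp)
      ultimately have "(\<psi>' ?M - x) - (\<psi>' ?M' - x') + (x - x' - mon X * NN k a b c d) \<in> J"
        using x(3) J_add J_diff by blast
      then show ?thesis by (simp add: algebra_simps)
    next
      case False
      \<comment> \<open>Two distinct vertices of positive degree would yield an admissible pair.
        Hence all four ends coincide, the exchange is trivial, and the default value 0 does no
        harm.\<close>
      have "D a > 0" "D b > 0" "D c > 0" "D d > 0" by (auto simp: D_def)
      then have "a = b \<and> c = b \<and> d = b"
        using False adm_exists[of "V - L" D] finV by (metis finite_Diff)
      then show ?thesis by (simp add: NN_def J_zero)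
    qed
  qed
  then show ?thesis unfolding consist_def by blast
qed

lemma consist_all: "\<exists>\<psi>. \<forall>n. consist n (\<psi> n)"
proof -
  have "\<exists>\<psi>. consist n \<psi>" for n
  proof (induction n)
    case 0
    show ?case by (simp add: consist_def)
  next
    case (Suc n)
    then show ?case using consist_Suc by blast
  qed
  then show ?thesis by metis
qed

definition psi where "psi = (SOME \<psi>. \<forall>n. consist n (\<psi> n))"

lemma psi_consist: "consist n (psi n)"
  using someI_ex[OF consist_all] unfolding psi_def by blast

definition vedges :: "(nat \<times> nat) set" where
  "vedges = {yv a b | a b. okv a b}"

lemma yv_in_vedges: "yv a b \<in> vedges \<longleftrightarrow> okv a b"
  unfolding vedges_def using okv_commute by (auto simp: yv_eq_iff)

lemma vmon_restr: "vmon (restr vedges m)"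
  by (simp add: vmon_def keys_restr vedges_def)

text \<open>Edges at \<open>k\<close> act as scalars: only the part of the monomial avoiding
  \<open>k\<close> is subject to exchanges, and its total degree selects the member of the family
  \<open>psi\<close>.\<close>

definition PsiM :: "(nat \<times> nat \<Rightarrow>\<^sub>0 nat) \<Rightarrow> (nat \<times> nat, 'a) mpoly" where
  "PsiM m = mon (restr (- vedges) m) * psi (tot (restr vedges m)) (restr vedges m)"

definition Psi :: "(nat \<times> nat, 'a) mpoly \<Rightarrow> (nat \<times> nat, 'a) mpoly" where
  "Psi = lin Const PsiM"

lemma Const_simps: "Const 0 = 0" "Const (u + v) = Const u + Const v"
  by (simp_all add: Const_def single_add)

lemma Psi_add: "Psi (f + g) = Psi f + Psi g"
  unfolding Psi_def by (rule lin_add) (simp_all add: Const_simps)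

lemma Psi_zero: "Psi 0 = 0"
  by (simp add: Psi_def)

lemma Psi_diff: "Psi (f - g) = Psi f - Psi g"
  using Psi_add[of "f - g" g] by simp

lemma Psi_single: "Psi (Poly_Mapping.single m c) = Const c * PsiM m"
  unfolding Psi_def by (rule lin_single) (simp add: Const_simps)

text \<open>\<open>Psi\<close> is constructed to be additive, while linearity over \<open>R\<close>
  modulo \<open>J\<close> is needed on the ideal of tetrads. The quantifier over \<open>r\<close>
  builds that linearity into the claim that \<open>s\<close> has the value \<open>h\<close>.\<close>

definition rep where
  "rep s h \<longleftrightarrow> (\<forall>r\<in>R. Psi (r * s) - r * h \<in> J)"

lemma rep_zero: "rep 0 0"
  by (simp add: rep_def Psi_zero J_zero)

lemma rep_add: "rep s h \<Longrightarrow> rep s' h' \<Longrightarrow> rep (s + s') (h + h')"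
proof -
  assume a: "rep s h" "rep s' h'"
  have "Psi (r * (s + s')) - r * (h + h') = (Psi (r * s) - r * h) + (Psi (r * s') - r * h')" for r
    by (simp add: distrib_left Psi_add)
  then show ?thesis using a J_add unfolding rep_def by simp
qed

lemma rep_diff: "rep s h \<Longrightarrow> rep s' h' \<Longrightarrow> rep (s - s') (h - h')"
proof -
  assume a: "rep s h" "rep s' h'"
  have "Psi (r * (s - s')) - r * (h - h') = (Psi (r * s) - r * h) - (Psi (r * s') - r * h')" for r
    by (simp add: right_diff_distrib Psi_diff)
  then show ?thesis using a J_diff unfolding rep_def by simp
qed

lemma rep_mult: "g \<in> R \<Longrightarrow> rep s h \<Longrightarrow> rep (g * s) (g * h)"
proof (unfold rep_def, intro ballI)
  fix r assume g: "g \<in> R" and rep: "\<forall>r\<in>R. Psi (r * s) - r * h \<in> J" and r: "r \<in> R"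
  have "Psi ((r * g) * s) - (r * g) * h \<in> J" using rep R_mult[OF r g] by blast
  then show "Psi (r * (g * s)) - r * (g * h) \<in> J" by (simp add: mult.assoc)
qed

lemma rep_DD:
  assumes ex: "exok a b c d"
  shows "rep (DD a b c d) (NN k a b c d)"
  unfolding rep_def
proof
  fix r assume "r \<in> R"
  then show "Psi (r * DD a b c d) - r * NN k a b c d \<in> J"
    unfolding R_eq
  proof (induction r rule: polyring_induct)
    case zero
    show ?case by (simp add: Psi_zero J_zero)
  next
    case (add f g)
    have "Psi ((f + g) * DD a b c d) - (f + g) * NN k a b c d
        = (Psi (f * DD a b c d) - f * NN k a b c d) + (Psi (g * DD a b c d) - g * NN k a b c d)"
      by (simp add: distrib_right Psi_add)
    then show ?case using add J_add by simp
  next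
    case (mon c' m)
    let ?X = "restr vedges m" and ?K = "restr (- vedges) m"
    have ok: "okv a b" "okv c d" "okv a c" "okv b d" using ex by (auto simp: exok_def)
    have K: "mon ?K \<in> R"
      unfolding R_eq by (rule polyring_single) (use mon in \<open>auto simp: keys_restr\<close>)
    have m: "mon m = mon ?K * (mon ?X :: (nat \<times> nat, 'a) mpoly)"
      by (simp add: mult_single restr_split)
    have eq1: "Const c' * mon m * DD a b c d =
        Poly_Mapping.single (m + (E a b + E c d)) c' - Poly_Mapping.single (m + (E a c + E b d)) c'"
      by (simp add: DD_def mon_E[symmetric] mult_single right_diff_distrib Const_def)
    have P1: "PsiM (m + (E a b + E c d)) = mon ?K * psi (tot ?X + 2) (E a b + (E c d + ?X))"
      using ok by (simp add: PsiM_def restr_add restr_E yv_in_vedges ac_simps)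
    have P2: "PsiM (m + (E a c + E b d)) = mon ?K * psi (tot ?X + 2) (E a c + (E b d + ?X))"
      using ok by (simp add: PsiM_def restr_add restr_E yv_in_vedges ac_simps)
    have c: "psi (tot ?X + 2) (E a b + (E c d + ?X)) - psi (tot ?X + 2) (E a c + (E b d + ?X))
        - mon ?X * NN k a b c d \<in> J"
      by (rule consD[OF psi_consist ex vmon_restr]) auto
    have eq2: "Psi (Const c' * mon m * DD a b c d) - Const c' * mon m * NN k a b c d
        = Const c' * (mon ?K * (psi (tot ?X + 2) (E a b + (E c d + ?X))
          - psi (tot ?X + 2) (E a c + (E b d + ?X)) - mon ?X * NN k a b c d))"
      unfolding eq1 Psi_diff Psi_single P1 P2 unfolding m by (simp add: algebra_simps)
    show ?case
      unfolding eq2 by (intro J_mult c K) (simp add: R_eq polyring_Const)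
  qed
qed

section \<open>The extended map sends the ideal into itself\<close>

definition killed where
  "killed s \<longleftrightarrow> (\<forall>r\<in>R. Psi (r * s) \<in> J)"

lemma killedI: "rep s h \<Longrightarrow> h \<in> J \<Longrightarrow> killed s"
  unfolding rep_def killed_def using J_mult J_add by (metis diff_add_cancel)

lemma killed_uminus: "killed (- s) \<longleftrightarrow> killed s"
proof -
  have "Psi (r * (- s)) = - Psi (r * s)" for r
    using Psi_diff[of 0 "r * s"] by (simp add: Psi_zero)
  then show ?thesis by (simp add: killed_def J_uminus_iff)
qed

lemma NN_in_R:
  assumes "exok a b c d" "ok x a" "ok x b" "ok x c" "ok x d"
  shows "NN x a b c d \<in> R"
  unfolding NN_def nn_def using assms by (auto intro!: R_closed simp: exok_def okvD)

lemma killed_row: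
  assumes "\<forall>s\<in>{d, e, f}. okv b s \<and> okv c s"
  shows "killed (mn k b c d e f)"
proof (rule killedI)
  show "rep (mn k b c d e f)
    (y k d * NN k b e f c - y k e * NN k b d f c + y k f * NN k b d e c)"
    unfolding minor_tetrads
    by (intro rep_add rep_diff rep_mult rep_DD R_y)
      (use assms okv_commute okvD in \<open>auto simp: exok_def\<close>)
qed (simp add: minor_lift_row J_zero)

text \<open>A row expansion writes the minor through tetrads. If \<open>k\<close> is a row, that row
  is expanded, the tetrads avoid \<open>k\<close>, and the lift is 0; a column \<open>k\<close> is
  reduced to this by transposing. Otherwise the lift consists of minors with a row replaced by
  \<open>k\<close>.\<close>

lemma killed_minor:
  assumes "s \<in> minors V L"
  shows "killed s"
proof -
  obtain a b c d e f where s: "s = mn a b c d e f" "distinct [a, b, c]" "distinct [d, e, f]"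
    and ok: "\<forall>r\<in>{a, b, c}. \<forall>s\<in>{d, e, f}. ok r s"
    using assms unfolding minors_def by blast
  have row: "killed (mn a b c d e f)"
    if km: "k \<in> {a, b, c}" and dm: "distinct [a, b, c]" and ok: "\<forall>r\<in>{a, b, c}. \<forall>s\<in>{d, e, f}. ok r s" for a b c d e f
  proof -
    obtain r t where rt: "distinct [k, r, t]" "{k, r, t} = {a, b, c}"
      "mn a b c d e f = (mn k r t d e f :: (nat \<times> nat, 'a) mpoly) \<or>
       mn a b c d e f = - (mn k r t d e f :: (nat \<times> nat, 'a) mpoly)"
      using mn_move_row[OF km dm] by blast
    have "k \<notin> {d, e, f}" using ok km kL by (auto simp: okp_def)
    moreover have "\<forall>x\<in>{k, r, t}. \<forall>s\<in>{d, e, f}. ok x s" unfolding rt(2) by (rule ok)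
    ultimately have "killed (mn k r t d e f)"
      using rt(1) by (intro killed_row) (auto simp: okv_def)
    then show ?thesis using rt(3) killed_uminus by metis
  qed
  consider "k \<in> {a, b, c}" | "k \<in> {d, e, f}" | "k \<notin> {a, b, c}" "k \<notin> {d, e, f}" by blast
  then show ?thesis
  proof cases
    case 1
    then show ?thesis using row s ok by blast
  next
    case 2
    have "killed (mn d e f a b c)"
      by (rule row) (use 2 s ok okp_commute in auto)
    then show ?thesis using s mn_transpose by metis
  next
    case 3
    then have okv: "\<forall>r\<in>{a, b, c}. \<forall>s\<in>{d, e, f}. okv r s" using ok by (auto simp: okv_def)
    show ?thesis unfolding s(1)
    proof (rule killedI)
      show "rep (mn a b c d e f) (y a d * NN k b e f c - y a e * NN k b d f c + y a f * NN k b d e c)"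
        unfolding minor_tetrads
        by (intro rep_add rep_diff rep_mult rep_DD R_y)
          (use okv okv_commute okvD in \<open>auto simp: exok_def\<close>)
      have "mn a k c d e f \<in> J" "mn a b k d e f \<in> J"
        by (rule J_mn; use okv okvD in auto)+
      then show "y a d * NN k b e f c - y a e * NN k b d f c + y a f * NN k b d e c \<in> J"
        unfolding minor_lift by (intro J_add J_mult R_y) (use okv okvD in auto)
    qed
  qed
qed

lemma okv_outside: "a \<in> V - L \<Longrightarrow> b \<in> V - L \<Longrightarrow> a \<noteq> b \<Longrightarrow> a \<noteq> k \<Longrightarrow> b \<noteq> k \<Longrightarrow> okv a b"
  by (auto simp: okv_def okp_def)

lemma ok_outside: "a \<in> V - L \<Longrightarrow> b \<in> V - L \<Longrightarrow> a \<noteq> b \<Longrightarrow> ok a b"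
  by (auto simp: okp_def)

text \<open>The pentad N' D - N D' is a combination of tetrads avoiding \<open>k\<close>, with value
  N' N - N N' = 0.\<close>

lemma killed_pentad_center:
  assumes "distinct [k, a, b, c, d]" "{a, b, c, d} \<subseteq> V - L"
  shows "killed (pentf k a b c d)"
proof (rule killedI)
  have ex: "exok a b c d" "exok a b d c"
    using assms okv_outside by (auto simp: exok_def)
  have okk: "ok k a" "ok k b" "ok k c" "ok k d" using ex okvD by (auto simp: exok_def)
  have NR: "NN k a b d c \<in> R" "NN k a b c d \<in> R" using NN_in_R ex okk by auto
  have "rep (NN k a b d c * DD a b c d - NN k a b c d * DD a b d c)
      (NN k a b d c * NN k a b c d - NN k a b c d * NN k a b d c)"
    by (intro rep_diff rep_mult rep_DD ex NR)
  then show "rep (pentf k a b c d) 0"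
    unfolding pentf_def by (simp add: mult.commute)
qed (rule J_zero)

lemma killed_pentad:
  assumes "s \<in> pentads (V - L)"
  shows "killed s"
proof -
  obtain a b c d f where s: "s = pentf a b c d f" "distinct [a, b, c, d, f]" "{a, b, c, d, f} \<subseteq> V - L"
    using assms unfolding pentads_def by blast
  consider "k = a" | "k = b" | "k = c" | "k = d" | "k = f" | "k \<notin> {a, b, c, d, f}" by blast
  then show ?thesis
  proof cases
    case 1
    then show ?thesis using s killed_pentad_center by auto
  next
    case 2
    have "killed (pentf k a c d f)" by (rule killed_pentad_center) (use s 2 in auto)
    then have "killed (pentf a k c d f)"
      unfolding pentf_swap1[of a k c d f] by (simp only: killed_uminus)
    then show ?thesis using s(1) 2 by simp
  next
    case 3
    have "killed (pentf k a b d f)" by (rule killed_pentad_center) (use s 3 in auto)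
    then have "killed (pentf a b k d f)"
      unfolding pentf_swap2[of a b k d f] pentf_swap1[of a k b d f] by simp
    then show ?thesis using s(1) 3 by simp
  next
    case 4
    have "killed (pentf k a b c f)" by (rule killed_pentad_center) (use s 4 in auto)
    then have "killed (pentf a b c k f)"
      unfolding pentf_swap3[of a b c k f] pentf_swap2[of a b k c f] pentf_swap1[of a k b c f]
      by (simp only: killed_uminus minus_minus)
    then show ?thesis using s(1) 4 by simp
  next
    case 5
    have "killed (pentf k a b c d)" by (rule killed_pentad_center) (use s 5 in auto)
    then have "killed (pentf a b c d k)"
      unfolding pentf_swap4[of a b c d k] pentf_swap3[of a b c k d] pentf_swap2[of a b k c d]
        pentf_swap1[of a k b c d] by simp
    then show ?thesis using s(1) 5 by simp
  next
    case 6
    \<comment> \<open>The pentad avoids \<open>k\<close>, so it is expanded around \<open>a\<close>;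
      its coefficients are of type \<open>NN a\<close>, and the lift mixes them with
      \<open>NN k\<close>, as in \<open>pentad_lift\<close>.\<close>
    have ex: "exok b c d f" "exok b c f d"
      using s 6 okv_outside by (auto simp: exok_def)
    have oka: "ok a b" "ok a c" "ok a d" "ok a f" using s ok_outside by auto
    have okk: "ok k a" "ok k b" "ok k c" "ok k d" "ok k f" using ok_outside s 6 kV kL by auto
    have NR: "NN a b c f d \<in> R" "NN a b c d f \<in> R" using NN_in_R ex oka by auto
    have "rep (NN a b c f d * DD b c d f - NN a b c d f * DD b c f d)
      (NN a b c f d * NN k b c d f - NN a b c d f * NN k b c f d)"
      by (intro rep_diff rep_mult rep_DD ex NR)
    then have rep: "rep s (NN k b c d f * NN a b c f d - NN k b c f d * NN a b c d f)"
      unfolding s(1) pentf_def by (simp add: mult.commute)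
    have okx: "ok b k" "ok c k" "ok d k" "ok f k" "ok a k" using okk okp_commute by auto
    have "ok r t" if "r \<in> {a, b, c, d, f, k}" "t \<in> {a, b, c, d, f, k}" "r \<noteq> t" for r t
      using that s ok_outside kV kL by auto
    note o = this
    have m: "mn a c k b d f \<in> J" "mn a d k b c f \<in> J" "mn a b d c f k \<in> J" "mn a f k b c d \<in> J"
      "mn a b k c d f \<in> J" "mn a c f b d k \<in> J"
      by (rule J_mn; use s 6 o in auto)+
    have Y: "y a d \<in> R" "y b f \<in> R" "y c k \<in> R" "y b k \<in> R" "y c f \<in> R" "y a c \<in> R" "y b d \<in> R"
      "y f k \<in> R" "y d f \<in> R" "y b c \<in> R" "y a f \<in> R" "y c d \<in> R" "y a b \<in> R" "y d k \<in> R"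
      by (rule R_y; rule o; use s 6 in auto)+
    show ?thesis
      by (rule killedI[OF rep]) (unfold pentad_lift, intro J_add J_diff J_mult R_mult m Y)
  qed
qed

lemma Psi_J: "f \<in> J \<Longrightarrow> Psi f \<in> J"
proof -
  have "J \<subseteq> {f. Psi f \<in> J}"
  proof -
    have "ideal_of (polyring (evars V L)) (minors V L \<union> pentads (V - L)) \<subseteq> {f. Psi f \<in> J}"
    proof (rule ideal_of_subset)
      fix r s :: "(nat \<times> nat, 'a) mpoly"
      assume r: "r \<in> polyring (evars V L)" and "s \<in> minors V L \<union> pentads (V - L)"
      then have "killed s" using killed_minor killed_pentad by blast
      then show "r * s \<in> {f. Psi f \<in> J}" using r[folded R_eq] by (simp add: killed_def)
    qed (auto simp: Psi_add Psi_zero J_add J_zero)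
    then show ?thesis by (simp add: J_eq JJ_def)
  qed
  then show "f \<in> J \<Longrightarrow> Psi f \<in> J" by blast
qed

end

section \<open>Elimination of one loop variable\<close>

context loop_step
begin

definition loop_sub :: "nat \<times> nat \<Rightarrow> (nat \<times> nat, 'a) mpoly poly" where
  "loop_sub v = (if v = (k, k) then [:0, 1:] else [:Var v:])"

text \<open>The ring with the loop at \<open>k\<close> is read as univariate polynomials in that
  loop. Elements of \<open>R\<close> become constants (\<open>loop_poly_R\<close>), so eliminating
  the loop amounts to comparing coefficients.\<close>

definition loop_poly :: "(nat \<times> nat, 'a) mpoly \<Rightarrow> (nat \<times> nat, 'a) mpoly poly" where
  "loop_poly = evalp (\<lambda>c. [:Const c:]) loop_sub"

lemma coeff_hom_loop: "coeff_hom (\<lambda>c::'a. [:Const c :: (nat \<times> nat, 'a) mpoly:])"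
  by unfold_locales (simp_all add: Const_def single_add mult_single one_pCons mult.commute)

interpretation lp: coeff_hom "\<lambda>c::'a. [:Const c :: (nat \<times> nat, 'a) mpoly:]"
  by (rule coeff_hom_loop)

lemma loop_poly_y: "loop_poly (y a b) = (if a = k \<and> b = k then [:0, 1:] else [:y a b:])"
  by (auto simp: loop_poly_def y_def lp.evalp_Var loop_sub_def yv_def max_def min_def)

lemma loop_poly_mult: "loop_poly (f * g) = loop_poly f * loop_poly g"
  by (simp add: loop_poly_def lp.evalp_mult)

lemma loop_poly_add: "loop_poly (f + g) = loop_poly f + loop_poly g"
  by (simp add: loop_poly_def lp.evalp_add)

lemma loop_poly_diff: "loop_poly (f - g) = loop_poly f - loop_poly g"
  by (simp add: loop_poly_def lp.evalp_diff)

lemma loop_poly_zero: "loop_poly 0 = 0"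
  by (simp add: loop_poly_def lp.evalp_zero)

lemma loop_poly_uminus: "loop_poly (- f) = - loop_poly f"
  by (simp add: loop_poly_def lp.evalp_uminus)

lemma loop_poly_Const_mon: "loop_poly (Const c * mon m) = [:Const c:] * mval loop_sub m"
  by (simp add: loop_poly_def lp.evalp_mult lp.evalp_Const lp.evalp_mon)

lemma loop_not_evar: "(k, k) \<notin> evars V L"
proof
  assume "(k, k) \<in> evars V L"
  then obtain a b where "(k, k) = yv a b" "ok a b" by (auto simp: evars_def)
  then have "a = k" "b = k" by (auto simp: yv_def max_def min_def split: if_splits)
  then show False using \<open>ok a b\<close> kL by (simp add: okp_def)
qed

lemma mval_loop_sub:
  "Poly_Mapping.keys m \<subseteq> evars V L \<Longrightarrow> mval loop_sub m = [:mon m:]"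
proof (induction m rule: mon_induct)
  case (add v m)
  then have "v \<in> evars V L" "Poly_Mapping.keys m \<subseteq> evars V L" by (auto simp: keys_add_nat)
  moreover have "v \<noteq> (k, k)" using calculation loop_not_evar by auto
  ultimately show ?case
    using add.IH by (simp add: mval_add loop_sub_def Var_def mult_single add.commute)
qed (simp add: one_pCons)

lemma loop_poly_R: "f \<in> R \<Longrightarrow> loop_poly f = [:f:]"
  unfolding R_eq
proof (induction f rule: polyring_induct)
  case (mon c m)
  then show ?case by (simp add: loop_poly_Const_mon mval_loop_sub)
qed (simp_all add: loop_poly_zero loop_poly_add)

definition CR :: "(nat \<times> nat, 'a) mpoly poly set" where
  "CR = {p. \<forall>i. coeff p i \<in> R}"

lemma R_zero: "0 \<in> R" and R_one: "1 \<in> R" and R_Const: "Const c \<in> R"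
  by (simp_all add: R_eq polyring_Const)

lemma CR_const: "r \<in> R \<Longrightarrow> [:r:] \<in> CR"
  by (simp add: CR_def coeff_pCons R_zero split: nat.split)

lemma CR_add: "p \<in> CR \<Longrightarrow> q \<in> CR \<Longrightarrow> p + q \<in> CR"
  by (simp add: CR_def R_add)

lemma CR_mult: "p \<in> CR \<Longrightarrow> q \<in> CR \<Longrightarrow> p * q \<in> CR"
proof -
  assume "p \<in> CR" "q \<in> CR"
  moreover have "(\<Sum>i\<in>A. f i) \<in> R" if "\<And>i. f i \<in> R" for A :: "nat set" and f
    using that by (induction A rule: infinite_finite_induct) (auto intro: R_zero R_add)
  ultimately show "p * q \<in> CR" by (simp add: CR_def coeff_mult R_mult)
qed

lemma loop_poly_CR:
  assumes "f \<in> polyring (evars V (insert k L))"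
  shows "loop_poly f \<in> CR"
  using assms
proof (induction f rule: polyring_induct)
  case zero
  then show ?case by (simp add: loop_poly_zero CR_def R_zero)
next
  case (add f g)
  then show ?case by (simp add: loop_poly_add CR_add)
next
  case (mon c m)
  then have "mval loop_sub m \<in> CR"
  proof (induction m rule: mon_induct)
    case zero
    then show ?case using CR_const[OF R_one] by (simp add: one_pCons)
  next
    case (add v m)
    then have v: "v \<in> evars V (insert k L)" by (auto simp: keys_add_nat)
    have "loop_sub v \<in> CR"
    proof (cases "v = (k, k)")
      case True
      then show ?thesis by (simp add: loop_sub_def CR_def coeff_pCons R_zero R_one split: nat.split)
    next
      case False
      obtain a b where ab: "v = yv a b" "okp V (insert k L) a b" using v by (auto simp: evars_def)
      then have "ok a b" using False by (auto simp: okp_def yv_def)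
      then have "Var v \<in> R" using ab R_y by (simp add: y_def)
      then show ?thesis using False by (simp add: loop_sub_def CR_const)
    qed
    moreover have "mval loop_sub m \<in> CR" using add by (simp add: keys_add_nat)
    ultimately show ?case by (simp add: mval_add CR_mult)
  qed
  then show ?case by (simp only: loop_poly_Const_mon) (intro CR_mult CR_const R_Const)
qed

text \<open>Modulo \<open>J\<close>, these are the combinations of the relations $y_{kk} D - N$, written as polynomials in
  the loop $y_{kk}$ with coefficients in \<open>R\<close>.\<close>

definition loop_rel :: "(nat \<times> nat, 'a) mpoly poly set" where
  "loop_rel = {F. \<exists>P Q. (\<forall>i. rep (coeff P i) (coeff Q i)) \<and> (\<forall>i. coeff (F - pCons 0 P + Q) i \<in> J)}"

lemma loop_relI:
  "(\<And>i. rep (coeff P i) (coeff Q i)) \<Longrightarrow> (\<And>i. coeff (F - pCons 0 P + Q) i \<in> J) \<Longrightarrow> F \<in> loop_rel"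
  unfolding loop_rel_def by blast

lemma loop_rel_add:
  assumes "F \<in> loop_rel" "F' \<in> loop_rel"
  shows "F + F' \<in> loop_rel"
proof -
  obtain P Q P' Q' where PQ: "\<And>i. rep (coeff P i) (coeff Q i)" "\<And>i. coeff (F - pCons 0 P + Q) i \<in> J"
    "\<And>i. rep (coeff P' i) (coeff Q' i)" "\<And>i. coeff (F' - pCons 0 P' + Q') i \<in> J"
    using assms unfolding loop_rel_def by blast
  have eq: "F + F' - pCons 0 (P + P') + (Q + Q') = (F - pCons 0 P + Q) + (F' - pCons 0 P' + Q')"
    by (simp add: algebra_simps)
  show ?thesis
    by (rule loop_relI[of "P + P'" "Q + Q'"]) (use PQ rep_add J_add in \<open>auto simp: eq simp del: add_pCons diff_pCons\<close>)
qed

lemma loop_rel_const: "f \<in> J \<Longrightarrow> [:f:] \<in> loop_rel"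
  by (rule loop_relI[of 0 0]) (auto simp: rep_zero coeff_pCons J_zero split: nat.split)

lemma loop_rel_smult:
  assumes "F \<in> loop_rel" "r \<in> R"
  shows "smult r F \<in> loop_rel"
proof -
  obtain P Q where PQ: "\<And>i. rep (coeff P i) (coeff Q i)" "\<And>i. coeff (F - pCons 0 P + Q) i \<in> J"
    using assms unfolding loop_rel_def by blast
  have eq: "smult r F - pCons 0 (smult r P) + smult r Q = smult r (F - pCons 0 P + Q)"
    by (simp add: smult_add_right smult_diff_right)
  show ?thesis
    by (rule loop_relI[of "smult r P" "smult r Q"]) (use PQ rep_mult J_mult assms in \<open>auto simp: eq\<close>)
qed

lemma loop_rel_pCons:
  assumes "F \<in> loop_rel"
  shows "pCons 0 F \<in> loop_rel"
proof -
  obtain P Q where PQ: "\<And>i. rep (coeff P i) (coeff Q i)" "\<And>i. coeff (F - pCons 0 P + Q) i \<in> J"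
    using assms unfolding loop_rel_def by blast
  have eq: "pCons 0 F - pCons 0 (pCons 0 P) + pCons 0 Q = pCons 0 (F - pCons 0 P + Q)"
    by simp
  show ?thesis
  proof (rule loop_relI[of "pCons 0 P" "pCons 0 Q"])
    show "rep (coeff (pCons 0 P) i) (coeff (pCons 0 Q) i)" for i
      using PQ(1) rep_zero by (simp add: coeff_pCons split: nat.split)
    show "coeff (pCons 0 F - pCons 0 (pCons 0 P) + pCons 0 Q) i \<in> J" for i
      unfolding eq using PQ(2) J_zero by (simp add: coeff_pCons split: nat.split del: coeff_add coeff_diff)
  qed
qed

lemma loop_rel_mult:
  assumes "p \<in> CR" "F \<in> loop_rel"
  shows "p * F \<in> loop_rel"
  using assms(1)
proof (induction p)
  case 0
  then show ?case using loop_rel_const[OF J_zero] by simp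
next
  case (pCons a p)
  have a: "a \<in> R" using pCons.prems by (auto simp: CR_def dest: spec[of _ 0])
  have "p \<in> CR" using pCons.prems by (auto simp: CR_def dest: spec[of _ "Suc _"])
  then have "pCons 0 (p * F) \<in> loop_rel" using pCons.IH loop_rel_pCons by blast
  then show ?case using a loop_rel_smult[OF assms(2)] loop_rel_add by simp
qed

lemma loop_rel_uminus: "F \<in> loop_rel \<Longrightarrow> - F \<in> loop_rel"
  using loop_rel_smult[of F "- 1"] R_diff[OF R_zero R_one] by simp

lemma loop_rel_loop_minor:
  assumes "distinct [k, a, b]" "distinct [k, c, d]"
    "\<forall>r\<in>{a, b}. \<forall>s\<in>{c, d}. okp V (insert k L) r s"
  shows "loop_poly (mn k a b k c d) \<in> loop_rel"
proof -
  have okv: "okv a c" "okv a d" "okv b c" "okv b d"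
    using assms by (auto simp: okv_def okp_def)
  have ex: "exok a c d b" using okv okv_commute by (auto simp: exok_def)
  have okk: "ok a c" "ok a d" "ok d b" "ok c b" "ok k a" "ok k b" "ok k c" "ok k d"
    using okvD[OF okv(1)] okvD[OF okv(4)] okvD[OF okv(2)] okvD[OF okv(3)] by simp_all
  have R: "DD a c d b \<in> R" "NN k a c d b \<in> R"
    unfolding DD_def NN_def nn_def by (intro R_closed okk)+
  have "loop_poly (mn k a b k c d) = [:0, 1:] * [:DD a c d b:] - [:NN k a c d b:]"
    unfolding loop_minor loop_poly_diff loop_poly_mult loop_poly_R[OF R(1)] loop_poly_R[OF R(2)]
    by (simp add: loop_poly_y)
  then have eq: "loop_poly (mn k a b k c d) = pCons 0 [:DD a c d b:] - [:NN k a c d b:]"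
    by simp
  show ?thesis
    unfolding eq
    by (rule loop_relI[of "[:DD a c d b:]" "[:NN k a c d b:]"])
      (auto simp: coeff_pCons rep_zero J_zero rep_DD[OF ex] split: nat.split)
qed

lemma R_minor: "\<forall>r\<in>{a, b, c}. \<forall>s\<in>{d, e, f}. ok r s \<Longrightarrow> mn a b c d e f \<in> R"
  unfolding mn_def by (intro R_closed) simp_all

lemma R_pentad:
  assumes "distinct [a, b, c, d, e]" "{a, b, c, d, e} \<subseteq> V - L"
  shows "pentf a b c d e \<in> R"
proof -
  have "ok r t" if "r \<in> {a, b, c, d, e}" "t \<in> {a, b, c, d, e}" "r \<noteq> t" for r t
    using that assms ok_outside by blast
  then show ?thesis
    unfolding pentf_def DD_def NN_def nn_def by (intro R_closed) (use assms in auto)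
qed

text \<open>The loop at \<open>k\<close> occurs in a minor only if \<open>k\<close> is both a row
  and a column; up to sign that minor is then a relation y_kk D - N. All other generators already
  belong to \<open>J\<close>.\<close>

lemma loop_rel_gen:
  assumes "s \<in> minors V (insert k L) \<union> pentads (V - insert k L)"
  shows "loop_poly s \<in> loop_rel"
  using assms
proof
  assume "s \<in> pentads (V - insert k L)"
  then obtain a b c d e where s: "s = pentf a b c d e" "distinct [a, b, c, d, e]"
    and "{a, b, c, d, e} \<subseteq> V - insert k L"
    unfolding pentads_def mem_Collect_eq by (elim exE conjE)
  then have s': "{a, b, c, d, e} \<subseteq> V - L" by auto
  have "s \<in> J" unfolding s(1) J_eq by (rule pentf_in_JJ[OF s(2) s'])
  then show ?thesis unfolding s(1) loop_poly_R[OF R_pentad[OF s(2) s']] by (rule loop_rel_const)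
next
  assume "s \<in> minors V (insert k L)"
  then obtain a b c d e f where s: "s = mn a b c d e f" "distinct [a, b, c]" "distinct [d, e, f]"
    and ok': "\<forall>r\<in>{a, b, c}. \<forall>s\<in>{d, e, f}. okp V (insert k L) r s"
    unfolding minors_def mem_Collect_eq by (elim exE conjE)
  show ?thesis
  proof (cases "k \<in> {a, b, c} \<and> k \<in> {d, e, f}")
    case False
    have ok: "\<forall>r\<in>{a, b, c}. \<forall>s\<in>{d, e, f}. ok r s"
    proof (intro ballI)
      fix r t assume rt: "r \<in> {a, b, c}" "t \<in> {d, e, f}"
      then have "okp V (insert k L) r t" using ok' by blast
      moreover have "\<not> (r = k \<and> t = k)" using False rt by blast
      ultimately show "ok r t" unfolding okp_def by blast
    qed
    show ?thesis unfolding s(1) loop_poly_R[OF R_minor[OF ok]] by (rule loop_rel_const[OF J_mn[OF ok]])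
  next
    case True
    note km = conjunct1[OF True] conjunct2[OF True]
    from mn_move_row[OF km(1) s(2), where 'a = 'a]
    obtain r t where rt: "distinct [k, r, t]" "{k, r, t} = {a, b, c}"
      "\<forall>d e f. mn a b c d e f = (mn k r t d e f :: (nat \<times> nat, 'a) mpoly) \<or>
         mn a b c d e f = - (mn k r t d e f :: (nat \<times> nat, 'a) mpoly)"
      by (elim exE conjE)
    from mn_move_row[OF km(2) s(3), where 'a = 'a]
    obtain u v where uv: "distinct [k, u, v]" "{k, u, v} = {d, e, f}"
      "\<forall>a b c. mn d e f a b c = (mn k u v a b c :: (nat \<times> nat, 'a) mpoly) \<or>
         mn d e f a b c = - (mn k u v a b c :: (nat \<times> nat, 'a) mpoly)"
      by (elim exE conjE)
    have m: "loop_poly (mn k r t k u v) \<in> loop_rel"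
      by (rule loop_rel_loop_minor[OF rt(1) uv(1)]) (use ok'[folded rt(2) uv(2)] in simp)
    have "mn k r t d e f = (mn k r t k u v :: (nat \<times> nat, 'a) mpoly) \<or>
        mn k r t d e f = - (mn k r t k u v :: (nat \<times> nat, 'a) mpoly)"
      using uv(3)[rule_format, of k r t] unfolding mn_transpose[of k r t] .
    then have "s = mn k r t k u v \<or> s = - mn k r t k u v"
      using rt(3)[rule_format, of d e f] s(1) by auto
    then show ?thesis using m loop_rel_uminus by (auto simp: loop_poly_uminus)
  qed
qed

lemma loop_rel_JJ:
  assumes "f \<in> JJ V (insert k L)"
  shows "loop_poly f \<in> loop_rel"
proof -
  have "ideal_of (polyring (evars V (insert k L))) (minors V (insert k L) \<union> pentads (V - insert k L))
      \<subseteq> {f. loop_poly f \<in> loop_rel}"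
  proof (rule ideal_of_subset)
    fix r s :: "(nat \<times> nat, 'a) mpoly"
    assume "r \<in> polyring (evars V (insert k L))" "s \<in> minors V (insert k L) \<union> pentads (V - insert k L)"
    then show "r * s \<in> {f. loop_poly f \<in> loop_rel}"
      using loop_rel_mult[OF loop_poly_CR loop_rel_gen] by (simp add: loop_poly_mult)
  next
    show "0 \<in> {f. loop_poly f \<in> loop_rel}"
      using loop_rel_const[OF J_zero] by (simp add: loop_poly_zero)
  qed (simp add: loop_poly_add loop_rel_add)
  then show ?thesis using assms unfolding JJ_def by blast
qed

text \<open>Since \<open>f\<close> is constant in the loop, the coefficients of positive powers give
  P_i = Q_(i+1) modulo \<open>J\<close>, and Q_(i+1) is the image of P_(i+1) under
  \<open>Psi\<close>. As \<open>Psi\<close> preserves \<open>J\<close>, membership descends from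
  P_(i+1) to P_i; finally f = - Q_0 modulo \<open>J\<close>.\<close>

lemma loop_elimination:
  assumes "f \<in> R" "f \<in> JJ V (insert k L)"
  shows "f \<in> J"
proof -
  obtain P Q where PQ: "\<And>i. rep (coeff P i) (coeff Q i)" "\<And>i. coeff ([:f:] - pCons 0 P + Q) i \<in> J"
    using loop_rel_JJ[OF assms(2)] unfolding loop_poly_R[OF assms(1)] loop_rel_def by blast
  have QJ: "coeff Q i \<in> J" if "coeff P i \<in> J" for i
  proof -
    have "Psi (coeff P i) - coeff Q i \<in> J"
      using PQ(1)[of i] R_one unfolding rep_def by fastforce
    then have "Psi (coeff P i) - (Psi (coeff P i) - coeff Q i) \<in> J"
      using Psi_J[OF that] J_diff by blast
    then show ?thesis by simp
  qed
  have PJ: "coeff P i \<in> J" if "coeff P (Suc i) \<in> J" for i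
  proof -
    have "coeff Q (Suc i) - coeff P i \<in> J"
      using PQ(2)[of "Suc i"] by (simp add: coeff_pCons)
    then have "coeff Q (Suc i) - (coeff Q (Suc i) - coeff P i) \<in> J"
      using QJ[OF that] J_diff by blast
    then show ?thesis by simp
  qed
  \<comment> \<open>The descent starts one place above the degree, where the coefficient is 0.
    Beyond \<open>degree P + 1\<close> steps the truncated difference stays at 0.\<close>
  have "coeff P (degree P + 1 - i) \<in> J" for i
  proof (induction i)
    case 0
    have "coeff P (degree P + 1) = 0" by (rule coeff_eq_0) simp
    then show ?case by (simp add: J_zero)
  next
    case (Suc i)
    show ?case
    proof (cases "i < degree P + 1")
      case True
      then have "degree P + 1 - i = Suc (degree P + 1 - Suc i)" by simp
      then show ?thesis using PJ Suc by metis
    next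
      case False
      then show ?thesis using Suc by simp
    qed
  qed
  from this[of "degree P + 1"] have "coeff P 0 \<in> J" by simp
  then have "coeff Q 0 \<in> J" by (rule QJ)
  moreover have "f + coeff Q 0 \<in> J" using PQ(2)[of 0] by (simp add: coeff_pCons)
  ultimately have "f + coeff Q 0 - coeff Q 0 \<in> J" by (intro J_diff)
  then show ?thesis by simp
qed

end

section \<open>The case of all loops\<close>

text \<open>For this weight the diagonal product is the strictly largest term of a minor with increasing
  rows and columns.\<close>

definition wt :: "(nat \<times> nat \<Rightarrow>\<^sub>0 nat) \<Rightarrow> nat" where
  "wt = wsum (\<lambda>e. fst e * snd e)"

lemma wt_add [simp]: "wt (X + Y) = wt X + wt Y"
  by (simp add: wt_def)

lemma wt_E [simp]: "wt (E a b) = a * b"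
  by (simp add: wt_def E_def yv_def max_def min_def)

lemma keys_empty_iff: "Poly_Mapping.keys m = {} \<longleftrightarrow> m = 0"
  by (auto intro: poly_mapping_eqI simp: in_keys_iff)

section \<open>Coefficients of the images of monomials\<close>

definition svar :: "nat \<Rightarrow> bool \<times> nat \<Rightarrow>\<^sub>0 nat" where
  "svar i = Poly_Mapping.single (False, i) 1"

definition tvar :: "nat \<Rightarrow> bool \<times> nat \<Rightarrow>\<^sub>0 nat" where
  "tvar i = Poly_Mapping.single (True, i) 1"

text \<open>A pair of monomials in the $y_{ij}$ is recorded by the exponents of the $s_i$, which are the
  degrees of the first, and those of the $t_i$, which are the degrees of the second.\<close>

definition bideg :: "(nat \<times> nat \<Rightarrow>\<^sub>0 nat) \<Rightarrow> (nat \<times> nat \<Rightarrow>\<^sub>0 nat) \<Rightarrow> (bool \<times> nat \<Rightarrow>\<^sub>0 nat) \<Rightarrow> bool" where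
  "bideg p q c \<longleftrightarrow> (\<forall>i. Poly_Mapping.lookup c (False, i) = dg i p \<and> Poly_Mapping.lookup c (True, i) = dg i q)"

lemma st_map_mon:
  "(st_map (i, j) :: (bool \<times> nat, 'a::comm_ring_1) mpoly) = mon (svar i + svar j) + mon (tvar i + tvar j)"
  by (simp add: st_map_def Var_def svar_def tvar_def mult_single)

lemma lookup_mon_mult: "Poly_Mapping.lookup (mon k * f) (k + c) = Poly_Mapping.lookup f c"
  for f :: "('v, 'a::comm_ring_1) mpoly"
proof -
  have "mon k * f = (\<Sum>m\<in>Poly_Mapping.keys f. Poly_Mapping.single (k + m) (Poly_Mapping.lookup f m))"
    by (subst (1) monomial_expansion[of f]) (simp add: sum_distrib_left mult_single)
  then have "Poly_Mapping.lookup (mon k * f) (k + c) =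
      (\<Sum>m\<in>Poly_Mapping.keys f. Poly_Mapping.lookup f m when m = c)"
    by (simp add: lookup_sum lookup_single when_def)
  also have "\<dots> = Poly_Mapping.lookup f c" by (auto simp: when_def in_keys_iff)
  finally show ?thesis .
qed

lemma lookup_mon_multE:
  fixes f :: "('v, 'a::comm_ring_1) mpoly"
  assumes "Poly_Mapping.lookup (mon k * f) c \<noteq> 0"
  obtains c' where "c = k + c'" "Poly_Mapping.lookup f c' \<noteq> 0"
proof -
  have "c \<in> Poly_Mapping.keys (mon k * f)" using assms by (simp add: in_keys_iff)
  then obtain c' where "c = k + c'" using Poly_Mapping.keys_mult[of "mon k" f] by (auto split: if_splits)
  then show thesis using assms that by (simp add: lookup_mon_mult)
qed

text \<open>Each edge contributes either its s-term or its t-term to a term of the product;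
  \<open>p\<close> collects the edges of the first kind and \<open>q\<close> the others.\<close>

lemma st_terms:
  fixes c :: "bool \<times> nat \<Rightarrow>\<^sub>0 nat"
  assumes "Poly_Mapping.lookup (mval st_map m :: (bool \<times> nat, 'a::comm_ring_1) mpoly) c \<noteq> 0"
  shows "\<exists>p q. m = p + q \<and> bideg p q c"
  using assms
proof (induction m arbitrary: c rule: mon_induct)
  case zero
  then have "c = 0" by (simp add: lookup_one when_def split: if_splits)
  then show ?case by (intro exI[of _ 0]) (simp add: bideg_def dg_def)
next
  case (add v m)
  let ?M = "mval st_map m :: (bool \<times> nat, 'a) mpoly"
  obtain i j where v: "v = (i, j)" by force
  have "Poly_Mapping.lookup (mon (svar i + svar j) * ?M + mon (tvar i + tvar j) * ?M) c \<noteq> 0"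
    using add.prems by (simp add: v mval_add st_map_mon distrib_right)
  then have "Poly_Mapping.lookup (mon (svar i + svar j) * ?M) c \<noteq> 0 \<or>
      Poly_Mapping.lookup (mon (tvar i + tvar j) * ?M) c \<noteq> 0"
    by (auto simp: lookup_add)
  then show ?case
  proof
    assume "Poly_Mapping.lookup (mon (svar i + svar j) * ?M) c \<noteq> 0"
    then obtain c' where c: "c = svar i + svar j + c'" "Poly_Mapping.lookup ?M c' \<noteq> 0"
      by (rule lookup_mon_multE)
    obtain p q where pq: "m = p + q" "bideg p q c'" using add.IH[OF c(2)] by blast
    have "bideg (Poly_Mapping.single v 1 + p) q c"
      using pq(2) by (auto simp: bideg_def c v dg_def svar_def lookup_add lookup_single when_def)
    then show ?thesis using pq(1) by (metis add.assoc)
  next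
    assume "Poly_Mapping.lookup (mon (tvar i + tvar j) * ?M) c \<noteq> 0"
    then obtain c' where c: "c = tvar i + tvar j + c'" "Poly_Mapping.lookup ?M c' \<noteq> 0"
      by (rule lookup_mon_multE)
    obtain p q where pq: "m = p + q" "bideg p q c'" using add.IH[OF c(2)] by blast
    have "bideg p (Poly_Mapping.single v 1 + q) c"
      using pq(2) by (auto simp: bideg_def c v dg_def tvar_def lookup_add lookup_single when_def)
    then show ?thesis using pq(1) by (metis add.left_commute)
  qed
qed

text \<open>Tightness excludes multinomial coefficients other than 1, whence the independence of the
  characteristic.\<close>

definition tight :: "(nat \<times> nat \<Rightarrow>\<^sub>0 nat) \<Rightarrow> (nat \<times> nat \<Rightarrow>\<^sub>0 nat) \<Rightarrow> bool" where
  "tight p q \<longleftrightarrow> (\<forall>p' q'. p' + q' = p + q \<longrightarrow> (\<forall>i. dg i p' = dg i p \<and> dg i q' = dg i q) \<longrightarrow> p' = p)"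

definition expo :: "(nat \<times> nat \<Rightarrow>\<^sub>0 nat) \<Rightarrow> (nat \<times> nat \<Rightarrow>\<^sub>0 nat) \<Rightarrow> bool \<times> nat \<Rightarrow>\<^sub>0 nat" where
  "expo p q = (\<Sum>v\<in>Poly_Mapping.keys p. Poly_Mapping.single (False, fst v) (Poly_Mapping.lookup p v)
       + Poly_Mapping.single (False, snd v) (Poly_Mapping.lookup p v))
    + (\<Sum>v\<in>Poly_Mapping.keys q. Poly_Mapping.single (True, fst v) (Poly_Mapping.lookup q v)
       + Poly_Mapping.single (True, snd v) (Poly_Mapping.lookup q v))"

lemma bideg_expo: "bideg p q (expo p q)"
  unfolding bideg_def expo_def dg_def wsum_def
  by (auto simp: lookup_add lookup_sum lookup_single when_def sum.distrib[symmetric] intro!: sum.cong)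

lemma bideg_unique: "bideg p q c \<Longrightarrow> bideg p q c' \<Longrightarrow> c = c'"
proof (rule poly_mapping_eqI)
  fix x :: "bool \<times> nat"
  assume "bideg p q c" "bideg p q c'"
  then show "Poly_Mapping.lookup c x = Poly_Mapping.lookup c' x"
    by (cases x; cases "fst x") (auto simp: bideg_def)
qed

lemma st_coefficient_t:
  assumes "bideg 0 q c"
  shows "Poly_Mapping.lookup (mval st_map q :: (bool \<times> nat, 'a::comm_ring_1) mpoly) c = 1"
  using assms
proof (induction q arbitrary: c rule: mon_induct)
  case zero
  have "bideg 0 0 0" by (simp add: bideg_def dg_def)
  then have "c = 0" using zero bideg_unique by blast
  then show ?case by simp
next
  case (add v q)
  let ?M = "mval st_map q :: (bool \<times> nat, 'a) mpoly"
  obtain i j where v: "v = (i, j)" by force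
  have "Poly_Mapping.lookup (mon (svar i + svar j) * ?M) c = 0"
  proof (rule ccontr)
    assume "Poly_Mapping.lookup (mon (svar i + svar j) * ?M) c \<noteq> 0"
    then obtain c' where "c = svar i + svar j + c'" by (rule lookup_mon_multE)
    then have "Poly_Mapping.lookup c (False, i) \<noteq> 0" by (simp add: lookup_add svar_def)
    then show False using add.prems by (simp add: bideg_def dg_def)
  qed
  moreover have c: "c = tvar i + tvar j + expo 0 q"
  proof (rule bideg_unique[OF add.prems])
    show "bideg 0 (Poly_Mapping.single v 1 + q) (tvar i + tvar j + expo 0 q)"
      using bideg_expo[of 0 q]
      by (auto simp: bideg_def v dg_def tvar_def lookup_add lookup_single when_def)
  qed
  moreover have "Poly_Mapping.lookup (mon (tvar i + tvar j) * ?M) c = 1"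
    unfolding c lookup_mon_mult by (rule add.IH[OF bideg_expo])
  ultimately show ?case
    by (simp add: mval_add v st_map_mon distrib_right lookup_add)
qed

text \<open>The edges of \<open>p\<close> are removed one by one. If such an edge contributed its
  t-term, the resulting decomposition would have the same degrees, and tightness would put the edge
  into \<open>q\<close> too, against disjointness. So the coefficient is unchanged until
  \<open>p\<close> is empty.\<close>

lemma st_coefficient:
  assumes "tight p q" "Poly_Mapping.keys p \<inter> Poly_Mapping.keys q = {}" "bideg p q c"
  shows "Poly_Mapping.lookup (mval st_map (p + q) :: (bool \<times> nat, 'a::comm_ring_1) mpoly) c = 1"
proof -
  have first: "Poly_Mapping.lookup (mval st_map (Poly_Mapping.single v 1 + (p + q)) :: (bool \<times> nat, 'a) mpoly)
        (svar (fst v) + svar (snd v) + c) = Poly_Mapping.lookup (mval st_map (p + q)) c \<and> tight p q"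
    if t: "tight (Poly_Mapping.single v 1 + p) q" and v: "v \<notin> Poly_Mapping.keys q" and c: "bideg p q c"
    for v p q c
  proof -
    obtain i j where ij: "v = (i, j)" by force
    let ?M = "mval st_map (p + q) :: (bool \<times> nat, 'a) mpoly"
    have "Poly_Mapping.lookup (mon (tvar i + tvar j) * ?M) (svar i + svar j + c) = 0"
    proof (rule ccontr)
      assume "Poly_Mapping.lookup (mon (tvar i + tvar j) * ?M) (svar i + svar j + c) \<noteq> 0"
      then obtain c' where c': "svar i + svar j + c = tvar i + tvar j + c'" "Poly_Mapping.lookup ?M c' \<noteq> 0"
        by (rule lookup_mon_multE)
      obtain p' q' where pq: "p + q = p' + q'" "bideg p' q' c'" using st_terms[OF c'(2)] by blast
      have lk: "Poly_Mapping.lookup (svar i + svar j + c) x = Poly_Mapping.lookup (tvar i + tvar j + c') x" for x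
        using c'(1) by simp
      have dp: "dg x p' = dg x (Poly_Mapping.single v 1 + p)" for x
        using lk[of "(False, x)"] c pq(2)
        by (auto simp: bideg_def ij dg_def svar_def tvar_def lookup_add lookup_single when_def)
      have dq: "dg x (Poly_Mapping.single v 1 + q') = dg x q" for x
        using lk[of "(True, x)"] c pq(2)
        by (auto simp: bideg_def ij dg_def svar_def tvar_def lookup_add lookup_single when_def)
      have "p' + (Poly_Mapping.single v 1 + q') = Poly_Mapping.single v 1 + p + q"
        unfolding add.assoc pq(1) by (rule add.left_commute)
      then have p': "p' = Poly_Mapping.single v 1 + p"
        using t dp dq unfolding tight_def by blast
      then have "p + q = p + (Poly_Mapping.single v 1 + q')" using pq(1) by (simp add: ac_simps)
      then have "q = Poly_Mapping.single v 1 + q'" by simp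
      then show False using v by (simp add: keys_add_nat)
    qed
    then have "Poly_Mapping.lookup (mval st_map (Poly_Mapping.single v 1 + (p + q)) :: (bool \<times> nat, 'a) mpoly)
        (svar i + svar j + c) = Poly_Mapping.lookup ?M c"
      by (simp add: mval_add ij st_map_mon distrib_right lookup_add lookup_mon_mult)
    moreover have "tight p q"
      unfolding tight_def
    proof (intro allI impI)
      fix p' q' assume "p' + q' = p + q" "\<forall>i. dg i p' = dg i p \<and> dg i q' = dg i q"
      then have "(Poly_Mapping.single v 1 + p') + q' = (Poly_Mapping.single v 1 + p) + q"
        "\<forall>i. dg i (Poly_Mapping.single v 1 + p') = dg i (Poly_Mapping.single v 1 + p) \<and> dg i q' = dg i q"
        by (simp_all add: add.assoc)
      then have "Poly_Mapping.single v 1 + p' = Poly_Mapping.single v 1 + p" using t unfolding tight_def by blast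
      then show "p' = p" by simp
    qed
    ultimately show ?thesis by (simp add: ij)
  qed
  show ?thesis
    using assms
  proof (induction p arbitrary: c rule: mon_induct)
    case zero
    then show ?case by (simp add: st_coefficient_t)
  next
    case (add v p)
    have v: "v \<notin> Poly_Mapping.keys q" and d: "Poly_Mapping.keys p \<inter> Poly_Mapping.keys q = {}"
      using add.prems(2) by (auto simp: keys_add_nat)
    have "bideg (Poly_Mapping.single v 1 + p) q (svar (fst v) + svar (snd v) + expo p q)"
      using bideg_expo[of p q]
      by (auto simp: bideg_def dg_def svar_def lookup_add lookup_single when_def)
    then have c: "c = svar (fst v) + svar (snd v) + expo p q"
      using add.prems(3) bideg_unique by blast
    note f = first[OF add.prems(1) v bideg_expo]
    show ?case
      unfolding c add.assoc[of _ p q] using f add.IH[OF conjunct2[OF f] d bideg_expo] by simp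
  qed
qed


section \<open>Chains and standard monomials\<close>

definition sdom :: "nat \<times> nat \<Rightarrow> nat \<times> nat \<Rightarrow> bool" where
  "sdom e f \<longleftrightarrow> fst e < fst f \<and> snd e < snd f"

text \<open>With an edge read as the interval from \<open>snd\<close> to \<open>fst\<close>, the
  edges of a chain are nested intervals. These are the chains of the order by inclusion, hence
  antichains for \<open>sdom\<close>.\<close>

definition chain :: "(nat \<times> nat \<Rightarrow>\<^sub>0 nat) \<Rightarrow> bool" where
  "chain p \<longleftrightarrow> (\<forall>e\<in>Poly_Mapping.keys p. \<forall>f\<in>Poly_Mapping.keys p. \<not> sdom e f)"

definition ordered :: "(nat \<times> nat \<Rightarrow>\<^sub>0 nat) \<Rightarrow> bool" where
  "ordered p \<longleftrightarrow> (\<forall>e\<in>Poly_Mapping.keys p. snd e \<le> fst e)"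

lemma ordered_add [simp]: "ordered (p + q) \<longleftrightarrow> ordered p \<and> ordered q"
  by (auto simp: ordered_def keys_add_nat)

lemma ordered_E [simp]: "ordered (E a b)"
  by (simp add: ordered_def yv_def)

lemma ordered_single: "snd e \<le> fst e \<Longrightarrow> Poly_Mapping.single e 1 = E (fst e) (snd e)"
  by (simp add: E_def yv_def max_def min_def) (metis le_antisym prod.collapse)

lemma dg_pos_iff: "dg i p > 0 \<longleftrightarrow> (\<exists>e\<in>Poly_Mapping.keys p. fst e = i \<or> snd e = i)"
proof
  assume pos: "dg i p > 0"
  show "\<exists>e\<in>Poly_Mapping.keys p. fst e = i \<or> snd e = i"
  proof (rule ccontr)
    assume "\<not> ?thesis"
    then have "dg i p = 0" unfolding dg_def wsum_def by (intro sum.neutral) auto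
    then show False using pos by simp
  qed
next
  assume "\<exists>e\<in>Poly_Mapping.keys p. fst e = i \<or> snd e = i"
  then obtain e X where "p = Poly_Mapping.single e 1 + X" "fst e = i \<or> snd e = i"
    by (metis keys_splitE)
  then show "dg i p > 0" by (auto simp: dg_def)
qed

text \<open>The widest of the nested intervals reaches both extreme vertices.\<close>

lemma chain_outer_edge:
  assumes "chain p" "ordered p" and hi: "dg hi p > 0" and lo: "dg lo p > 0"
    and bounds: "\<And>i. dg i p > 0 \<Longrightarrow> lo \<le> i \<and> i \<le> hi"
  shows "(hi, lo) \<in> Poly_Mapping.keys p"
proof -
  have b: "lo \<le> fst e \<and> fst e \<le> hi \<and> lo \<le> snd e \<and> snd e \<le> hi \<and> snd e \<le> fst e"
    if "e \<in> Poly_Mapping.keys p" for e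
  proof -
    have "dg (fst e) p > 0" "dg (snd e) p > 0" using that by (auto simp: dg_pos_iff)
    then show ?thesis using bounds[of "fst e"] bounds[of "snd e"] assms(2) that by (simp add: ordered_def)
  qed
  obtain e where e: "e \<in> Poly_Mapping.keys p" "fst e = hi"
    using hi b unfolding dg_pos_iff by (metis le_antisym)
  obtain f where f: "f \<in> Poly_Mapping.keys p" "snd f = lo"
    using lo b unfolding dg_pos_iff by (metis le_antisym)
  have "\<not> sdom f e" using assms(1) e f by (auto simp: chain_def)
  then have "fst f = hi \<or> snd e = lo"
    using b[OF e(1)] b[OF f(1)] e f by (auto simp: sdom_def)
  then show ?thesis using e f by (metis prod.collapse)
qed

text \<open>The degrees determine the outermost edge by \<open>chain_outer_edge\<close>; removing it
  leaves a smaller chain.\<close>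

lemma chain_unique:
  assumes "chain p" "ordered p" "chain p'" "ordered p'" "\<And>i. dg i p = dg i p'"
  shows "p = p'"
  using assms
proof (induction "tot p" arbitrary: p p' rule: less_induct)
  case less
  define S where "S = {i. dg i p > 0}"
  have S': "S = {i. dg i p' > 0}" using less.prems(5) by (simp add: S_def)
  have "S = (\<Union>e\<in>Poly_Mapping.keys p. {fst e, snd e})" by (auto simp: S_def dg_pos_iff)
  then have fin: "finite S" by simp
  show ?case
  proof (cases "S = {}")
    case True
    have "e \<notin> Poly_Mapping.keys p" for e
      using True dg_pos_iff[of "fst e" p] unfolding S_def by blast
    moreover have "e \<notin> Poly_Mapping.keys p'" for e
      using True dg_pos_iff[of "fst e" p'] unfolding S' by blast
    ultimately have "Poly_Mapping.keys p = {}" "Poly_Mapping.keys p' = {}" by blast+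
    then show ?thesis by (metis keys_empty_iff)
  next
    case False
    define hi lo where "hi = Max S" and "lo = Min S"
    have hl: "dg hi p > 0" "dg lo p > 0" "dg hi p' > 0" "dg lo p' > 0"
      using Max_in[OF fin False] Min_in[OF fin False] S' by (auto simp: hi_def lo_def S_def)
    have bd: "lo \<le> i \<and> i \<le> hi" if "dg i p > 0" for i
      using that Max_ge[OF fin, of i] Min_le[OF fin, of i] by (simp add: hi_def lo_def S_def)
    have bd': "lo \<le> i \<and> i \<le> hi" if "dg i p' > 0" for i
      using that bd less.prems(5) by simp
    have "(hi, lo) \<in> Poly_Mapping.keys p" "(hi, lo) \<in> Poly_Mapping.keys p'"
      using chain_outer_edge[OF less.prems(1,2) hl(1,2) bd] chain_outer_edge[OF less.prems(3,4) hl(3,4) bd']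
      by auto
    then obtain q q' where q: "p = Poly_Mapping.single (hi, lo) 1 + q" "p' = Poly_Mapping.single (hi, lo) 1 + q'"
      by (metis keys_splitE)
    have "q = q'"
    proof (rule less.hyps)
      show "tot q < tot p" by (simp add: q tot_def)
      show "chain q" "chain q'" using less.prems(1,3) by (auto simp: q chain_def keys_add_nat)
      show "ordered q" "ordered q'" using less.prems(2,4) by (auto simp: q)
      show "dg i q = dg i q'" for i using less.prems(5)[of i] by (simp add: q)
    qed
    then show ?thesis by (simp add: q)
  qed
qed

lemma rearrange: "x < x' \<Longrightarrow> z < z' \<Longrightarrow> x * z' + x' * z < x * z + x' * (z'::nat)"
proof -
  assume "x < x'" "z < z'"
  then obtain a b where "x' = x + Suc a" "z' = z + Suc b" by (metis less_iff_Suc_add add_Suc_right)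
  then show ?thesis by (simp add: algebra_simps)
qed

text \<open>Crossing two edges with \<open>sdom e f\<close> keeps the degrees and strictly lowers
  the weight. The descent can only stop at a chain, which \<open>chain_unique\<close> identifies as
  \<open>p\<close>.\<close>

lemma chain_minimal:
  assumes "chain p" "ordered p" "ordered p'" "\<And>i. dg i p' = dg i p"
  shows "wt p \<le> wt p' \<and> (wt p' = wt p \<longrightarrow> p' = p)"
  using assms(3,4)
proof (induction "wt p'" arbitrary: p' rule: less_induct)
  case less
  show ?case
  proof (cases "chain p'")
    case True
    then have "p' = p" using chain_unique assms(1,2) less.prems by metis
    then show ?thesis by simp
  next
    case False
    then obtain e f where ef: "e \<in> Poly_Mapping.keys p'" "f \<in> Poly_Mapping.keys p'" "sdom e f"
      by (auto simp: chain_def)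
    have so: "snd e \<le> fst e" "snd f \<le> fst f" using ef less.prems(1) by (auto simp: ordered_def)
    obtain X where X: "p' = Poly_Mapping.single e 1 + X" using ef(1) by (rule keys_splitE)
    have "f \<noteq> e" using ef(3) by (auto simp: sdom_def)
    then have "f \<in> Poly_Mapping.keys X" using ef(2) by (auto simp: X keys_add_nat)
    then obtain Y where Y: "X = Poly_Mapping.single f 1 + Y" by (rule keys_splitE)
    have p': "p' = E (fst e) (snd e) + (E (fst f) (snd f) + Y)"
      unfolding X Y ordered_single[OF so(1)] ordered_single[OF so(2)] ..
    define p'' where "p'' = E (fst e) (snd f) + (E (fst f) (snd e) + Y)"
    have lt: "wt p'' < wt p'"
      using rearrange[of "fst e" "fst f" "snd e" "snd f"] ef(3) by (simp add: p' p''_def sdom_def)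
    have "dg i p'' = dg i p" for i
      using less.prems(2)[of i] by (simp add: p' p''_def)
    moreover have "ordered p''" using less.prems(1) by (simp add: p' p''_def)
    ultimately have "wt p \<le> wt p''" using less.hyps[OF lt] by blast
    then show ?thesis using lt by simp
  qed
qed

text \<open>Three edges increasing for \<open>sdom\<close> are the diagonal of a minor, so these are
  the monomials that no diagonal term divides.\<close>

definition standard :: "(nat \<times> nat \<Rightarrow>\<^sub>0 nat) \<Rightarrow> bool" where
  "standard m \<longleftrightarrow> (\<forall>e\<in>Poly_Mapping.keys m. \<forall>f\<in>Poly_Mapping.keys m. \<forall>g\<in>Poly_Mapping.keys m.
     \<not> (sdom e f \<and> sdom f g))"

text \<open>\<open>A\<close> holds the edges that lie above another edge. Two edges of
  \<open>A\<close> related by \<open>sdom\<close> would extend downward to a forbidden triple, and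
  an edge outside \<open>A\<close> lies above none.\<close>

lemma standard_split:
  assumes "standard m" "ordered m"
  obtains p q where "m = p + q" "chain p" "chain q" "ordered p" "ordered q"
    "Poly_Mapping.keys p \<inter> Poly_Mapping.keys q = {}"
proof -
  define A where "A = {f. \<exists>e\<in>Poly_Mapping.keys m. sdom e f}"
  have "chain (restr A m)" using assms(1) by (auto simp: chain_def keys_restr A_def standard_def)
  moreover have "chain (restr (- A) m)" by (auto simp: chain_def keys_restr A_def)
  moreover have "ordered (restr A m)" "ordered (restr (- A) m)"
    using assms(2) by (auto simp: ordered_def keys_restr)
  moreover have "Poly_Mapping.keys (restr (- A) m) \<inter> Poly_Mapping.keys (restr A m) = {}"
    by (auto simp: keys_restr)
  ultimately show thesis using that[of "restr (- A) m" "restr A m"] by (simp add: restr_split)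
qed

lemma lookup_Const_mult: "Poly_Mapping.lookup (Const a * g) c = a * Poly_Mapping.lookup g c"
  unfolding Const_def mult_map_scale_conv_mult[symmetric] by (simp add: map.rep_eq when_def)

text \<open>For \<open>m\<close> of largest weight, split as p + q, consider the coefficient at
  \<open>expo p q\<close>. Any other monomial contributing there splits with the same degrees, so by
  \<open>chain_minimal\<close> its weight is at least that of \<open>m\<close>, with equality only
  for \<open>m\<close> itself. Nothing can cancel the coefficient 1.\<close>

lemma standard_independent:
  fixes f :: "(nat \<times> nat, 'a::comm_ring_1) mpoly"
  assumes std: "\<And>m. m \<in> Poly_Mapping.keys f \<Longrightarrow> standard m \<and> ordered m"
    and zero: "evalp Const st_map f = 0"
  shows "f = 0"
proof (rule ccontr)
  assume "f \<noteq> 0"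
  then have ne: "Poly_Mapping.keys f \<noteq> {}" by (metis keys_empty_iff)
  have "Max (wt ` Poly_Mapping.keys f) \<in> wt ` Poly_Mapping.keys f" using ne by (intro Max_in) auto
  then obtain m where m1: "m \<in> Poly_Mapping.keys f" "Max (wt ` Poly_Mapping.keys f) = wt m" by blast
  have "wt m' \<le> wt m" if "m' \<in> Poly_Mapping.keys f" for m'
    unfolding m1(2)[symmetric] using that by (intro Max_ge) auto
  note m = m1(1) this
  obtain p q where pq: "m = p + q" "chain p" "chain q" "ordered p" "ordered q"
    "Poly_Mapping.keys p \<inter> Poly_Mapping.keys q = {}"
    using standard_split std[OF m(1)] by metis
  have key: "p' = p \<and> q' = q"
    if "ordered (p' + q')" "wt (p' + q') \<le> wt m" "\<And>i. dg i p' = dg i p" "\<And>i. dg i q' = dg i q" for p' q'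
  proof -
    have "wt p \<le> wt p' \<and> (wt p' = wt p \<longrightarrow> p' = p)" "wt q \<le> wt q' \<and> (wt q' = wt q \<longrightarrow> q' = q)"
      using chain_minimal pq that by simp_all
    then show ?thesis using that(2) pq(1) by simp
  qed
  have tight: "tight p q"
    unfolding tight_def using key pq std[OF m(1)] by (metis order.refl)
  let ?c = "expo p q"
  have other: "Poly_Mapping.lookup (mval st_map m' :: (bool \<times> nat, 'a) mpoly) ?c = 0"
    if m': "m' \<in> Poly_Mapping.keys f" "m' \<noteq> m" for m'
  proof (rule ccontr)
    assume "Poly_Mapping.lookup (mval st_map m' :: (bool \<times> nat, 'a) mpoly) ?c \<noteq> 0"
    then obtain p' q' where "m' = p' + q'" "bideg p' q' ?c" using st_terms by blast
    then have "p' = p \<and> q' = q"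
      using key[of p' q'] std[OF m'(1)] m(2)[OF m'(1)] bideg_expo[of p q] by (simp add: bideg_def)
    then show False using m' pq(1) \<open>m' = p' + q'\<close> by simp
  qed
  have "Poly_Mapping.lookup (evalp Const st_map f) ?c
    = (\<Sum>m'\<in>Poly_Mapping.keys f. Poly_Mapping.lookup f m' * Poly_Mapping.lookup (mval st_map m') ?c)"
    by (simp add: evalp_def lin_def lookup_sum lookup_Const_mult)
  also have "\<dots> = (\<Sum>m'\<in>{m}. Poly_Mapping.lookup f m' * Poly_Mapping.lookup (mval st_map m') ?c)"
    by (rule sum.mono_neutral_right) (use m other in auto)
  also have "\<dots> = Poly_Mapping.lookup f m"
    using st_coefficient[OF tight pq(6) bideg_expo, where 'a = 'a] by (simp add: pq(1)[symmetric])
  finally have "Poly_Mapping.lookup f m = 0" using zero by simp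
  then show False using m(1) by (simp add: in_keys_iff)
qed

section \<open>Reduction to standard monomials\<close>

context
  fixes V :: "nat set" and R J :: "(nat \<times> nat, 'a::comm_ring_1) mpoly set"
  defines "R \<equiv> polyring (evars V V)" and "J \<equiv> JJ V V"
begin

definition reducible_to_standard :: "(nat \<times> nat, 'a) mpoly \<Rightarrow> bool" where
  "reducible_to_standard f \<longleftrightarrow> (\<exists>g\<in>R. f - g \<in> J \<and> (\<forall>m\<in>Poly_Mapping.keys g. standard m))"

lemma red_add:
  assumes "reducible_to_standard f" "reducible_to_standard f'"
  shows "reducible_to_standard (f + f')"
proof -
  obtain g g' where g: "g \<in> R" "f - g \<in> J" "\<forall>m\<in>Poly_Mapping.keys g. standard m"
    "g' \<in> R" "f' - g' \<in> J" "\<forall>m\<in>Poly_Mapping.keys g'. standard m"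
    using assms unfolding reducible_to_standard_def by blast
  have "f + f' - (g + g') = (f - g) + (f' - g')" by simp
  then have "f + f' - (g + g') \<in> J" using g(2,5) by (simp only: J_def JJ_def ideal_of_add)
  moreover have "g + g' \<in> R" using g by (simp add: R_def polyring_add)
  moreover have "\<forall>m\<in>Poly_Mapping.keys (g + g'). standard m" using g(3,6) Poly_Mapping.keys_add[of g g'] by blast
  ultimately show ?thesis unfolding reducible_to_standard_def by blast
qed

lemma red_Const:
  assumes "reducible_to_standard f"
  shows "reducible_to_standard (Const a * f)"
proof -
  obtain g where g: "g \<in> R" "f - g \<in> J" "\<forall>m\<in>Poly_Mapping.keys g. standard m"
    using assms unfolding reducible_to_standard_def by blast
  have "Const a * f - Const a * g = Const a * (f - g)" by (simp add: algebra_simps)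
  then have "Const a * f - Const a * g \<in> J"
    using g(2) unfolding J_def JJ_def by (simp add: ideal_of_polyring_mult polyring_Const)
  moreover have "Const a * g \<in> R" using g by (simp add: R_def polyring_mult polyring_Const)
  moreover have "\<forall>m\<in>Poly_Mapping.keys (Const a * g). standard m"
    using g(3) by (auto simp: in_keys_iff lookup_Const_mult)
  ultimately show ?thesis unfolding reducible_to_standard_def by blast
qed

lemma red_uminus: "reducible_to_standard f \<Longrightarrow> reducible_to_standard (- f)"
  using red_Const[of f "- 1"] by (simp add: Const_def single_uminus)

lemma red_diff: "reducible_to_standard f \<Longrightarrow> reducible_to_standard g \<Longrightarrow> reducible_to_standard (f - g)"
  using red_add[of f "- g"] red_uminus[of g] by simp

lemma red_J: "f \<in> J \<Longrightarrow> reducible_to_standard f"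
  unfolding reducible_to_standard_def by (intro bexI[of _ 0]) (simp_all add: R_def)

lemma red_mon:
  assumes "Poly_Mapping.keys m \<subseteq> evars V V"
  shows "reducible_to_standard (mon m)"
  using assms
proof (induction "wt m" arbitrary: m rule: less_induct)
  case less
  show ?case
  proof (cases "standard m")
    case True
    then show ?thesis
      unfolding reducible_to_standard_def using less.prems
      by (intro bexI[of _ "mon m"]) (simp_all add: R_def J_def JJ_def ideal_of.zero polyring_single)
  next
    case False
    then obtain e f g where efg: "e \<in> Poly_Mapping.keys m" "f \<in> Poly_Mapping.keys m" "g \<in> Poly_Mapping.keys m"
      "sdom e f" "sdom f g" by (auto simp: standard_def)
    define a b c i j l where "a = fst e" "b = fst f" "c = fst g" "i = snd e" "j = snd f" "l = snd g"
    note ab = this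
    have lt: "a < b" "b < c" "i < j" "j < l" using efg by (auto simp: ab sdom_def)
    have ev: "yv (fst x) (snd x) = x \<and> fst x \<in> V \<and> snd x \<in> V" if "x \<in> Poly_Mapping.keys m" for x
    proof -
      have "x \<in> evars V V" using that less.prems by blast
      then obtain u v where "x = yv u v" "okp V V u v" unfolding evars_def by blast
      then show ?thesis by (auto simp: okp_def yv_def max_def min_def)
    qed
    have yv: "yv a i = e" "yv b j = f" "yv c l = g" and V: "{a, b, c, i, j, l} \<subseteq> V"
      using ev efg by (simp_all add: ab)
    obtain X1 where X1: "m = E a i + X1" using efg(1) yv(1) E_splitE by metis
    have "f \<noteq> e" "g \<noteq> e" "g \<noteq> f" using lt by (auto simp: ab)
    then have "f \<in> Poly_Mapping.keys X1" "g \<in> Poly_Mapping.keys X1"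
      using efg X1 yv by (auto simp: keys_add_nat)
    then obtain X2 where X2: "X1 = E b j + X2" using yv(2) E_splitE by metis
    then have "g \<in> Poly_Mapping.keys X2"
      using \<open>g \<in> Poly_Mapping.keys X1\<close> \<open>g \<noteq> f\<close> yv by (auto simp: keys_add_nat)
    then obtain X where X: "X2 = E c l + X" using yv(3) E_splitE by metis
    have m: "m = E a i + (E b j + (E c l + X))" by (simp add: X1 X2 X)
    have XV: "Poly_Mapping.keys X \<subseteq> evars V V" using less.prems by (auto simp: m keys_add_nat)
    have okV: "okp V V r s" if "r \<in> {a, b, c}" "s \<in> {i, j, l}" for r s
      using that V by (auto simp: okp_def)
    have evV: "yv r s \<in> evars V V" if "r \<in> {a, b, c}" "s \<in> {i, j, l}" for r s
      unfolding evars_def using okV[OF that] by blast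
    have lower: "reducible_to_standard (mon (E a r + (E b s + (E c t + X))))"
      if "a * r + b * s + c * t < a * i + b * j + c * l" "{r, s, t} \<subseteq> {i, j, l}" for r s t
    proof (rule less.hyps)
      show "wt (E a r + (E b s + (E c t + X))) < wt m" using that(1) by (simp add: m)
      have "yv a r \<in> evars V V" "yv b s \<in> evars V V" "yv c t \<in> evars V V"
        using evV that(2) by simp_all
      then show "Poly_Mapping.keys (E a r + (E b s + (E c t + X))) \<subseteq> evars V V"
        using XV by (simp add: keys_add_nat)
    qed
    have w: "b * l + c * j < b * j + c * l" "a * j + b * i < a * i + b * j" "a * l + c * i < a * i + c * l"
      "b * l + c * i < b * i + c * l" "a * l + b * j < a * j + b * l"
      using rearrange lt by simp_all
    have r: "reducible_to_standard (mon (E a i + (E b l + (E c j + X))))"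
      "reducible_to_standard (mon (E a j + (E b i + (E c l + X))))"
      "reducible_to_standard (mon (E a j + (E b l + (E c i + X))))"
      "reducible_to_standard (mon (E a l + (E b i + (E c j + X))))"
      "reducible_to_standard (mon (E a l + (E b j + (E c i + X))))"
      by (rule lower; use w rearrange[of a b j l] rearrange[of a b i l] rearrange[of a b i j]
        rearrange[of b c i l] rearrange[of b c i j] rearrange[of a c j l] rearrange[of a c i j] lt in simp)+
    have mnJ: "mn a b c i j l * mon X \<in> J"
      unfolding J_def JJ_def mult.commute[of _ "mon X"]
      by (rule ideal_of_polyring_mult[OF mn_in_JJ[unfolded JJ_def]])
        (use okV XV in \<open>simp_all add: polyring_single\<close>)
    have eq: "mon m = mn a b c i j l * mon X + mon (E a i + (E b l + (E c j + X)))
       + mon (E a j + (E b i + (E c l + X))) - mon (E a j + (E b l + (E c i + X)))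
       - mon (E a l + (E b i + (E c j + X))) + mon (E a l + (E b j + (E c i + X)))"
      unfolding m mon_E_add mn_def by (simp add: algebra_simps)
    show ?thesis unfolding eq by (intro red_add red_diff red_J mnJ r)
  qed
qed

text \<open>\<open>f\<close> and its standard form have the same image, which is 0, so independence
  of the standard monomials makes the standard form vanish.\<close>

lemma base_case:
  assumes f: "f \<in> R" "evalp Const st_map f = 0"
    and minors_zero: "\<And>g. g \<in> J \<Longrightarrow> evalp Const (st_map :: _ \<Rightarrow> (bool \<times> nat, 'a) mpoly) g = 0"
  shows "f \<in> J"
proof -
  have "reducible_to_standard f"
    using f(1) unfolding R_def
  proof (induction f rule: polyring_induct)
    case zero
    show ?case by (rule red_J) (simp add: J_def JJ_def ideal_of.zero)
  qed (auto intro: red_add red_Const red_mon)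
  then obtain g where g: "g \<in> R" "f - g \<in> J" "\<forall>m\<in>Poly_Mapping.keys g. standard m"
    unfolding reducible_to_standard_def by blast
  have "evalp Const (st_map :: _ \<Rightarrow> (bool \<times> nat, 'a) mpoly) g = 0"
    using minors_zero[OF g(2)] f(2) by (simp add: psub.evalp_diff)
  moreover have "ordered m" if "m \<in> Poly_Mapping.keys g" for m
    using that g(1) by (fastforce simp: R_def polyring_def evars_def ordered_def yv_def)
  ultimately have "g = 0" using standard_independent[of g] g(3) by blast
  then show ?thesis using g(2) by simp
qed

end

section \<open>Orbits of the pentad and of the minor\<close>

lemma offdiag_minor_eq: "offdiag_minor = (mn 4 5 6 1 2 3 :: (nat \<times> nat, 'a::comm_ring_1) mpoly)"
proof -
  have S: "{1..3::nat} = {1, 2, 3}" by auto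
  have P: "(\<Prod>r\<in>{1..3::nat}. Var (yv (r + 3) (p r))) =
    (y 4 (p 1) * (y 5 (p 2) * y 6 (p 3)) :: (nat \<times> nat, 'a) mpoly)" for p
    unfolding S by (simp add: y_def del: One_nat_def)
  have id: "{p. p permutes ({} :: nat set)} = {id}" by (auto simp: permutes_empty)
  show ?thesis
    unfolding offdiag_minor_def P unfolding S
    by (simp add: sum_over_permutations_insert id sign_compose permutation_compose permutation_swap_id
        sign_swap_id transpose_def Const_def mn_def algebra_simps single_uminus)
qed

text \<open>The 120 permutations describe 12 five-cycles, each ten times: five starting points and
  two directions. Rotations and reflections of a five-cycle are even, so the ten signs
  agree.\<close>

lemma pentad_sum:
  "(\<Sum>\<pi>\<in>{\<pi>. \<pi> permutes {1..5::nat}}.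
      Const (sign \<pi>) * (\<Prod>k\<in>{1..5::nat}. Var (yv (\<pi> k) (\<pi> (k mod 5 + 1))))) =
   (10 * (- pentf 1 2 3 4 5) :: (nat \<times> nat, int) mpoly)"
proof -
  have S: "{1..5::nat} = {1, 2, 3, 4, 5}" by auto
  have P: "(\<Prod>k\<in>{1..5::nat}. Var (yv (\<pi> k) (\<pi> (k mod 5 + 1)))) =
    (y (\<pi> 1) (\<pi> 2) * (y (\<pi> 2) (\<pi> 3) * (y (\<pi> 3) (\<pi> 4) * (y (\<pi> 4) (\<pi> 5) * y (\<pi> 5) (\<pi> 1)))) :: (nat \<times> nat, int) mpoly)" for \<pi>
  proof -
    have m: "(1::nat) mod 5 + 1 = 2" "(2::nat) mod 5 + 1 = 3" "(3::nat) mod 5 + 1 = 4"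
      "(4::nat) mod 5 + 1 = 5" "(5::nat) mod 5 + 1 = 1" by simp_all
    show ?thesis unfolding S by (simp add: y_def m del: One_nat_def)
  qed
  have id: "{p. p permutes ({} :: nat set)} = {id}" by (auto simp: permutes_empty)
  show ?thesis
    unfolding P unfolding S
    by (simp add: sum_over_permutations_insert id sign_compose permutation_compose permutation_swap_id
        sign_swap_id transpose_def Const_def poly_defs algebra_simps single_uminus y_commute)
qed


lemma coeff_hom_of_int: "coeff_hom (\<lambda>c::int. Const (of_int c) :: ('v, 'a::comm_ring_1) mpoly)"
  by unfold_locales (simp_all add: Const_def single_add mult_single del: single_of_int)

lemma lookup_map: "h 0 = 0 \<Longrightarrow> Poly_Mapping.lookup (Poly_Mapping.map h f) k = h (Poly_Mapping.lookup f k)"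
  by (simp add: map.rep_eq when_def)

lemma mval_Var: "mval Var m = (mon m :: ('v, 'a::comm_ring_1) mpoly)"
proof (induction m rule: mon_induct)
  case (add v m)
  then show ?case by (simp add: mval_add mult_single Var_def add.commute)
qed simp

text \<open>As an evaluation homomorphism, the change of coefficients can be pushed through the
  formula for the pentad.\<close>

lemma map_of_int_conv_evalp:
  "Poly_Mapping.map of_int f = (evalp (\<lambda>c. Const (of_int c)) Var f :: ('v, 'a::comm_ring_1) mpoly)"
proof (rule poly_mapping_eqI)
  fix k
  have "Poly_Mapping.lookup (evalp (\<lambda>c. Const (of_int c)) Var f :: ('v, 'a) mpoly) k =
      (\<Sum>m\<in>Poly_Mapping.keys f. of_int (Poly_Mapping.lookup f m) when m = k)"
    by (simp add: evalp_def lin_def mval_Var Const_def mult_single lookup_sum lookup_single del: single_of_int)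
  also have "\<dots> = of_int (Poly_Mapping.lookup f k)" by (auto simp: when_def in_keys_iff)
  finally show "Poly_Mapping.lookup (Poly_Mapping.map of_int f :: ('v, 'a) mpoly) k =
      Poly_Mapping.lookup (evalp (\<lambda>c. Const (of_int c)) Var f) k"
    by (simp add: lookup_map)
qed

lemma pentad_eq: "pentad = (- pentf 1 2 3 4 5 :: (nat \<times> nat, 'a::comm_ring_1) mpoly)"
proof -
  interpret h: coeff_hom "\<lambda>c::int. Const (of_int c) :: (nat \<times> nat, 'a) mpoly"
    by (rule coeff_hom_of_int)
  have ten: "(10 :: (nat \<times> nat, int) mpoly) = Const 10"
    by (simp add: Const_def)
  \<comment> \<open>The sum is ten times an integer polynomial, so the coefficientwise
    \<open>div 10\<close> is exact.\<close>
  have Z: "pentad_Z = - pentf 1 2 3 4 5"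
    unfolding pentad_Z_def pentad_sum ten
    by (rule poly_mapping_eqI) (subst lookup_map, simp, subst lookup_Const_mult, simp)
  show ?thesis
    by (simp only: pentad_def map_of_int_conv_evalp Z poly_defs y_def h.evalp_simps)
qed

lemma evalp_relabel_y:
  "evalp Const (\<lambda>(i, j). Var (yv (\<sigma> i) (\<sigma> j))) (y a b) = (y (\<sigma> a) (\<sigma> b) :: (nat \<times> nat, 'a::comm_ring_1) mpoly)"
  unfolding y_def psub.evalp_Var by (auto simp: yv_def[of a b] max_def min_def yv_commute)

lemma sym_act_offdiag_minor:
  "sym_act \<sigma> offdiag_minor = (mn (\<sigma> 4) (\<sigma> 5) (\<sigma> 6) (\<sigma> 1) (\<sigma> 2) (\<sigma> 3) :: (nat \<times> nat, 'a::comm_ring_1) mpoly)"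
  unfolding sym_act_def psubst_conv_evalp offdiag_minor_eq mn_def
  by (simp only: psub.evalp_simps evalp_relabel_y)

lemma sym_act_pentad:
  "sym_act \<sigma> pentad = (- pentf (\<sigma> 1) (\<sigma> 2) (\<sigma> 3) (\<sigma> 4) (\<sigma> 5) :: (nat \<times> nat, 'a::comm_ring_1) mpoly)"
  unfolding sym_act_def psubst_conv_evalp pentad_eq poly_defs
  by (simp only: psub.evalp_simps evalp_relabel_y)

lemma permutation_extending:
  assumes "length xs = length ys" "distinct xs" "distinct ys" "set xs \<subseteq> V" "set ys \<subseteq> V"
  shows "\<exists>\<sigma>. \<sigma> permutes V \<and> map \<sigma> xs = ys"
  using assms
proof (induction xs ys rule: list_induct2)
  case Nil
  then show ?case using permutes_id[of V, unfolded id_def] by (intro exI[of _ "\<lambda>u. u"]) simp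
next
  case (Cons x xs z zs)
  then obtain \<sigma> where \<sigma>: "\<sigma> permutes V" "map \<sigma> xs = zs" by auto
  \<comment> \<open>The correction moves \<open>\<sigma> x\<close> to \<open>z\<close>. By
    injectivity and distinctness, the values already arranged differ from both and stay
    fixed.\<close>
  let ?\<tau> = "transpose (\<sigma> x) z \<circ> \<sigma>"
  have "\<sigma> x \<in> V" "z \<in> V" using Cons.prems \<sigma>(1) by (auto simp: permutes_in_image)
  then have perm: "?\<tau> permutes V" using \<sigma>(1) by (intro permutes_compose permutes_swap_id)
  have same: "?\<tau> u = \<sigma> u" if "u \<in> set xs" for u
  proof -
    have "\<sigma> u \<in> set zs" using \<sigma>(2) that by auto
    then have "\<sigma> u \<noteq> z" using Cons.prems by auto
    moreover have "\<sigma> u \<noteq> \<sigma> x" using that Cons.prems permutes_inj[OF \<sigma>(1)] by (auto dest: injD)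
    ultimately show ?thesis by (simp add: transpose_apply_other)
  qed
  from same have "map ?\<tau> xs = zs" using \<sigma>(2) by (metis (no_types, lifting) map_cong)
  then have "map ?\<tau> (x # xs) = z # zs" by simp
  from conjI[OF perm this] show ?case by (rule exI[of _ ?\<tau>])
qed

section \<open>Vanishing of the generators in the target\<close>

lemma evalp_st_y:
  "evalp Const st_map (y a b) = (Var (False, a) * Var (False, b) + Var (True, a) * Var (True, b)
     :: (bool \<times> nat, 'a::comm_ring_1) mpoly)"
  unfolding y_def psub.evalp_Var by (auto simp: yv_def st_map_def max_def min_def mult.commute)

text \<open>The image matrix is the product of a 3 x 2 and a 2 x 3 matrix, so its determinant is
  0.\<close>

lemma evalp_st_mn: "evalp Const st_map (mn a b c d e f) = (0 :: (bool \<times> nat, 'a::comm_ring_1) mpoly)"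
  unfolding mn_def by (simp only: psub.evalp_simps evalp_st_y) (simp add: algebra_simps)

text \<open>In the target every \<open>NN k\<close> is s_k^2 + t_k^2 times its tetrad, so the two
  products in the pentad cancel.\<close>

lemma evalp_st_pentf: "evalp Const st_map (pentf k a b c d) = (0 :: (bool \<times> nat, 'a::comm_ring_1) mpoly)"
proof -
  have N: "evalp Const st_map (NN k a b c d) =
      evalp Const st_map (y k k) * (evalp Const st_map (DD a b c d) :: (bool \<times> nat, 'a) mpoly)" for a b c d
    unfolding NN_def nn_def DD_def by (simp only: psub.evalp_simps evalp_st_y) (simp add: algebra_simps)
  show ?thesis unfolding pentf_def by (simp only: psub.evalp_simps N) (simp add: algebra_simps)
qed

lemma evalp_st_JJ:
  assumes "f \<in> JJ V L"
  shows "evalp Const st_map f = (0 :: (bool \<times> nat, 'a::comm_ring_1) mpoly)"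
proof -
  have "ideal_of (polyring (evars V L)) (minors V L \<union> pentads (V - L))
      \<subseteq> {f. evalp Const st_map f = (0 :: (bool \<times> nat, 'a) mpoly)}"
    by (rule ideal_of_subset)
      (auto simp: psub.evalp_simps minors_def pentads_def evalp_st_mn evalp_st_pentf)
  then show ?thesis using assms unfolding JJ_def by blast
qed

section \<open>The ideal of the two-factor model\<close>

lemma kernel_in_JJ:
  fixes f :: "(nat \<times> nat, 'a::comm_ring_1) mpoly"
  assumes "finite V" "L \<subseteq> V" "f \<in> polyring (evars V L)" "evalp Const st_map f = 0"
  shows "f \<in> JJ V L"
  using assms
proof (induction "card (V - L)" arbitrary: L)
  case 0
  then have "L = V" by auto
  then show ?case using base_case[of f V] 0 evalp_st_JJ by blast
next
  case (Suc n)
  then obtain k where k: "k \<in> V" "k \<notin> L"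
    by (metis Diff_eq_empty_iff card.empty nat.distinct(1) subsetI)
  interpret loop_step V L k "polyring (evars V L)" "JJ V L :: (nat \<times> nat, 'a) mpoly set"
    using Suc.prems k by unfold_locales auto
  have "evars V L \<subseteq> evars V (insert k L)" unfolding evars_def okp_def by blast
  then have f: "f \<in> polyring (evars V (insert k L))"
    using Suc.prems(3) polyring_mono by blast
  have "V - insert k L = (V - L) - {k}" by auto
  then have "n = card (V - insert k L)" using Suc.hyps(2) k Suc.prems(1) by simp
  then have "f \<in> JJ V (insert k L)" using Suc.hyps(1) Suc.prems f k by blast
  then show ?case by (rule loop_elimination[OF Suc.prems(3)])
qed

lemma evars_eq_Yvars: "evars {1..n} {} = Yvars n"
proof
  show "evars {1..n} {} \<subseteq> Yvars n"
    by (auto simp: evars_def okp_def Yvars_def yv_def max_def min_def)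
  show "Yvars n \<subseteq> evars {1..n} {}"
  proof
    fix e assume "e \<in> Yvars n"
    then obtain i j where "e = (i, j)" "1 \<le> j" "j < i" "i \<le> n" by (auto simp: Yvars_def)
    then have "e = yv i j" "okp {1..n} {} i j" by (auto simp: okp_def yv_def)
    then show "e \<in> evars {1..n} {}" unfolding evars_def by blast
  qed
qed

lemma Rpoly_eq: "Rpoly n = polyring (evars {1..n} {})"
  unfolding Rpoly_def polyring_def evars_eq_Yvars ..

text \<open>Without loops, rows and columns of a minor are disjoint. Minors and pentads are then
  indexed by sequences of six or five distinct vertices, and the symmetric group is transitive on
  each kind.\<close>

lemma JJ_eq_gen_ideal:
  assumes n: "n \<ge> 6"
  shows "JJ {1..n} {} = gen_ideal (Rpoly n)
    (orbit_Sym n pentad \<union> orbit_Sym n (offdiag_minor :: (nat \<times> nat, 'a::comm_ring_1) mpoly))"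
    (is "_ = gen_ideal _ ?S")
proof -
  let ?R = "polyring (evars {1..n} {}) :: (nat \<times> nat, 'a) mpoly set"
  have gen: "gen_ideal (Rpoly n) ?S = ideal_of ?R ?S"
    unfolding Rpoly_eq by (rule gen_ideal_conv_ideal_of) (auto intro: polyring_add)
  have minors: "mn a b c d e f \<in> ?S" if d: "distinct [a, b, c]" "distinct [d, e, f]"
    and ok: "\<forall>r\<in>{a, b, c}. \<forall>s\<in>{d, e, f}. okp {1..n} {} r s" for a b c d e f
  proof -
    have ds: "distinct [a, b, c, d, e, f]" "set [a, b, c, d, e, f] \<subseteq> {1..n}"
      using d ok by (simp_all add: okp_def)
    have "\<exists>\<sigma>. \<sigma> permutes {1..n} \<and> map \<sigma> [4, 5, 6, 1, 2, 3] = [a, b, c, d, e, f]"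
      by (rule permutation_extending) (use ds n in simp_all)
    then obtain \<sigma> where \<sigma>: "\<sigma> permutes {1..n}" "\<sigma> 4 = a" "\<sigma> 5 = b" "\<sigma> 6 = c" "\<sigma> 1 = d" "\<sigma> 2 = e" "\<sigma> 3 = f"
      by auto
    have "mn a b c d e f = sym_act \<sigma> (offdiag_minor :: (nat \<times> nat, 'a) mpoly)"
      unfolding sym_act_offdiag_minor \<sigma>(2-7) ..
    then show ?thesis using \<sigma>(1) unfolding orbit_Sym_def by blast
  qed
  have pentads: "- pentf a b c d e \<in> ?S" if d: "distinct [a, b, c, d, e]" "{a, b, c, d, e} \<subseteq> {1..n}" for a b c d e
  proof -
    have "\<exists>\<sigma>. \<sigma> permutes {1..n} \<and> map \<sigma> [1, 2, 3, 4, 5] = [a, b, c, d, e]"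
      by (rule permutation_extending) (use d n in simp_all)
    then obtain \<sigma> where \<sigma>: "\<sigma> permutes {1..n}" "\<sigma> 1 = a" "\<sigma> 2 = b" "\<sigma> 3 = c" "\<sigma> 4 = d" "\<sigma> 5 = e"
      by auto
    have "- pentf a b c d e = sym_act \<sigma> (pentad :: (nat \<times> nat, 'a) mpoly)"
      unfolding sym_act_pentad \<sigma>(2-6) ..
    then show ?thesis using \<sigma>(1) unfolding orbit_Sym_def by blast
  qed
  have "JJ {1..n} {} \<subseteq> ideal_of ?R ?S"
    unfolding JJ_def
  proof (rule ideal_of_subset)
    fix r s :: "(nat \<times> nat, 'a) mpoly"
    assume r: "r \<in> ?R" and "s \<in> minors {1..n} {} \<union> pentads ({1..n} - {})"
    then consider a b c d e f where "s = mn a b c d e f" "distinct [a, b, c]" "distinct [d, e, f]"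
        "\<forall>r\<in>{a, b, c}. \<forall>s\<in>{d, e, f}. okp {1..n} {} r s"
      | a b c d e where "s = pentf a b c d e" "distinct [a, b, c, d, e]" "{a, b, c, d, e} \<subseteq> {1..n} - {}"
      unfolding minors_def pentads_def Un_iff mem_Collect_eq by (elim disjE exE conjE)
    then show "r * s \<in> ideal_of ?R ?S"
    proof cases
      case 1
      then show ?thesis using minors[OF 1(2-4)] ideal_of.step[OF ideal_of.zero r] by fastforce
    next
      case 2
      have "- pentf a b c d e \<in> ?S" by (rule pentads) (use 2 in simp_all)
      then have "0 + (- r) * (- pentf a b c d e) \<in> ideal_of ?R ?S"
        by (intro ideal_of.step ideal_of.zero polyring_uminus r)
      then show ?thesis using 2(1) by simp
    qed
  qed (auto intro: ideal_of_add ideal_of.zero)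
  moreover have "ideal_of ?R ?S \<subseteq> JJ {1..n} {}"
  proof (rule ideal_of_subset)
    fix r s :: "(nat \<times> nat, 'a) mpoly"
    assume r: "r \<in> ?R" and "s \<in> ?S"
    then obtain \<sigma> where \<sigma>: "\<sigma> permutes {1..n}" "s = sym_act \<sigma> pentad \<or> s = sym_act \<sigma> offdiag_minor"
      unfolding orbit_Sym_def by blast
    have inj: "\<sigma> i = \<sigma> j \<longleftrightarrow> i = j" for i j using permutes_inj[OF \<sigma>(1)] by (auto dest: injD)
    have im: "\<sigma> i \<in> {1..n}" if "i \<in> {1..6}" for i
      using that n permutes_in_image[OF \<sigma>(1), of i] by auto
    have V: "\<sigma> 1 \<in> {1..n}" "\<sigma> 2 \<in> {1..n}" "\<sigma> 3 \<in> {1..n}" "\<sigma> 4 \<in> {1..n}" "\<sigma> 5 \<in> {1..n}" "\<sigma> 6 \<in> {1..n}"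
      by (rule im; simp)+
    from \<sigma>(2) have "s \<in> JJ {1..n} {}"
    proof
      assume s: "s = sym_act \<sigma> pentad"
      have "(pentf (\<sigma> 1) (\<sigma> 2) (\<sigma> 3) (\<sigma> 4) (\<sigma> 5) :: (nat \<times> nat, 'a) mpoly) \<in> JJ {1..n} {}"
        by (rule pentf_in_JJ) (use V inj in simp_all)
      then show ?thesis unfolding s sym_act_pentad JJ_def by (rule ideal_of_polyring_uminus)
    next
      assume s: "s = sym_act \<sigma> offdiag_minor"
      show ?thesis unfolding s sym_act_offdiag_minor
        by (rule mn_in_JJ) (use V inj in \<open>simp add: okp_def\<close>)
    qed
    then show "r * s \<in> JJ {1..n} {}" using r unfolding JJ_def by (rule ideal_of_polyring_mult)
  qed (auto simp: JJ_def intro: ideal_of_add ideal_of.zero)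
  ultimately show ?thesis using gen by auto
qed

lemma JJ_subset_polyring: "JJ V L \<subseteq> polyring (evars V L)"
  unfolding JJ_def
proof (rule ideal_of_subset)
  fix r s :: "(nat \<times> nat, 'a::comm_ring_1) mpoly"
  assume r: "r \<in> polyring (evars V L)" and "s \<in> minors V L \<union> pentads (V - L)"
  then have "s \<in> polyring (evars V L)"
  proof (elim UnE)
    assume "s \<in> minors V L"
    then obtain a b c d e f where s: "s = mn a b c d e f"
      and ok: "\<forall>r\<in>{a, b, c}. \<forall>s\<in>{d, e, f}. okp V L r s"
      unfolding minors_def mem_Collect_eq by (elim exE conjE)
    show ?thesis unfolding s mn_def
      by (intro polyring_add polyring_diff polyring_mult y_in_polyring) (use ok in simp_all)
  next
    assume "s \<in> pentads (V - L)"
    then obtain a b c d e where s: "s = pentf a b c d e" "distinct [a, b, c, d, e]"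
      "{a, b, c, d, e} \<subseteq> V - L"
      unfolding pentads_def mem_Collect_eq by (elim exE conjE)
    have ok: "okp V L r t" if "r \<in> {a, b, c, d, e}" "t \<in> {a, b, c, d, e}" "r \<noteq> t" for r t
      using that s(3) by (auto simp: okp_def)
    show ?thesis unfolding s(1) pentf_def DD_def NN_def nn_def
      by (intro polyring_add polyring_diff polyring_mult y_in_polyring; rule ok) (use s(2) in auto)
  qed
  then show "r * s \<in> polyring (evars V L)" using r by (intro polyring_mult)
qed (auto intro: polyring_add)

theorem theorem1p7:
  fixes n :: nat
  assumes "n \<ge> 6"
  shows "(In_ideal n :: (nat \<times> nat, 'a::field) mpoly set)
           = gen_ideal (Rpoly n) (orbit_Sym n pentad \<union> orbit_Sym n offdiag_minor)"
  unfolding JJ_eq_gen_ideal[OF assms, symmetric]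
proof
  show "In_ideal n \<subseteq> (JJ {1..n} {} :: (nat \<times> nat, 'a) mpoly set)"
    unfolding In_ideal_def Rpoly_eq psubst_conv_evalp using kernel_in_JJ[of "{1..n}" "{}"] by auto
  show "(JJ {1..n} {} :: (nat \<times> nat, 'a) mpoly set) \<subseteq> In_ideal n"
    unfolding In_ideal_def Rpoly_eq psubst_conv_evalp
    using JJ_subset_polyring evalp_st_JJ by blast
qed

end
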